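(* Let $p$ be a prime, let $d\in\mathbb{N}$ and suppose $0\le h\le p-2$. Let $\gamma\in \mathrm{PDP}^d_{\le p-2}\cup\mathrm{IDP}^d_{p-1}$. Then: (1) $\operatorname{LM}(\theta(\gamma))=\Lambda(\gamma)$. (2) If $\gamma\in\mathrm{PDP}^d_{\le p-2}(h)$ then $\theta(\gamma)$ lies in $\mathbf{F}[d\,V_2]^{C_p}_{(1,1,\dots,1)}\cong(\otimes^dV_2)^{C_p}$ and has length $h+1$. (3) If $\gamma\in\mathrm{IDP}^d_{p-1}$ then $\theta(\gamma)$ lies in $\mathbf{F}[d\,V_2]^{C_p}_{(1,1,\dots,1)}\cong(\otimes^dV_2)^{C_p}$ and has length $p$. (4) The set $$B=\{x_i\mid 1\le i\le d\}\cup\{u_{ij}\mid 1\le i<j\le d\}\cup\Big\{\operatorname{Tr}\Big(\prod_{i=1}^dy_i^{e_i}\Big)\ \Big|\ 0\le e_i\le1 \text{ for all } i\Big\}$$ is a SAGBI basis in multi-degree $(1,1,\dots,1)$ for $\mathbf{F}[d\,V_2]^{C_p}$. Furthermore, there is the following decomposition of the $C_p$-representation $\otimes^dV_2\cong \mathbf{F}[d\,V_2]_{(1,\dots,1)}$ into indecomposable summands: $$\bigotimes^d V_2\ \cong\bigoplus_{\gamma\in\mathrm{PDP}^d_{\le p-2}\cup\mathrm{IDP}^d_{p-1}}V(\gamma),$$ where $V(\gamma)\cong V_{k+1}$ is the $C_p$-module generated by $\theta'(\gamma)$, with socle spanned by $\theta(\gamma)$, and $k=\ell(\theta(\gamma))-1$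 equals the finishing height of $\gamma$ if $\gamma\in\mathrm{PDP}^d_{\le p-2}$, and equals $p-1$ if $\gamma\in\mathrm{IDP}^d_{p-1}$.
   Context: $\mathbf{F}$ is a field of characteristic $p$. $C_p=\langle\sigma\rangle$ is cyclic of order $p$; for $1\le n\le p$, $V_n$ is the unique indecomposable $\mathbf{F}C_p$-module of dimension $n$ ($\sigma$ acts by a single unipotent Jordan block). $\mathbf{F}[d\,V_2]=\mathbf{F}[x_1,y_1,\dots,x_d,y_d]$ with $\sigma(x_i)=x_i$, $\sigma(y_i)=y_i+x_i$, graded by multi-degree in $\mathbb{N}^d$ ($x_i,y_i$ have multi-degree the $i$-th unit vector). The component $\mathbf{F}[d\,V_2]_{(1,\dots,1)}$ of multi-linear polynomials is identified with $\otimes^dV_2$ (with $\otimes^0V_2=V_1$). $u_{ij}=x_iy_j-x_jy_i$; $\operatorname{Tr}(f)=\sum_{\tau\in C_p}\tau(f)$. The length $\ell(f)$ of a nonzero invariant $f$ is $r+1$, where $r$ is maximal with $f$ in the image of $(\sigma-1)^r$ (acting on $\otimes^d V_2$). Term order: graded reverse lexicographic with $y_1>x_1>y_2>x_2>\dots>y_d>x_d$; $\operatorname{LM}$ is the lead monomial (no coefficient). "$B$ is a SAGBI basis in multi-degree $(1,\dots,1)$ for $S=\mathbf{F}[d\,V_2]^{C_p}$" means that for every nonzero $f\in S_{(1,\dots,1)}$, $\operatorname{LM}(f)$ is a finite product $\prod_g\operatorname{LM}(g)^{e_g}$ over nonzero $g\in B$, with non-negative integers $e_g$. Lattice paths: a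 lattice path of length $d$ is a sequence of $d$ steps starting at the origin, each $(1,0)$ (an $x$-step) or $(0,1)$ (a $y$-step); it is encoded by its word $\gamma_1\cdots\gamma_d$ in the letters $x,y$. Its height is the largest integer $h$ such that the path touches the line $y=x-h$; its finishing height is $h$ if it ends on the line $y=x-h$. A partial Dyck path is a lattice path staying on or below the line $y=x$. An initial Dyck path of escape height $t$ is a lattice path consisting of a partial Dyck path of finishing height $t$ followed by an arbitrary sequence of steps. $\mathrm{PDP}^d_{\le q}$ is the set of partial Dyck paths of length $d$ and height at most $q$; $\mathrm{PDP}^d_{\le q}(h)$ is the subset of those with finishing height $h$; $\mathrm{IDP}^d_q$ is the set of initial Dyck paths of length $d$ and escape height $q$. For a lattice path $\gamma$ of length $d$, $\Lambda(\gamma)=z_1\cdots z_d$ where $z_i=x_i$ if $\gamma_i=x$ and $z_i=y_i$ if $\gamma_i=y$. Matching: for $\gamma\in\mathrm{PDP}^d_{\le p-1}(h)$ put $I_1=\{j\mid\gamma_j=y\}$ and define $\rho$ on $I_1$ recursively in increasing order of $j$: $\rho(j)$ is the maximal $i<j$ with $\gamma_i=x$ and $i\ne\rho(s)$ for all $s\in I_1$, $s<j$. Put $I_2=\rho(I_1)$, $I_3=\{1,\dots,d\}\setminus(I_1\sqcup I_2)$, and $$\theta_0(\gamma)=\prod_{j\in I_1}u_{\rho(j),j}\prod_{i\in I_3}x_i,\qquad \theta_0'(\gamma)=\prod_{j\in I_1}u_{\rho(j),j}\prod_{i\in I_3}y_i.$$ If $\gamma\in\mathrm{PDP}^d_{\le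 p-2}$, then $\theta(\gamma)=\theta_0(\gamma)$ and $\theta'(\gamma)=\theta_0'(\gamma)$. If $\gamma\in\mathrm{IDP}^d_{p-1}$, let $s$ be minimal such that the path $\gamma'$ with word $\gamma_1\cdots\gamma_s$ is a partial Dyck path of finishing height $p-1$, so that $\gamma'\in\mathrm{PDP}^s_{\le p-1}(p-1)$; let $I_1=\{j\le s\mid\gamma_j=y\}$, define $\rho$ on $I_1$ recursively in increasing order of $j$ by letting $\rho(j)$ be the maximal $i<j$ with $\gamma_i=x$ and $i\ne\rho(j')$ for all $j'\in I_1$, $j'<j$, let $I_2=\rho(I_1)$ and $I_3=\{1,\dots,s\}\setminus(I_1\sqcup I_2)$, let $I_4=\{i>s\mid\gamma_i=x\}$, $I_5=\{i>s\mid\gamma_i=y\}$, and set $$\theta'(\gamma)=\prod_{j\in I_1}u_{\rho(j),j}\prod_{i\in I_3\cup I_5}y_i\prod_{i\in I_4}x_i,\qquad \theta(\gamma)=\operatorname{Tr}\Big(\prod_{i\in I_3\cup I_5}y_i\Big)\prod_{j\in I_1}u_{\rho(j),j}\prod_{i\in I_4}x_i.$$ *)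

theory Defs
  imports "HOL-Library.Poly_Mapping" "HOL-Computational_Algebra.Computational_Algebra"
begin

section \<open>Modules over the group algebra of a cyclic group\<close>

text \<open>
  All vector spaces live in types \<open>'b \<Rightarrow>\<^sub>0 'a\<close> (the vector space over the field \<open>'a\<close> with
  basis \<open>'b\<close>).  A representation of \<open>C\<^sub>p = \<langle>\<sigma>\<rangle>\<close> is given by a carrier set together with the map
  \<open>s\<close> by which the generator acts; submodules are the subspaces closed under \<open>s\<close>.
\<close>

definition scale :: "'a::field \<Rightarrow> ('b \<Rightarrow>\<^sub>0 'a) \<Rightarrow> ('b \<Rightarrow>\<^sub>0 'a)"
  where "scale c v = Poly_Mapping.map (\<lambda>t. c * t) v"

lemma lookup_scale: "Poly_Mapping.lookup (scale c v) k = c * Poly_Mapping.lookup v k"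
  by (simp add: scale_def Poly_Mapping.map.rep_eq when_def)

global_interpretation fsupp: vector_space "scale :: 'a::field \<Rightarrow> ('b \<Rightarrow>\<^sub>0 'a) \<Rightarrow> ('b \<Rightarrow>\<^sub>0 'a)"
  by standard (simp_all add: poly_mapping_eq_iff fun_eq_iff lookup_scale lookup_add algebra_simps)

definition linear_ext :: "('b \<Rightarrow> ('c \<Rightarrow>\<^sub>0 'a)) \<Rightarrow> ('b \<Rightarrow>\<^sub>0 'a::field) \<Rightarrow> ('c \<Rightarrow>\<^sub>0 'a)"
  where "linear_ext b v = (\<Sum>k\<in>Poly_Mapping.keys v. scale (Poly_Mapping.lookup v k) (b k))"

definition submodule :: "(('b \<Rightarrow>\<^sub>0 'a::field) \<Rightarrow> ('b \<Rightarrow>\<^sub>0 'a)) \<Rightarrow> ('b \<Rightarrow>\<^sub>0 'a) set \<Rightarrow> bool"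
  where "submodule s M \<longleftrightarrow> fsupp.subspace M \<and> s ` M \<subseteq> M"

definition generated_module ::
    "(('b \<Rightarrow>\<^sub>0 'a::field) \<Rightarrow> ('b \<Rightarrow>\<^sub>0 'a)) \<Rightarrow> ('b \<Rightarrow>\<^sub>0 'a) \<Rightarrow> ('b \<Rightarrow>\<^sub>0 'a) set"
  where "generated_module s v = \<Inter>{M. submodule s M \<and> v \<in> M}"

definition simple_module :: "(('b \<Rightarrow>\<^sub>0 'a::field) \<Rightarrow> ('b \<Rightarrow>\<^sub>0 'a)) \<Rightarrow> ('b \<Rightarrow>\<^sub>0 'a) set \<Rightarrow> bool"
  where "simple_module s M \<longleftrightarrow> submodule s M \<and> M \<noteq> {0} \<and>
     (\<forall>N. submodule s N \<longrightarrow> N \<subseteq> M \<longrightarrow> N = {0} \<or> N = M)"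

definition socle ::
    "(('b \<Rightarrow>\<^sub>0 'a::field) \<Rightarrow> ('b \<Rightarrow>\<^sub>0 'a)) \<Rightarrow> ('b \<Rightarrow>\<^sub>0 'a) set \<Rightarrow> ('b \<Rightarrow>\<^sub>0 'a) set"
  where "socle s M = fsupp.span (\<Union>{N. simple_module s N \<and> N \<subseteq> M})"

definition indecomposable :: "(('b \<Rightarrow>\<^sub>0 'a::field) \<Rightarrow> ('b \<Rightarrow>\<^sub>0 'a)) \<Rightarrow> ('b \<Rightarrow>\<^sub>0 'a) set \<Rightarrow> bool"
  where "indecomposable s M \<longleftrightarrow> submodule s M \<and> M \<noteq> {0} \<and>
     (\<forall>A B. submodule s A \<longrightarrow> submodule s B \<longrightarrow> A \<inter> B = {0} \<longrightarrow> {a + b | a b. a \<in> A \<and> b \<in> B} = M \<longrightarrow>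
        A = {0} \<or> B = {0})"

definition isomorphic ::
    "(('b \<Rightarrow>\<^sub>0 'a::field) \<Rightarrow> ('b \<Rightarrow>\<^sub>0 'a)) \<Rightarrow> ('b \<Rightarrow>\<^sub>0 'a) set \<Rightarrow>
     (('c \<Rightarrow>\<^sub>0 'a) \<Rightarrow> ('c \<Rightarrow>\<^sub>0 'a)) \<Rightarrow> ('c \<Rightarrow>\<^sub>0 'a) set \<Rightarrow> bool"
  where "isomorphic s M t N \<longleftrightarrow> (\<exists>\<phi>. bij_betw \<phi> M N \<and>
     (\<forall>u\<in>M. \<forall>v\<in>M. \<phi> (u + v) = \<phi> u + \<phi> v) \<and>
     (\<forall>c. \<forall>v\<in>M. \<phi> (scale c v) = scale c (\<phi> v)) \<and>
     (\<forall>v\<in>M. \<phi> (s v) = t (\<phi> v)))"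

definition internal_direct_sum ::
    "(('b \<Rightarrow>\<^sub>0 'a::field) \<Rightarrow> ('b \<Rightarrow>\<^sub>0 'a)) \<Rightarrow> ('b \<Rightarrow>\<^sub>0 'a) set \<Rightarrow> 'i set \<Rightarrow> ('i \<Rightarrow> ('b \<Rightarrow>\<^sub>0 'a) set) \<Rightarrow> bool"
  where "internal_direct_sum s W I V \<longleftrightarrow> finite I \<and>
     (\<forall>i\<in>I. submodule s (V i) \<and> V i \<subseteq> W) \<and>
     (\<forall>w\<in>W. \<exists>!v. (\<forall>i\<in>I. v i \<in> V i) \<and> (\<forall>i. i \<notin> I \<longrightarrow> v i = 0) \<and> w = (\<Sum>i\<in>I. v i))"

text \<open>\<open>V\<^sub>n\<close>, with basis \<open>e\<^sub>0, \<dots>, e\<^sub>n\<^sub>-\<^sub>1\<close>: a single unipotent Jordan block.\<close>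

definition Vn :: "nat \<Rightarrow> (nat \<Rightarrow>\<^sub>0 'a::field) set"
  where "Vn n = {v. Poly_Mapping.keys v \<subseteq> {..<n}}"

definition jordan_basis :: "nat \<Rightarrow> (nat \<Rightarrow>\<^sub>0 'a::field)"
  where "jordan_basis i =
     (if i = 0 then Poly_Mapping.single 0 1
      else Poly_Mapping.single i 1 + Poly_Mapping.single (i - 1) 1)"

definition jordan :: "(nat \<Rightarrow>\<^sub>0 'a::field) \<Rightarrow> (nat \<Rightarrow>\<^sub>0 'a)"
  where "jordan = linear_ext jordan_basis"

text \<open>
  The \<open>d\<close>-th tensor power of \<open>V\<^sub>2\<close> with the diagonal action, on the basis of pure tensors
  \<open>e\<^sub>w\<^sub>1 \<otimes> \<dots> \<otimes> e\<^sub>w\<^sub>d\<close>, indexed by the words \<open>[w\<^sub>1, \<dots>, w\<^sub>d]\<close> in \<open>0, 1\<close>.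
\<close>

fun pure_tensor :: "('b \<Rightarrow>\<^sub>0 'a::field) list \<Rightarrow> ('b list \<Rightarrow>\<^sub>0 'a)"
  where
    "pure_tensor [] = Poly_Mapping.single [] 1"
  | "pure_tensor (v # vs) = linear_ext (\<lambda>i. linear_ext (\<lambda>w. Poly_Mapping.single (i # w) 1) (pure_tensor vs)) v"

definition tensor_power :: "nat \<Rightarrow> (nat list \<Rightarrow>\<^sub>0 'a::field) set"
  where "tensor_power d = {v. \<forall>w\<in>Poly_Mapping.keys v. length w = d \<and> set w \<subseteq> {0, 1}}"

definition tensor_action :: "(nat list \<Rightarrow>\<^sub>0 'a::field) \<Rightarrow> (nat list \<Rightarrow>\<^sub>0 'a)"
  where "tensor_action = linear_ext (\<lambda>w. pure_tensor (map jordan_basis w))"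


section \<open>The polynomial ring\<close>

datatype var = X nat | Y nat

fun var_index :: "var \<Rightarrow> nat"
  where "var_index (X i) = i" | "var_index (Y i) = i"

type_synonym monomial = "var \<Rightarrow>\<^sub>0 nat"
type_synonym 'a mpoly = "(var \<Rightarrow>\<^sub>0 nat) \<Rightarrow>\<^sub>0 'a"

definition Var :: "var \<Rightarrow> 'a::field mpoly"
  where "Var v = Poly_Mapping.single (Poly_Mapping.single v 1) 1"

abbreviation xvar :: "nat \<Rightarrow> 'a::field mpoly" where "xvar i \<equiv> Var (X i)"
abbreviation yvar :: "nat \<Rightarrow> 'a::field mpoly" where "yvar i \<equiv> Var (Y i)"

definition udet :: "nat \<Rightarrow> nat \<Rightarrow> 'a::field mpoly"
  where "udet i j = xvar i * yvar j - xvar j * yvar i"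

text \<open>The algebra \<open>F[d V\<^sub>2]\<close> and its component of multi-degree \<open>(1, \<dots>, 1)\<close>.\<close>

definition poly_ring :: "nat \<Rightarrow> 'a::field mpoly set"
  where "poly_ring d = {f. \<forall>m\<in>Poly_Mapping.keys f. \<forall>v\<in>Poly_Mapping.keys m. var_index v \<in> {1..d}}"

definition multideg :: "monomial \<Rightarrow> nat \<Rightarrow> nat"
  where "multideg m i = Poly_Mapping.lookup m (X i) + Poly_Mapping.lookup m (Y i)"

definition multilinear :: "nat \<Rightarrow> 'a::field mpoly set"
  where "multilinear d = {f \<in> poly_ring d. \<forall>m\<in>Poly_Mapping.keys f. \<forall>i\<in>{1..d}. multideg m i = 1}"

text \<open>The generator \<open>\<sigma>\<close> acts by the algebra homomorphism extending \<open>x\<^sub>i \<mapsto> x\<^sub>i\<close>, \<open>y\<^sub>i \<mapsto> y\<^sub>i + x\<^sub>i\<close>.\<close>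

fun sigma_var :: "var \<Rightarrow> 'a::field mpoly"
  where "sigma_var (X i) = xvar i" | "sigma_var (Y i) = yvar i + xvar i"

definition sigma :: "'a::field mpoly \<Rightarrow> 'a mpoly"
  where "sigma = linear_ext (\<lambda>m. \<Prod>v\<in>Poly_Mapping.keys m. sigma_var v ^ Poly_Mapping.lookup m v)"

definition Tr :: "nat \<Rightarrow> 'a::field mpoly \<Rightarrow> 'a mpoly"
  where "Tr p f = (\<Sum>k<p. (sigma ^^ k) f)"

definition invariants :: "nat \<Rightarrow> nat \<Rightarrow> 'a::field mpoly set"
  where "invariants p d = {f \<in> poly_ring d. \<forall>k<p. (sigma ^^ k) f = f}"

text \<open>The length; meaningful for nonzero multi-linear invariants only (\<open>f = 0\<close> admits no maximal exponent).\<close>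

definition inv_length :: "nat \<Rightarrow> 'a::field mpoly \<Rightarrow> nat"
  where "inv_length d f = (GREATEST r. f \<in> ((\<lambda>g. sigma g - g) ^^ r) ` multilinear d) + 1"


section \<open>Lead monomials\<close>

text \<open>
  \<open>var_rank\<close> enumerates \<open>y\<^sub>1 > x\<^sub>1 > y\<^sub>2 > x\<^sub>2 > \<dots>\<close> in decreasing order, so in the graded reverse
  lexicographic order ties are decided at the differing variable of largest rank.
\<close>

fun var_rank :: "var \<Rightarrow> nat"
  where "var_rank (Y i) = 2 * i" | "var_rank (X i) = 2 * i + 1"

definition total_deg :: "monomial \<Rightarrow> nat"
  where "total_deg m = (\<Sum>v\<in>Poly_Mapping.keys m. Poly_Mapping.lookup m v)"

definition grevlex_less :: "monomial \<Rightarrow> monomial \<Rightarrow> bool"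
  where "grevlex_less m n \<longleftrightarrow> total_deg m < total_deg n \<or>
     (total_deg m = total_deg n \<and>
       (\<exists>v. Poly_Mapping.lookup m v > Poly_Mapping.lookup n v \<and>
            (\<forall>w. var_rank w > var_rank v \<longrightarrow> Poly_Mapping.lookup m w = Poly_Mapping.lookup n w)))"

text \<open>Lead monomial, as a polynomial; meaningful for \<open>f \<noteq> 0\<close> only.\<close>

definition LM :: "'a::field mpoly \<Rightarrow> 'a mpoly"
  where "LM f = Poly_Mapping.single
     (THE m. m \<in> Poly_Mapping.keys f \<and>
        (\<forall>n\<in>Poly_Mapping.keys f. n \<noteq> m \<longrightarrow> grevlex_less n m)) 1"

definition multilinear_sagbi_basis :: "nat \<Rightarrow> 'a::field mpoly set \<Rightarrow> 'a mpoly set \<Rightarrow> bool"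
  where "multilinear_sagbi_basis d B S \<longleftrightarrow>
     (\<forall>f \<in> S \<inter> multilinear d. f \<noteq> 0 \<longrightarrow>
        (\<exists>G e. finite G \<and> G \<subseteq> B - {0} \<and> LM f = (\<Prod>g\<in>G. LM g ^ e g)))"


section \<open>Lattice paths\<close>

datatype step = xstep | ystep

text \<open>
  Steps are numbered from 1.  A path ends on the line \<open>y = x - h\<close> iff its finishing height
  is \<open>h\<close>; it touches this line for \<open>h\<close> an integer iff one of its lattice points is on it.
\<close>

definition letter :: "step list \<Rightarrow> nat \<Rightarrow> step"
  where "letter \<gamma> i = \<gamma> ! (i - 1)"

definition finishing_height :: "step list \<Rightarrow> int"
  where "finishing_height \<gamma> = int (count_list \<gamma> xstep) - int (count_list \<gamma> ystep)"

definition height :: "step list \<Rightarrow> int"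
  where "height \<gamma> = Max ((\<lambda>k. finishing_height (take k \<gamma>)) ` {0..length \<gamma>})"

definition partial_dyck :: "step list \<Rightarrow> bool"
  where "partial_dyck \<gamma> \<longleftrightarrow> (\<forall>k\<le>length \<gamma>. finishing_height (take k \<gamma>) \<ge> 0)"

definition PDP :: "nat \<Rightarrow> nat \<Rightarrow> step list set"
  where "PDP d q = {\<gamma>. length \<gamma> = d \<and> partial_dyck \<gamma> \<and> height \<gamma> \<le> int q}"

definition PDP_at :: "nat \<Rightarrow> nat \<Rightarrow> nat \<Rightarrow> step list set"
  where "PDP_at d q h = {\<gamma> \<in> PDP d q. finishing_height \<gamma> = int h}"

definition IDP :: "nat \<Rightarrow> nat \<Rightarrow> step list set"
  where "IDP d q = {\<gamma>. length \<gamma> = d \<and>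
     (\<exists>\<alpha> \<beta>. \<gamma> = \<alpha> @ \<beta> \<and> partial_dyck \<alpha> \<and> finishing_height \<alpha> = int q)}"

fun step_var :: "step \<Rightarrow> nat \<Rightarrow> var"
  where "step_var xstep i = X i" | "step_var ystep i = Y i"

definition Lambda :: "step list \<Rightarrow> 'a::field mpoly"
  where "Lambda \<gamma> = (\<Prod>i\<in>{1..length \<gamma>}. Var (step_var (letter \<gamma> i) i))"


section \<open>The matching and the polynomials attached to a path\<close>

function rho :: "step list \<Rightarrow> nat \<Rightarrow> nat"
  where "rho \<gamma> j =
     Max ({i\<in>{1..<j}. letter \<gamma> i = xstep} - (\<lambda>s. rho \<gamma> s) ` {s\<in>{1..<j}. letter \<gamma> s = ystep})"
  by pat_completeness auto
termination by (relation "measure snd") auto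

declare rho.simps [simp del]

definition I1 :: "step list \<Rightarrow> nat set"
  where "I1 \<gamma> = {j\<in>{1..length \<gamma>}. letter \<gamma> j = ystep}"

definition I2 :: "step list \<Rightarrow> nat set"
  where "I2 \<gamma> = rho \<gamma> ` I1 \<gamma>"

definition I3 :: "step list \<Rightarrow> nat set"
  where "I3 \<gamma> = {1..length \<gamma>} - (I1 \<gamma> \<union> I2 \<gamma>)"

definition theta0 :: "step list \<Rightarrow> 'a::field mpoly"
  where "theta0 \<gamma> = (\<Prod>j\<in>I1 \<gamma>. udet (rho \<gamma> j) j) * (\<Prod>i\<in>I3 \<gamma>. xvar i)"

definition theta0' :: "step list \<Rightarrow> 'a::field mpoly"
  where "theta0' \<gamma> = (\<Prod>j\<in>I1 \<gamma>. udet (rho \<gamma> j) j) * (\<Prod>i\<in>I3 \<gamma>. yvar i)"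

definition escape :: "nat \<Rightarrow> step list \<Rightarrow> nat"
  where "escape p \<gamma> = (LEAST s. s \<le> length \<gamma> \<and> partial_dyck (take s \<gamma>) \<and>
     finishing_height (take s \<gamma>) = int (p - 1))"

abbreviation initial_part :: "nat \<Rightarrow> step list \<Rightarrow> step list"
  where "initial_part p \<gamma> \<equiv> take (escape p \<gamma>) \<gamma>"

definition I4 :: "nat \<Rightarrow> step list \<Rightarrow> nat set"
  where "I4 p \<gamma> = {i\<in>{escape p \<gamma><..length \<gamma>}. letter \<gamma> i = xstep}"

definition I5 :: "nat \<Rightarrow> step list \<Rightarrow> nat set"
  where "I5 p \<gamma> = {i\<in>{escape p \<gamma><..length \<gamma>}. letter \<gamma> i = ystep}"

text \<open>The second case of \<open>theta\<close> and \<open>theta'\<close> is meant for initial Dyck paths of escape height \<open>p - 1\<close>.\<close>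

definition theta :: "nat \<Rightarrow> step list \<Rightarrow> 'a::field mpoly"
  where "theta p \<gamma> =
     (if \<gamma> \<in> PDP (length \<gamma>) (p - 2) then theta0 \<gamma>
      else let \<gamma>' = initial_part p \<gamma> in
        Tr p (\<Prod>i\<in>I3 \<gamma>' \<union> I5 p \<gamma>. yvar i) * (\<Prod>j\<in>I1 \<gamma>'. udet (rho \<gamma>' j) j) * (\<Prod>i\<in>I4 p \<gamma>. xvar i))"

definition theta' :: "nat \<Rightarrow> step list \<Rightarrow> 'a::field mpoly"
  where "theta' p \<gamma> =
     (if \<gamma> \<in> PDP (length \<gamma>) (p - 2) then theta0' \<gamma>
      else let \<gamma>' = initial_part p \<gamma> in
        (\<Prod>j\<in>I1 \<gamma>'. udet (rho \<gamma>' j) j) * (\<Prod>i\<in>I3 \<gamma>' \<union> I5 p \<gamma>. yvar i) * (\<Prod>i\<in>I4 p \<gamma>. xvar i))"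

definition basis_B :: "nat \<Rightarrow> nat \<Rightarrow> 'a::field mpoly set"
  where "basis_B p d =
     {xvar i | i. 1 \<le> i \<and> i \<le> d} \<union> {udet i j | i j. 1 \<le> i \<and> i < j \<and> j \<le> d} \<union>
     {Tr p (\<Prod>i\<in>{1..d}. yvar i ^ e i) | e. \<forall>i\<in>{1..d}. e i \<le> (1::nat)}"

definition V_path :: "nat \<Rightarrow> step list \<Rightarrow> 'a::field mpoly set"
  where "V_path p \<gamma> = generated_module sigma (theta' p \<gamma>)"

end

theory Submission
  imports Defs
begin

text \<open>
  Put \<open>D = \<sigma> - 1\<close>.  By the twisted Leibniz rule for \<open>D\<close>, a product of \<open>k\<close> variables \<open>y\<^sub>i\<close> is sent by
  \<open>D\<^sup>k\<close> to \<open>k!\<close> times the product of the corresponding \<open>x\<^sub>i\<close>; moreover \<open>Tr =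
      D\<^sup>p\<^sup>-\<^sup>1\<close> in characteristic \<open>p\<close>,
  because \<open>p\<close> divides the intermediate binomial coefficients.  Hence \<open>D\<^sup>k \<theta>'(\<gamma>)\<close> is a nonzero
  multiple of the invariant \<open>\<theta>(\<gamma>)\<close>, where \<open>k\<close> is the finishing height of \<open>\<gamma>\<close> or \<open>p - 1\<close>, and
  \<open>\<theta>'(\<gamma>), D \<theta>'(\<gamma>), \<dots>, D\<^sup>k \<theta>'(\<gamma>)\<close> is a Jordan string.  The lead monomials \<open>\<Lambda>(\<gamma>)\<close> of the
  ends of these strings are distinct, so the ends, and with them all the strings, are linearly
  independent.  Counting paths by appending one step at a time shows that the string lengths add
  up to \<open>2\<^sup>d\<close>, so that the strings form a basis.  The decomposition, the lengths and the space of
  invariants are read off from this basis; the lead monomial of an invariant is one of the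
  \<open>\<Lambda>(\<gamma>)\<close>, and \<open>\<theta>(\<gamma>)\<close> is a product of elements of \<open>B\<close>.
\<close>

section \<open>Unipotent operators and their Jordan strings\<close>

text \<open>No spanning argument is made: as many independent vectors as there are multi-linear
  monomials must form a basis, so the counting of paths carries the spanning part of the
  decomposition. Independence of whole strings reduces to that of their ends because
  \<open>D\<close> moves every string towards its end; a suitable power of \<open>D\<close> turns
  any relation into one between ends. The strings of initial Dyck paths need a separate reason to
  stop. There \<open>theta'\<close> may have more than p - 1 free factors y_i, so counting factors
  does not make \<open>D\<close> to the power p vanish on it; it vanishes because \<open>D\<close>
  to the power p - 1 produces a trace, and this trace is invariant. The term order explains the lead
  monomial of that trace. Trading y_b for x_b at the largest index b makes a monomial smaller, so in
  the lead monomial the p - 1 copies of \<open>D\<close> fall on the lowest indices. These are the p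
  - 1 unmatched x-steps before the escape, and the y-steps after it stay y, as the path prescribes.
  The factor (p - 1)! that arises there is nonzero in characteristic p.\<close>

lemma linear_ext_superset:
  assumes "finite K" "Poly_Mapping.keys v \<subseteq> K"
  shows "linear_ext b v = (\<Sum>k\<in>K. scale (Poly_Mapping.lookup v k) (b k))"
  unfolding linear_ext_def using assms
  by (intro sum.mono_neutral_left) (auto simp: in_keys_iff)

lemma linear_ext_add: "linear_ext b (u + v) = linear_ext b u + linear_ext b v"
proof -
  define K where "K = Poly_Mapping.keys u \<union> Poly_Mapping.keys v"
  have K: "finite K" "Poly_Mapping.keys u \<subseteq> K" "Poly_Mapping.keys v \<subseteq> K"
    "Poly_Mapping.keys (u + v) \<subseteq> K"
    using keys_add[of u v] by (auto simp: K_def)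
  show ?thesis
    by (simp add: linear_ext_superset[OF K(1,2)] linear_ext_superset[OF K(1,3)]
        linear_ext_superset[OF K(1,4)] lookup_add fsupp.scale_left_distrib sum.distrib)
qed

lemma linear_ext_scale: "linear_ext b (scale c v) = scale c (linear_ext b v)"
proof -
  have K: "Poly_Mapping.keys (scale c v) \<subseteq> Poly_Mapping.keys v"
    by (auto simp: in_keys_iff lookup_scale)
  show ?thesis
    by (subst linear_ext_superset[OF finite_keys K])
      (simp add: linear_ext_def fsupp.scale_sum_right lookup_scale)
qed

lemma linear_ext_single [simp]: "linear_ext b (Poly_Mapping.single k c) = scale c (b k)"
  by (subst linear_ext_superset[of "{k}"]) auto

lemma linear_linear_ext: "Vector_Spaces.linear scale scale (linear_ext b)"
  by (simp add: Vector_Spaces.linear_iff fsupp.vector_space_axioms linear_ext_add linear_ext_scale)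

lemma poly_mapping_eq_sum_singles:
  "f = (\<Sum>k\<in>Poly_Mapping.keys f. scale (Poly_Mapping.lookup f k) (Poly_Mapping.single k 1))"
proof (rule poly_mapping_eqI)
  fix n
  have "(\<Sum>k\<in>Poly_Mapping.keys f. Poly_Mapping.lookup f k * (1 when k = n)) =
      Poly_Mapping.lookup f n"
    by (cases "n \<in> Poly_Mapping.keys f")
      (auto simp: when_def in_keys_iff if_distrib[of "\<lambda>t. _ * t"] cong: if_cong)
  then show "Poly_Mapping.lookup f n = Poly_Mapping.lookup
      (\<Sum>k\<in>Poly_Mapping.keys f. scale (Poly_Mapping.lookup f k) (Poly_Mapping.single k 1)) n"
    by (simp add: lookup_sum lookup_scale lookup_single)
qed

text \<open>Lets a condition on supports be used as a span: closure under linear combinations comes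
  for free, and the number of admissible basis elements bounds the size of independent sets.\<close>

lemma keys_subset_eq_span:
  "{f. Poly_Mapping.keys f \<subseteq> K} = fsupp.span ((\<lambda>k. Poly_Mapping.single k (1::'a::field)) ` K)"
    (is "?L = fsupp.span ?T")
proof
  show "?L \<subseteq> fsupp.span ?T"
  proof
    fix f :: "'b \<Rightarrow>\<^sub>0 'a" assume "f \<in> ?L"
    then have "Poly_Mapping.single k (1::'a) \<in> fsupp.span ?T" if "k \<in> Poly_Mapping.keys f" for k
      using that by (intro fsupp.span_base) auto
    then show "f \<in> fsupp.span ?T"
      by (subst poly_mapping_eq_sum_singles) (intro fsupp.span_sum fsupp.span_scale)
  qed
  show "fsupp.span ?T \<subseteq> ?L"
  proof (rule fsupp.span_minimal)
    show "fsupp.subspace ?L"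
      unfolding fsupp.subspace_def
    proof (intro conjI ballI allI)
      fix f g :: "'b \<Rightarrow>\<^sub>0 'a" assume "f \<in> ?L" "g \<in> ?L"
      then show "f + g \<in> ?L" using keys_add[of f g] by blast
    next
      fix c and f :: "'b \<Rightarrow>\<^sub>0 'a" assume "f \<in> ?L"
      then show "scale c f \<in> ?L" by (auto simp: in_keys_iff lookup_scale)
    qed simp
  qed auto
qed

section \<open>A linear operator and its difference with the identity\<close>

locale linear_operator =
  fixes s :: "('b \<Rightarrow>\<^sub>0 'a::field) \<Rightarrow> ('b \<Rightarrow>\<^sub>0 'a)"
  assumes linear_s: "Vector_Spaces.linear scale scale s"
begin

definition D :: "('b \<Rightarrow>\<^sub>0 'a) \<Rightarrow> ('b \<Rightarrow>\<^sub>0 'a)"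
  where "D f = s f - f"

lemma linear_D_pow: "Vector_Spaces.linear scale scale (D ^^ n)"
proof (induction n)
  case 0
  then show ?case by (simp add: fsupp.linear_id id_def[symmetric])
next
  case (Suc n)
  interpret S: Vector_Spaces.linear scale scale s by (rule linear_s)
  have "Vector_Spaces.linear scale scale D"
    by (simp add: Vector_Spaces.linear_iff fsupp.vector_space_axioms D_def S.add S.scale
        fsupp.scale_right_diff_distrib)
  from Vector_Spaces.linear_compose[OF Suc this] show ?case by (simp add: o_def)
qed

lemmas D_pow_add = Vector_Spaces.linear.axioms(3)[OF linear_D_pow, THEN module_hom.add]
  and D_pow_scale = Vector_Spaces.linear.axioms(3)[OF linear_D_pow, THEN module_hom.scale]
  and D_pow_sum = Vector_Spaces.linear.axioms(3)[OF linear_D_pow, THEN module_hom.sum]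
  and D_pow_zero [simp] = Vector_Spaces.linear.axioms(3)[OF linear_D_pow, THEN module_hom.zero]

lemmas D_add = D_pow_add[of 1, simplified]
  and D_scale = D_pow_scale[of 1, simplified]
  and D_sum = D_pow_sum[of 1, simplified]
  and D_zero [simp] = D_pow_zero[of 1, simplified]

lemma D_fun_eq: "(\<lambda>g. s g - g) = D"
  by (simp add: fun_eq_iff D_def)

lemma s_eq: "s f = f + D f"
  by (simp add: D_def)

text \<open>\<open>s\<close> is the identity plus \<open>D\<close>, so on a subspace the two
  stability conditions agree. The module arguments below can therefore work with \<open>D\<close>,
  which is nilpotent on strings.\<close>

lemma submodule_iff: "submodule s M \<longleftrightarrow> fsupp.subspace M \<and> (\<forall>f\<in>M. D f \<in> M)"
proof (cases "fsupp.subspace M")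
  case True
  have "s f \<in> M \<longleftrightarrow> D f \<in> M" if "f \<in> M" for f
    using that fsupp.subspace_add[OF True that, of "D f"] fsupp.subspace_diff[OF True, of "s f" f]
    by (metis s_eq D_def)
  then show ?thesis using True by (auto simp: submodule_def)
qed (simp add: submodule_def)

lemma submodule_D_pow: "submodule s M \<Longrightarrow> f \<in> M \<Longrightarrow> (D ^^ n) f \<in> M"
  by (induction n) (auto simp: submodule_iff)

end

text \<open>Independence of the ends is required of the indexed family and not of the set of ends,
  so it also rules out that different strings share an end.\<close>

locale jordan_strings = linear_operator s
  for s :: "('b \<Rightarrow>\<^sub>0 'a::field) \<Rightarrow> ('b \<Rightarrow>\<^sub>0 'a)" +
  fixes I :: "'i set" and v :: "'i \<Rightarrow> ('b \<Rightarrow>\<^sub>0 'a)" and k :: "'i \<Rightarrow> nat"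
  assumes finite_I: "finite I"
    and end_of_string: "i \<in> I \<Longrightarrow> (D ^^ Suc (k i)) (v i) = 0"
    and ends_independent:
      "(\<Sum>i\<in>I. scale (a i) ((D ^^ k i) (v i))) = 0 \<Longrightarrow> i \<in> I \<Longrightarrow> a i = 0"
begin

definition string :: "'i \<Rightarrow> (nat \<Rightarrow> 'a) \<Rightarrow> ('b \<Rightarrow>\<^sub>0 'a)"
  where "string i c = (\<Sum>j\<le>k i. scale (c j) ((D ^^ j) (v i)))"

lemma string_cong: "(\<And>j. j \<le> k i \<Longrightarrow> c j = c' j) \<Longrightarrow> string i c = string i c'"
  by (auto simp: string_def)

lemma string_add: "string i c + string i c' = string i (\<lambda>j. c j + c' j)"
  by (simp add: string_def fsupp.scale_left_distrib sum.distrib)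

lemma string_scale: "scale t (string i c) = string i (\<lambda>j. t * c j)"
  by (simp add: string_def fsupp.scale_sum_right)

lemma string_diff: "string i c - string i c' = string i (\<lambda>j. c j - c' j)"
  by (simp add: string_def fsupp.scale_left_diff_distrib sum_subtractf)

lemma string_zero: "string i (\<lambda>_. 0) = 0"
  by (simp add: string_def)

lemma string_delta:
  "m \<le> k i \<Longrightarrow> string i (\<lambda>j. if j = m then t else 0) = scale t ((D ^^ m) (v i))"
  by (simp add: string_def if_distrib[of "\<lambda>t. scale t _"] cong: if_cong)

lemma D_string:
  assumes "i \<in> I"
  shows "D (string i c) = string i (\<lambda>j. if j = 0 then 0 else c (j - 1))"
proof -
  have "D (string i c) = (\<Sum>j\<le>k i. scale (c j) ((D ^^ Suc j) (v i)))"
    by (simp add: string_def D_sum D_scale)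
  also have "\<dots> = (\<Sum>j\<le>Suc (k i). scale (if j = 0 then 0 else c (j - 1)) ((D ^^ j) (v i)))"
    by (subst sum.atMost_Suc_shift) simp
  \<comment> \<open>The shifted sum has one term more than a string has;
    \<open>end_of_string\<close> kills it.\<close>
  also have "\<dots> = string i (\<lambda>j. if j = 0 then 0 else c (j - 1))"
    using end_of_string[OF assms] by (simp add: string_def)
  finally show ?thesis .
qed

lemma D_pow_string:
  assumes "i \<in> I"
  shows "(D ^^ n) (string i c) = string i (\<lambda>j. if j < n then 0 else c (j - n))"
proof (induction n)
  case (Suc n)
  have "(D ^^ Suc n) (string i c) = string i (\<lambda>j. if j = 0 then 0 else
      if j - 1 < n then 0 else c (j - 1 - n))"
    by (simp only: funpow.simps comp_apply Suc D_string[OF assms])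
  also have "\<dots> = string i (\<lambda>j. if j < Suc n then 0 else c (j - Suc n))"
    by (rule string_cong) auto
  finally show ?case .
qed simp

text \<open>Let \<open>m\<close> be the greatest distance \<open>k i - j\<close> from the end of its
  string at which some coefficient is nonzero. The power \<open>D ^^ m\<close> moves the terms at
  distance \<open>m\<close> exactly to the ends and pushes all nearer ones off, which leaves a
  nontrivial relation between the ends.\<close>

lemma strings_independent:
  assumes eq0: "(\<Sum>i\<in>I. string i (c i)) = 0" and "i0 \<in> I" "j0 \<le> k i0"
  shows "c i0 j0 = 0"
proof (rule ccontr)
  assume nz: "c i0 j0 \<noteq> 0"
  define bad where "bad = (\<lambda>(i, j). k i - j) ` {(i, j). i \<in> I \<and> j \<le> k i \<and> c i j \<noteq> 0}"
  have fin: "finite bad"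
    unfolding bad_def using finite_I
    by (auto intro!: finite_imageI intro: rev_finite_subset[of "Sigma I (\<lambda>i. {..k i})"])
  have "bad \<noteq> {}"
    using nz assms by (auto simp: bad_def)
  define m where "m = Max bad"
  from \<open>bad \<noteq> {}\<close> fin have "m \<in> bad" by (simp add: m_def)
  then obtain i1 j1 where ij: "i1 \<in> I" "j1 \<le> k i1" "c i1 j1 \<noteq> 0" "m = k i1 - j1"
    by (auto simp: bad_def)
  have max: "k i - j \<le> m" if "i \<in> I" "j \<le> k i" "c i j \<noteq> 0" for i j
    unfolding m_def using that fin by (intro Max_ge) (force simp: bad_def)+
  \<comment> \<open>The coefficient at distance \<open>m\<close> from the end of string
    \<open>i\<close>; a string shorter than that contributes nothing.\<close>
  define a where "a i = (if m \<le> k i then c i (k i - m) else 0)" for i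
  have "(D ^^ m) (string i (c i)) = scale (a i) ((D ^^ k i) (v i))" if i: "i \<in> I" for i
  proof -
    \<comment> \<open>For \<open>m \<le> j < k i\<close> the position \<open>j - m\<close> is
      farther than \<open>m\<close> from the end, so its coefficient is zero by \<open>max\<close>;
      only \<open>j = k i\<close> survives.\<close>
    have "(if j < m then 0 else c i (j - m)) = (if j = k i then a i else 0)" if "j \<le> k i" for j
      using that max[OF i _, of "j - m"] le_trans[OF diff_le_self that, of m]
      by (cases "c i (j - m) = 0") (auto simp: a_def)
    then have "string i (\<lambda>j. if j < m then 0 else c i (j - m)) =
        string i (\<lambda>j. if j = k i then a i else 0)"
      by (rule string_cong)
    then show ?thesis
      by (simp add: D_pow_string[OF i] string_delta)
  qed
  with eq0 have "(\<Sum>i\<in>I. scale (a i) ((D ^^ k i) (v i))) = 0"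
    using D_pow_sum[of m "\<lambda>i. string i (c i)" I] by simp
  from ends_independent[OF this ij(1)] ij show False
    by (auto simp: a_def)
qed

lemma string_eq_0:
  assumes "i \<in> I" "string i c = 0" "j \<le> k i"
  shows "c j = 0"
proof -
  have "(\<Sum>i'\<in>I. string i' (if i' = i then c else (\<lambda>_. 0))) = 
        (\<Sum>i'\<in>I. if i' = i then string i c else 0)"
    by (intro sum.cong) (auto simp: string_zero)
  also have "\<dots> = 0" using assms finite_I by simp
  finally show ?thesis
    using strings_independent[of "\<lambda>i'. if i' = i then c else (\<lambda>_. 0)" i j] assms by simp
qed

lemma subspace_string: "fsupp.subspace (range (string i))"
  unfolding fsupp.subspace_def
proof (intro conjI ballI allI)
  show "0 \<in> range (string i)" by (metis string_zero rangeI)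
qed (auto simp: string_add string_scale)

lemma generated_module_eq:
  assumes "i \<in> I"
  shows "generated_module s (v i) = range (string i)"
proof
  have "submodule s (range (string i))"
    using subspace_string by (auto simp: submodule_iff D_string[OF assms])
  moreover have "v i \<in> range (string i)"
    by (rule range_eqI[of _ _ "\<lambda>j. if j = 0 then 1 else 0"]) (simp add: string_delta)
  ultimately show "generated_module s (v i) \<subseteq> range (string i)"
    by (auto simp: generated_module_def)
  have "string i c \<in> M" if "submodule s M" "v i \<in> M" for c M
    unfolding string_def using that
    by (intro fsupp.subspace_sum fsupp.subspace_scale submodule_D_pow) (auto simp: submodule_iff)
  then show "range (string i) \<subseteq> generated_module s (v i)"
    by (auto simp: generated_module_def)
qed

lemma submodule_generated: "i \<in> I \<Longrightarrow> submodule s (generated_module s (v i))"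
  using subspace_string by (auto simp: submodule_iff D_string generated_module_eq)

text \<open>Take a nonzero element and its lowest position \<open>j\<close> with nonzero
  coefficient. \<open>D ^^ (k i - j)\<close> moves that term to the end of the string and all later
  terms off it, so a nonzero multiple of the end lies in \<open>N\<close>. This makes the string
  uniserial enough for both indecomposability and the socle.\<close>

lemma end_in_submodule:
  assumes i: "i \<in> I" and N: "submodule s N" "N \<subseteq> generated_module s (v i)" "N \<noteq> {0}"
  shows "(D ^^ k i) (v i) \<in> N"
proof -
  have sub: "fsupp.subspace N" using N by (simp add: submodule_iff)
  from N sub obtain n where n: "n \<in> N" "n \<noteq> 0"
    using fsupp.subspace_0 by blast
  then obtain c where c: "n = string i c"
    using N generated_module_eq[OF i] by blast
  have "\<exists>j\<le>k i. c j \<noteq> 0"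
    using n string_cong[of i c "\<lambda>_. 0"] by (auto simp: c string_zero)
  then obtain j where j: "j \<le> k i" "c j \<noteq> 0"
    and min: "\<forall>j'<j. \<not> (j' \<le> k i \<and> c j' \<noteq> 0)"
    using exists_least_iff[of "\<lambda>j. j \<le> k i \<and> c j \<noteq> 0"] by blast
  then have least: "c j' = 0" if "j' < j" for j'
    using that by (meson le_trans less_imp_le)
  have "(D ^^ (k i - j)) n = string i (\<lambda>j'. if j' = k i then c j else 0)"
    unfolding c D_pow_string[OF i] using j least by (intro string_cong) (auto simp: less_diff_conv)
  then have "scale (c j) ((D ^^ k i) (v i)) \<in> N"
    using submodule_D_pow[OF N(1) n(1), of "k i - j"] by (simp add: string_delta)
  from fsupp.subspace_scale[OF sub this, of "inverse (c j)"] show ?thesis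
    using j by simp
qed

lemma end_nonzero:
  assumes "i \<in> I"
  shows "(D ^^ k i) (v i) \<noteq> 0"
proof
  assume "(D ^^ k i) (v i) = 0"
  then have "string i (\<lambda>j. if j = k i then 1 else 0) = 0"
    by (simp add: string_delta)
  from string_eq_0[OF assms this, of "k i"] show False by simp
qed

lemma end_in_generated: "i \<in> I \<Longrightarrow> (D ^^ k i) (v i) \<in> generated_module s (v i)"
  unfolding generated_module_eq
  by (rule range_eqI[of _ _ "\<lambda>j. if j = k i then 1 else 0"]) (simp add: string_delta)

text \<open>Two nonzero submodules always share the end of the string, so their intersection is not
  zero.\<close>

lemma indecomposable_generated:
  assumes i: "i \<in> I"
  shows "indecomposable s (generated_module s (v i))"
  unfolding indecomposable_def
proof (intro conjI allI impI submodule_generated[OF i])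
  show "generated_module s (v i) \<noteq> {0}"
    using end_in_generated[OF i] end_nonzero[OF i] by blast
  fix A B assume A: "submodule s A" and B: "submodule s B" and AB: "A \<inter> B = {0}"
    and sum: "{a + b | a b. a \<in> A \<and> b \<in> B} = generated_module s (v i)"
  have "0 \<in> A" "0 \<in> B" using AB by auto
  then have "A \<subseteq> generated_module s (v i)" "B \<subseteq> generated_module s (v i)"
    unfolding sum[symmetric] by force+
  then show "A = {0} \<or> B = {0}"
    using end_in_submodule[OF i A] end_in_submodule[OF i B] AB end_nonzero[OF i] by blast
qed

text \<open>The span of the end lies in every nonzero submodule, hence it is the only simple
  one.\<close>

lemma socle_generated:
  assumes i: "i \<in> I"
  shows "socle s (generated_module s (v i)) = fsupp.span {(D ^^ k i) (v i)}" (is "_ =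
      fsupp.span {?e}")
proof -
  have De: "D ?e = 0" using end_of_string[OF i] by simp
  have sub: "submodule s (fsupp.span {?e})"
    unfolding submodule_iff
    by (intro conjI fsupp.subspace_span) (auto simp: fsupp.span_singleton D_scale De intro:
        range_eqI[of _ _ 0])
  have incl: "fsupp.span {?e} \<subseteq> generated_module s (v i)"
    using submodule_generated[OF i] end_in_generated[OF i]
    by (intro fsupp.span_minimal) (auto simp: submodule_iff)
  have nz: "fsupp.span {?e} \<noteq> {0}"
    using fsupp.span_base[of ?e "{?e}"] end_nonzero[OF i] by blast
  have least: "fsupp.span {?e} \<subseteq> N"
    if "submodule s N" "N \<subseteq> generated_module s (v i)" "N \<noteq> {0}" for N
    using end_in_submodule[OF i that] that by (intro fsupp.span_minimal) (auto simp: submodule_iff)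
  have "{N. simple_module s N \<and> N \<subseteq> generated_module s (v i)} = {fsupp.span {?e}}"
  proof (intro equalityI subsetI)
    fix N assume "N \<in> {N. simple_module s N \<and> N \<subseteq> generated_module s (v i)}"
    then have N: "simple_module s N" "N \<subseteq> generated_module s (v i)" by auto
    then have "fsupp.span {?e} \<subseteq> N"
      by (intro least) (auto simp: simple_module_def)
    then have "N = fsupp.span {?e}"
      using N sub nz unfolding simple_module_def by blast
    then show "N \<in> {fsupp.span {?e}}" by simp
  next
    fix N assume "N \<in> {fsupp.span {?e}}"
    then have N: "N = fsupp.span {?e}" by simp
    have "simple_module s (fsupp.span {?e})"
      unfolding simple_module_def
    proof (intro conjI allI impI sub nz)
      fix M assume "submodule s M" "M \<subseteq> fsupp.span {?e}"
      then show "M = {0} \<or> M = fsupp.span {?e}"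
        using least[of M] incl by blast
    qed
    then show "N \<in> {N. simple_module s N \<and> N \<subseteq> generated_module s (v i)}"
      using incl N by simp
  qed
  then show ?thesis by (simp add: socle_def fsupp.span_span)
qed

lemma isomorphic_generated:
  assumes i: "i \<in> I"
  shows "isomorphic s (generated_module s (v i)) jordan (Vn (k i + 1))"
proof -
  \<comment> \<open>The Jordan block lowers the index of a basis vector while \<open>D\<close> raises the exponent, hence the
     reversal.\<close>
  define \<psi> where "\<psi> u = string i (\<lambda>j. Poly_Mapping.lookup u (k i - j))" for u :: "nat \<Rightarrow>\<^sub>0 'a"
  have inj: "inj_on \<psi> (Vn (k i + 1))"
  proof (rule inj_onI, rule poly_mapping_eqI)
    fix u w :: "nat \<Rightarrow>\<^sub>0 'a" and n assume uw: "u \<in> Vn (k i + 1)" "w \<in> Vn (k i + 1)" "\<psi> u = \<psi> w"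
    then have "string i (\<lambda>j. Poly_Mapping.lookup u (k i - j) - Poly_Mapping.lookup w (k i - j)) = 0"
      by (simp add: \<psi>_def string_diff[symmetric])
    from string_eq_0[OF i this, of "k i - n"]
    show "Poly_Mapping.lookup u n = Poly_Mapping.lookup w n"
    proof (cases "n \<le> k i")
      case False
      then have "n \<notin> Poly_Mapping.keys u" "n \<notin> Poly_Mapping.keys w"
        using uw(1,2) by (auto simp: Vn_def)
      then show ?thesis by (simp add: in_keys_iff)
    qed simp
  qed
  have surj: "\<psi> ` Vn (k i + 1) = generated_module s (v i)"
  proof
    show "\<psi> ` Vn (k i + 1) \<subseteq> generated_module s (v i)"
      by (auto simp: \<psi>_def generated_module_eq[OF i])
    show "generated_module s (v i) \<subseteq> \<psi> ` Vn (k i + 1)"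
    proof
      fix w assume "w \<in> generated_module s (v i)"
      then obtain c where c: "w = string i c" by (auto simp: generated_module_eq[OF i])
      define u where "u = (\<Sum>j\<le>k i. Poly_Mapping.single j (c (k i - j)))"
      have lu: "Poly_Mapping.lookup u n = (if n \<le> k i then c (k i - n) else 0)" for n
        by (simp add: u_def lookup_sum lookup_single when_def)
      then have "u \<in> Vn (k i + 1)"
        by (auto simp: Vn_def in_keys_iff less_Suc_eq_le split: if_splits)
      moreover have "\<psi> u = w"
        unfolding \<psi>_def c by (rule string_cong) (simp add: lu)
      ultimately show "w \<in> \<psi> ` Vn (k i + 1)" by blast
    qed
  qed
  have add: "\<psi> (u + w) = \<psi> u + \<psi> w" for u w
    by (simp add: \<psi>_def string_add lookup_add)
  have scl: "\<psi> (scale t u) = scale t (\<psi> u)" for t u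
    by (simp add: \<psi>_def string_scale lookup_scale)
  have single: "\<psi> (Poly_Mapping.single n 1) = (D ^^ (k i - n)) (v i)" if "n \<le> k i" for n
  proof -
    have "\<psi> (Poly_Mapping.single n 1) = string i (\<lambda>j. if j = k i - n then 1 else 0)"
      unfolding \<psi>_def using that by (intro string_cong) (auto simp: lookup_single when_def)
    then show ?thesis by (simp add: string_delta)
  qed
  \<comment> \<open>Equivariance is checked on basis vectors: index 0 corresponds to the end, which
    \<open>D\<close> kills, and lowering a positive index by one corresponds to one application of
    \<open>D\<close>.\<close>
  have basis: "\<psi> (jordan_basis n) = s (\<psi> (Poly_Mapping.single n 1))" if "n \<le> k i" for n
  proof (cases n)
    case 0
    then show ?thesis
      using single[of 0] end_of_string[OF i] by (simp add: jordan_basis_def s_eq)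
  next
    case (Suc m)
    then have "D (\<psi> (Poly_Mapping.single n 1)) = \<psi> (Poly_Mapping.single m 1)"
      using that single[of n] single[of m]
      by (metis Suc_diff_Suc Suc_le_eq funpow.simps(2) comp_apply less_imp_le)
    then show ?thesis using Suc by (simp add: jordan_basis_def s_eq add)
  qed
  interpret S: Vector_Spaces.linear scale scale s by (rule linear_s)
  have zero: "\<psi> 0 = 0" by (simp add: \<psi>_def string_zero)
  have sum: "\<psi> (\<Sum>n\<in>K. f n) = (\<Sum>n\<in>K. \<psi> (f n))" for f :: "nat \<Rightarrow> nat \<Rightarrow>\<^sub>0 'a" and K
    by (induction K rule: infinite_finite_induct) (auto simp: zero add)
  have equiv: "\<psi> (jordan u) = s (\<psi> u)" if "u \<in> Vn (k i + 1)" for u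
  proof -
    have le: "n \<le> k i" if "n \<in> Poly_Mapping.keys u" for n
      using that \<open>u \<in> Vn (k i + 1)\<close> by (auto simp: Vn_def)
    have "\<psi> (jordan u) = (\<Sum>n\<in>Poly_Mapping.keys u. scale (Poly_Mapping.lookup u n) (\<psi> (jordan_basis
        n)))"
      by (simp add: jordan_def linear_ext_def sum scl)
    also have "\<dots> = s (\<psi> (\<Sum>n\<in>Poly_Mapping.keys u. scale (Poly_Mapping.lookup u n)
        (Poly_Mapping.single n 1)))"
      using le by (simp add: sum scl S.sum S.scale basis)
    finally show ?thesis by (simp flip: poly_mapping_eq_sum_singles)
  qed
  have closed: "u \<in> Vn n \<Longrightarrow> w \<in> Vn n \<Longrightarrow> u + w \<in> Vn n" "u \<in> Vn n \<Longrightarrow> scale t u \<in> Vn n"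
    for u w :: "nat \<Rightarrow>\<^sub>0 'a" and t n
    using keys_add[of u w] by (auto simp: Vn_def in_keys_iff lookup_scale)
  have jclosed: "jordan u \<in> Vn (k i + 1)" if "u \<in> Vn (k i + 1)" for u :: "nat \<Rightarrow>\<^sub>0 'a"
  proof -
    have "(jordan_basis n :: nat \<Rightarrow>\<^sub>0 'a) \<in> Vn (k i + 1)" if "n \<le> k i" for n
      using that by (auto simp: Vn_def jordan_basis_def dest!: subsetD[OF keys_add])
    moreover have "fsupp.subspace (Vn (k i + 1) :: (nat \<Rightarrow>\<^sub>0 'a) set)"
      unfolding fsupp.subspace_def using closed by (auto simp: Vn_def)
    ultimately show ?thesis
      unfolding jordan_def linear_ext_def using that
      by (intro fsupp.subspace_sum fsupp.subspace_scale)
          (auto simp: Vn_def subset_iff less_Suc_eq_le)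
  qed
  \<comment> \<open>The required isomorphism starts from the generated module, so it is the inverse
    of \<open>\<psi>\<close>; its properties follow by writing every module element as a value of
    \<open>\<psi>\<close>.\<close>
  define \<phi> where "\<phi> = the_inv_into (Vn (k i + 1)) \<psi>"
  have \<phi>\<psi>: "\<phi> (\<psi> u) = u" if "u \<in> Vn (k i + 1)" for u
    unfolding \<phi>_def using inj that by (rule the_inv_into_f_f)
  show ?thesis
    unfolding isomorphic_def
  proof (intro exI[of _ \<phi>] conjI ballI allI)
    show "bij_betw \<phi> (generated_module s (v i)) (Vn (k i + 1))"
      unfolding \<phi>_def using inj surj by (intro bij_betw_the_inv_into) (auto simp: bij_betw_def)
  qed (auto simp: surj[symmetric] \<phi>\<psi>[simplified] closed jclosed[simplified] simp flip: add scl
      equiv)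
qed

end

text \<open>\<open>T\<close> is a finite spanning set, and \<open>count\<close> says that there are
  as many string vectors as elements of \<open>T\<close>. This numerical condition takes the place
  of an assumption that the strings span \<open>W\<close>.\<close>

locale full_jordan_strings = jordan_strings s I v k
  for s :: "('b \<Rightarrow>\<^sub>0 'a::field) \<Rightarrow> ('b \<Rightarrow>\<^sub>0 'a)" and I :: "'i set" and v k +
  fixes W T
  assumes W_span: "W = fsupp.span T" and finite_T: "finite T"
    and submodule_W: "submodule s W"
    and v_in_W: "i \<in> I \<Longrightarrow> v i \<in> W"
    and count: "(\<Sum>i\<in>I. k i + 1) = card T"
begin

lemma D_pow_v_in_W: "i \<in> I \<Longrightarrow> (D ^^ j) (v i) \<in> W"
  by (intro submodule_D_pow submodule_W v_in_W)

lemma string_in_W: "i \<in> I \<Longrightarrow> string i c \<in> W"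
  unfolding string_def using submodule_W D_pow_v_in_W
  by (intro fsupp.subspace_sum fsupp.subspace_scale) (auto simp: submodule_iff)

text \<open>A vector of \<open>W\<close> outside the span of the string vectors would extend them to
  an independent subset of \<open>fsupp.span T\<close> with more than \<open>card T\<close>
  elements.\<close>

lemma ex_string_coeffs:
  assumes "w \<in> W"
  shows "\<exists>c. w = (\<Sum>i\<in>I. string i (c i))"
proof -
  define J where "J = Sigma I (\<lambda>i. {..k i})"
  define b where "b = (\<lambda>(i, j). (D ^^ j) (v i))"
  have fin: "finite J" using finite_I by (auto simp: J_def)
  have sum_J: "(\<Sum>q\<in>J. scale (c q) (b q)) = (\<Sum>i\<in>I. string i (\<lambda>j. c (i, j)))" for c
    unfolding J_def string_def using finite_I by (subst sum.Sigma) (auto simp: b_def case_prod_beta)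
  have indep: "c q = 0" if "(\<Sum>q\<in>J. scale (c q) (b q)) = 0" "q \<in> J" for c q
    using strings_independent[of "\<lambda>i j. c (i, j)" "fst q" "snd q"] that sum_J[of c]
    by (auto simp: J_def)
  \<comment> \<open>Needed to pass from indices to a set of vectors of the same size: a repeated
    vector would give a relation with coefficients 1 and -1.\<close>
  have inj: "inj_on b J"
  proof (rule inj_onI, rule ccontr)
    fix q r assume qr: "q \<in> J" "r \<in> J" "b q = b r" "q \<noteq> r"
    have "(\<Sum>t\<in>J. scale (if t = q then 1 else if t = r then -1 else 0) (b t)) =
        (\<Sum>t\<in>J. (if t = q then b q else 0) - (if t = r then b r else 0))"
      using qr by (intro sum.cong) auto
    also have "\<dots> = 0"
      using qr fin by (simp add: sum_subtractf)
    finally show False using indep[of "\<lambda>t. if t = q then 1 else if t = r then -1 else 0" q] qr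
        by simp
  qed
  have ind: "fsupp.independent (b ` J)"
  proof
    assume "fsupp.dependent (b ` J)"
    then obtain u where u: "\<exists>x\<in>b ` J. u x \<noteq> 0" "(\<Sum>x\<in>b ` J. scale (u x) x) = 0"
      using fin by (auto simp: fsupp.dependent_finite)
    then have "(\<Sum>q\<in>J. scale (u (b q)) (b q)) = 0"
      by (simp add: sum.reindex[OF inj])
    from indep[OF this] u(1) show False by auto
  qed
  have card: "card (b ` J) = card T"
    using count finite_I unfolding card_image[OF inj] by (simp add: J_def card_SigmaI)
  have "w \<in> fsupp.span (b ` J)"
  proof (rule ccontr)
    assume w: "w \<notin> fsupp.span (b ` J)"
    then have "fsupp.independent (insert w (b ` J))" "w \<notin> b ` J"
      using ind fsupp.span_base[of w "b ` J"] by (auto simp: fsupp.independent_insert)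
    moreover have "insert w (b ` J) \<subseteq> fsupp.span T"
      using assms D_pow_v_in_W by (auto simp: J_def b_def W_span)
    ultimately have "card (insert w (b ` J)) \<le> card T"
      using fsupp.independent_span_bound[OF finite_T] by blast
    with \<open>w \<notin> b ` J\<close> fin card show False by simp
  qed
  then obtain u where "w = (\<Sum>x\<in>b ` J. scale (u x) x)"
    using fin by (auto simp: fsupp.span_finite)
  then have "w = (\<Sum>i\<in>I. string i (\<lambda>j. u (b (i, j))))"
    by (simp add: sum.reindex[OF inj] sum_J)
  then show ?thesis by (rule exI[of _ "\<lambda>i j. u (b (i, j))"])
qed

lemma internal_direct_sum_generated:
  "internal_direct_sum s W I (\<lambda>i. generated_module s (v i))"
  unfolding internal_direct_sum_def
proof (intro conjI ballI finite_I submodule_generated)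
  fix i assume "i \<in> I"
  then show "generated_module s (v i) \<subseteq> W"
    using string_in_W by (auto simp: generated_module_eq)
next
  fix w assume "w \<in> W"
  then obtain c where c: "w = (\<Sum>i\<in>I. string i (c i))" using ex_string_coeffs by blast
  show "\<exists>!u. (\<forall>i\<in>I. u i \<in> generated_module s (v i)) \<and> (\<forall>i. i \<notin> I \<longrightarrow> u i = 0) \<and>
      w = (\<Sum>i\<in>I. u i)"
  proof (rule ex1I[of _ "\<lambda>i. if i \<in> I then string i (c i) else 0"])
    fix u assume u: "(\<forall>i\<in>I. u i \<in> generated_module s (v i)) \<and> (\<forall>i. i \<notin> I \<longrightarrow> u i = 0) \<and>
      w = (\<Sum>i\<in>I. u i)"
    then have "\<forall>i\<in>I. \<exists>e. u i = string i e"
      by (auto simp: generated_module_eq)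
    then obtain e where e: "\<And>i. i \<in> I \<Longrightarrow> u i = string i (e i)" by metis
    then have "(\<Sum>i\<in>I. string i (\<lambda>j. e i j - c i j)) = 0"
      using u c by (simp add: string_diff[symmetric] sum_subtractf)
    from strings_independent[OF this] have "e i j = c i j" if "i \<in> I" "j \<le> k i" for i j
      using that by simp
    then show "u = (\<lambda>i. if i \<in> I then string i (c i) else 0)"
      using u e by (intro ext) (auto intro: string_cong)
  qed (auto simp: c generated_module_eq)
qed

lemma D_pow_strings:
  "(D ^^ n) (\<Sum>i\<in>I. string i (c i)) = (\<Sum>i\<in>I. string i (\<lambda>j. if j < n then 0 else c i (j - n)))"
  by (simp add: D_pow_sum D_pow_string)

text \<open>\<open>D\<close> shifts coefficients along the strings and loses only the last one of
  each, so independence forces all the others to vanish. Applied to \<open>sigma\<close>, this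
  describes the multi-linear invariants.\<close>

lemma kernel_D:
  assumes "w \<in> W" "D w = 0"
  shows "\<exists>a. w = (\<Sum>i\<in>I. scale (a i) ((D ^^ k i) (v i)))"
proof -
  obtain c where c: "w = (\<Sum>i\<in>I. string i (c i))" using ex_string_coeffs assms by blast
  then have "(\<Sum>i\<in>I. string i (\<lambda>j. if j < 1 then 0 else c i (j - 1))) = 0"
    using assms(2) D_pow_strings[of 1 c] by simp
  from strings_independent[OF this] have "c i j = 0" if "i \<in> I" "j < k i" for i j
    using that by (metis Suc_leI diff_Suc_1 not_less_eq One_nat_def not_less_zero)
  then have "string i (c i) = string i (\<lambda>j. if j = k i then c i (k i) else 0)" if "i \<in> I" for i
    using that by (intro string_cong) auto
  then have "w = (\<Sum>i\<in>I. scale (c i (k i)) ((D ^^ k i) (v i)))"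
    unfolding c by (intro sum.cong) (auto simp: string_delta)
  then show ?thesis by (intro exI[of _ "\<lambda>i. c i (k i)"])
qed

text \<open>An element of the image of \<open>D ^^ r\<close> has zero coefficients at all positions
  below \<open>r\<close>, while the end has its only coefficient at position \<open>k i\<close>. The
  factor \<open>t\<close> is there because \<open>theta\<close> is only a scalar multiple of the end
  of its string.\<close>

lemma end_in_image_iff:
  assumes "i \<in> I" "t \<noteq> 0"
  shows "scale t ((D ^^ k i) (v i)) \<in> (D ^^ r) ` W \<longleftrightarrow> r \<le> k i"
proof
  assume "r \<le> k i"
  then have "scale t ((D ^^ k i) (v i)) = (D ^^ r) (scale t ((D ^^ (k i - r)) (v i)))"
    by (simp add: D_pow_scale flip: funpow_add comp_apply[of "D ^^ r"])
  moreover have "scale t ((D ^^ (k i - r)) (v i)) \<in> W"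
    using assms D_pow_v_in_W submodule_W by (auto simp: submodule_iff intro!: fsupp.subspace_scale)
  ultimately show "scale t ((D ^^ k i) (v i)) \<in> (D ^^ r) ` W" by blast
next
  assume "scale t ((D ^^ k i) (v i)) \<in> (D ^^ r) ` W"
  then obtain c where "scale t ((D ^^ k i) (v i)) = (D ^^ r) (\<Sum>i\<in>I. string i (c i))"
    using ex_string_coeffs by blast
  then have eq: "scale t ((D ^^ k i) (v i)) = (\<Sum>i\<in>I. string i (\<lambda>j.
      if j < r then 0 else c i (j - r)))"
    by (simp add: D_pow_strings)
  have "scale t ((D ^^ k i) (v i)) =
      (\<Sum>i'\<in>I. if i' = i then string i (\<lambda>j. if j = k i then t else 0) else 0)"
    using assms finite_I by (simp add: string_delta)
  also have "\<dots> = (\<Sum>i'\<in>I. string i' (\<lambda>j. if i' = i \<and> j = k i then t else 0))"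
    by (intro sum.cong) (auto simp: string_zero)
  finally have "(\<Sum>i'\<in>I. string i' (\<lambda>j. (if i' = i \<and> j = k i then t else 0) -
      (if j < r then 0 else c i' (j - r)))) = 0"
    using eq by (simp add: string_diff[symmetric] sum_subtractf)
  from strings_independent[OF this assms(1), of "k i"] assms(2) show "r \<le> k i"
    by (auto split: if_splits)
qed

end

section \<open>Lead monomials\<close>

lemma var_rank_inject: "var_rank v = var_rank w \<Longrightarrow> v = w"
  by (cases v; cases w) (simp_all, presburger+)

lemma total_deg_superset:
  assumes "finite K" "Poly_Mapping.keys m \<subseteq> K"
  shows "total_deg m = (\<Sum>v\<in>K. Poly_Mapping.lookup m v)"
  unfolding total_deg_def using assms by (intro sum.mono_neutral_left) (auto simp: in_keys_iff)

lemma total_deg_add: "total_deg (m + n) = total_deg m + total_deg n"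
proof -
  define K where "K = Poly_Mapping.keys m \<union> Poly_Mapping.keys n"
  have K: "finite K" "Poly_Mapping.keys m \<subseteq> K" "Poly_Mapping.keys n \<subseteq> K"
    "Poly_Mapping.keys (m + n) \<subseteq> K"
    using keys_add[of m n] by (auto simp: K_def)
  show ?thesis
    by (simp add: total_deg_superset[OF K(1,2)] total_deg_superset[OF K(1,3)]
        total_deg_superset[OF K(1,4)] lookup_add sum.distrib)
qed

lemma grevlex_less_irrefl: "\<not> grevlex_less m m"
  by (simp add: grevlex_less_def)

lemma grevlex_less_trans:
  assumes "grevlex_less a b" "grevlex_less b c"
  shows "grevlex_less a c"
proof (cases "total_deg a < total_deg b \<or> total_deg b < total_deg c")
  case True
  then show ?thesis using assms by (auto simp: grevlex_less_def)
next
  case False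
  let ?l = Poly_Mapping.lookup
  obtain v where v: "?l a v > ?l b v" "\<forall>w. var_rank w > var_rank v \<longrightarrow> ?l a w = ?l b w"
    using assms(1) False by (auto simp: grevlex_less_def)
  obtain u where u: "?l b u > ?l c u" "\<forall>w. var_rank w > var_rank u \<longrightarrow> ?l b w = ?l c w"
    using assms(2) False by (auto simp: grevlex_less_def)
  have "total_deg a = total_deg c"
    using False assms by (auto simp: grevlex_less_def)
  moreover have "\<exists>x. ?l a x > ?l c x \<and> (\<forall>w. var_rank w > var_rank x \<longrightarrow> ?l a w = ?l c w)"
  proof (cases "var_rank u" "var_rank v" rule: linorder_cases)
    case less
    then show ?thesis using u v by (intro exI[of _ v]) auto
  next
    case equal
    then have "u = v" by (rule var_rank_inject)
    then show ?thesis using u v by (intro exI[of _ v]) auto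
  next
    case greater
    then show ?thesis using u v by (intro exI[of _ u]) auto
  qed
  ultimately show ?thesis by (simp add: grevlex_less_def)
qed

lemma grevlex_less_add_right: "grevlex_less a b \<Longrightarrow> grevlex_less (a + c) (b + c)"
  by (auto simp: grevlex_less_def total_deg_add lookup_add)

lemma grevlex_less_add_left: "grevlex_less a b \<Longrightarrow> grevlex_less (c + a) (c + b)"
  using grevlex_less_add_right[of a b c] by (simp add: add.commute)

lemma grevlex_less_linear:
  assumes "a \<noteq> b"
  shows "grevlex_less a b \<or> grevlex_less b a"
proof (cases "total_deg a" "total_deg b" rule: linorder_cases)
  case equal
  let ?l = Poly_Mapping.lookup
  define S where "S = {v. ?l a v \<noteq> ?l b v}"
  have "S \<subseteq> Poly_Mapping.keys a \<union> Poly_Mapping.keys b"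
    by (auto simp: S_def in_keys_iff)
  then have fin: "finite S" by (rule finite_subset) simp
  have "S \<noteq> {}" using assms by (auto simp: S_def poly_mapping_eq_iff fun_eq_iff)
  then have "Max (var_rank ` S) \<in> var_rank ` S" using fin by (intro Max_in) auto
  then obtain v where v: "v \<in> S" "var_rank v = Max (var_rank ` S)" by auto
  have "?l a w = ?l b w" if "var_rank w > var_rank v" for w
  proof (rule ccontr)
    assume "?l a w \<noteq> ?l b w"
    then have "var_rank w \<le> Max (var_rank ` S)" using fin by (intro Max_ge) (auto simp: S_def)
    then show False using that v(2) by simp
  qed
  then show ?thesis
    using equal v(1) by (auto simp: grevlex_less_def S_def neq_iff)
qed (auto simp: grevlex_less_def)

text \<open>The predicate under \<open>THE\<close> in \<open>LM\<close>, kept as a relation: it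
  carries existence with it and so implies that the polynomial is nonzero, which an equation for
  \<open>LM\<close> would not.\<close>

definition has_lead :: "'a::field mpoly \<Rightarrow> monomial \<Rightarrow> bool"
  where "has_lead f m \<longleftrightarrow> m \<in> Poly_Mapping.keys f \<and>
    (\<forall>n\<in>Poly_Mapping.keys f. n \<noteq> m \<longrightarrow> grevlex_less n m)"

lemma has_lead_unique: "has_lead f m \<Longrightarrow> has_lead f n \<Longrightarrow> m = n"
  unfolding has_lead_def by (metis grevlex_less_trans grevlex_less_irrefl)

lemma LM_eq:
  assumes "has_lead f m"
  shows "LM f = Poly_Mapping.single m 1"
proof -
  have "(THE m. has_lead f m) = m"
    using assms has_lead_unique by (intro the_equality)
  then show ?thesis by (simp add: LM_def has_lead_def)
qed

lemma has_lead_nonzero: "has_lead f m \<Longrightarrow> f \<noteq> 0"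
  by (auto simp: has_lead_def)

lemma has_lead_single [simp]: "c \<noteq> 0 \<Longrightarrow> has_lead (Poly_Mapping.single m c) m"
  by (auto simp: has_lead_def)

lemma has_lead_scale:
  assumes "has_lead f m" "c \<noteq> 0"
  shows "has_lead (scale c f) m"
  using assms by (auto simp: has_lead_def in_keys_iff lookup_scale)

lemma has_lead_add:
  assumes "has_lead f m" "\<And>n. n \<in> Poly_Mapping.keys g \<Longrightarrow> grevlex_less n m"
  shows "has_lead (f + g) m"
proof -
  have "m \<notin> Poly_Mapping.keys g" using assms(2) grevlex_less_irrefl by blast
  then have "m \<in> Poly_Mapping.keys (f + g)"
    using assms(1) by (auto simp: has_lead_def in_keys_iff lookup_add)
  then show ?thesis
    using assms keys_add[of f g] by (auto simp: has_lead_def)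
qed

lemma grevlex_less_add_cases:
  assumes "a = m \<or> grevlex_less a m" "b = n \<or> grevlex_less b n" "a \<noteq> m \<or> b \<noteq> n"
  shows "grevlex_less (a + b) (m + n)"
  using assms grevlex_less_add_right[of a m b] grevlex_less_add_left[of b n m] grevlex_less_trans
  by blast

lemma keys_mult_less:
  assumes "\<And>a. a \<in> Poly_Mapping.keys f \<Longrightarrow> grevlex_less a m"
    and "\<And>b. b \<in> Poly_Mapping.keys g \<Longrightarrow> b = n \<or> grevlex_less b n"
    and "q \<in> Poly_Mapping.keys (f * g)"
  shows "grevlex_less q (m + n)"
proof -
  obtain a b where q: "q = a + b" "a \<in> Poly_Mapping.keys f" "b \<in> Poly_Mapping.keys g"
    using assms(3) keys_mult[of f g] by auto
  then have "a \<noteq> m" using assms(1) grevlex_less_irrefl by auto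
  then show ?thesis
    using grevlex_less_add_cases[of a m b n] assms(1,2) q by auto
qed

lemma has_lead_mult:
  assumes f: "has_lead f m" and g: "has_lead g n"
  shows "has_lead (f * g) (m + n)"
proof -
  define f' where "f' = f - Poly_Mapping.single m (Poly_Mapping.lookup f m)"
  define g' where "g' = g - Poly_Mapping.single n (Poly_Mapping.lookup g n)"
  have f': "grevlex_less a m" if "a \<in> Poly_Mapping.keys f'" for a
    using that f by (auto simp: f'_def has_lead_def in_keys_iff lookup_minus lookup_single when_def
        split: if_splits)
  have g': "grevlex_less b n" if "b \<in> Poly_Mapping.keys g'" for b
    using that g by (auto simp: g'_def has_lead_def in_keys_iff lookup_minus lookup_single when_def
        split: if_splits)
  \<comment> \<open>Apart from the product of the two lead terms, each summand has a factor whose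
    monomials are all strictly below the corresponding lead, so nothing can cancel the product of
    the lead coefficients, which is nonzero in a field.\<close>
  have fg: "f * g = Poly_Mapping.single (m + n) (Poly_Mapping.lookup f m * Poly_Mapping.lookup g
      n) +
      (Poly_Mapping.single m (Poly_Mapping.lookup f m) * g' + f' * g)"
    by (simp add: f'_def g'_def algebra_simps mult_single)
  have "has_lead (Poly_Mapping.single (m + n) (Poly_Mapping.lookup f m * Poly_Mapping.lookup g n))
      (m + n)"
    using f g by (intro has_lead_single) (auto simp: has_lead_def in_keys_iff)
  then show ?thesis
    unfolding fg
  proof (rule has_lead_add)
    fix q assume "q \<in> Poly_Mapping.keys (Poly_Mapping.single m (Poly_Mapping.lookup f m) * g' +
        f' * g)"
    then consider "q \<in> Poly_Mapping.keys (g' * Poly_Mapping.single m (Poly_Mapping.lookup f m))"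
      | "q \<in> Poly_Mapping.keys (f' * g)"
      using keys_add by (metis UnE mult.commute subsetD)
    then show "grevlex_less q (m + n)"
    proof cases
      case 1
      then show ?thesis
        unfolding add.commute[of m] by (rule keys_mult_less[rotated 2])
            (auto intro: g' split: if_splits)
    next
      case 2
      then show ?thesis
        by (rule keys_mult_less[rotated 2]) (use f' g in \<open>auto simp: has_lead_def\<close>)
    qed
  qed
qed

lemma has_lead_one: "has_lead (1 :: 'a::field mpoly) 0"
  using has_lead_single[of "1::'a" 0] by simp

lemma has_lead_prod:
  "finite A \<Longrightarrow> (\<And>i. i \<in> A \<Longrightarrow> has_lead (f i) (m i)) \<Longrightarrow> has_lead (\<Prod>i\<in>A. f i) (\<Sum>i\<in>A. m i)"
  by (induction A rule: finite_induct) (auto simp: has_lead_one has_lead_mult)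

text \<open>Distinct lead monomials cannot cancel, so the greatest one with nonzero coefficient
  leads the sum. Either alternative of the last assumption excludes that all coefficients vanish:
  the first serves to find the lead monomial of a given invariant, the second to prove linear
  independence.\<close>

lemma has_lead_sum:
  assumes "finite I" "\<And>i. i \<in> I \<Longrightarrow> has_lead (f i) (m i)" "inj_on m I"
    and "(\<Sum>i\<in>I. scale (a i) (f i)) \<noteq> 0 \<or> (\<exists>i\<in>I. a i \<noteq> 0)"
  shows "\<exists>i\<in>I. has_lead (\<Sum>i\<in>I. scale (a i) (f i)) (m i)"
proof -
  define J where "J = {i\<in>I. a i \<noteq> 0}"
  have J: "finite J" "J \<subseteq> I" using assms by (auto simp: J_def)
  have sum_J: "(\<Sum>i\<in>I. scale (a i) (f i)) = (\<Sum>i\<in>J. scale (a i) (f i))"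
    using assms by (intro sum.mono_neutral_right) (auto simp: J_def)
  have ne: "J \<noteq> {}" using assms(4) by (force simp: J_def sum.neutral)
  have "K \<noteq> {} \<Longrightarrow> \<exists>i\<in>K. has_lead (\<Sum>i\<in>K. scale (a i) (f i)) (m i)" if "finite K" "K \<subseteq> J" for K
    using that
  proof (induction K rule: finite_induct)
    case (insert x K)
    have x: "has_lead (scale (a x) (f x)) (m x)"
      using insert J assms by (intro has_lead_scale) (auto simp: J_def)
    show ?case
    proof (cases "K = {}")
      case False
      then obtain i where i: "i \<in> K" "has_lead (\<Sum>i\<in>K. scale (a i) (f i)) (m i)"
        using insert by auto
      have "m x \<noteq> m i" using assms(3) i insert J by (metis inj_onD insert_subset subsetD)
      then consider "grevlex_less (m x) (m i)" | "grevlex_less (m i) (m x)"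
        using grevlex_less_linear by blast
      then show ?thesis
      proof cases
        case 1
        have "has_lead ((\<Sum>i\<in>K. scale (a i) (f i)) + scale (a x) (f x)) (m i)"
          using i(2)
        proof (rule has_lead_add)
          fix n assume "n \<in> Poly_Mapping.keys (scale (a x) (f x))"
          then show "grevlex_less n (m i)"
            using x 1 grevlex_less_trans[of n "m x" "m i"]
            by (cases "n = m x") (auto simp: has_lead_def)
        qed
        then show ?thesis using insert i by (auto simp: add.commute)
      next
        case 2
        have "has_lead (scale (a x) (f x) + (\<Sum>i\<in>K. scale (a i) (f i))) (m x)"
          using x
        proof (rule has_lead_add)
          fix n assume "n \<in> Poly_Mapping.keys (\<Sum>i\<in>K. scale (a i) (f i))"
          then show "grevlex_less n (m x)"
            using i(2) 2 grevlex_less_trans[of n "m i" "m x"]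
            by (cases "n = m i") (auto simp: has_lead_def)
        qed
        then show ?thesis using insert by auto
      qed
    qed (use x in simp)
  qed simp
  from this[OF J(1) subset_refl ne] J(2) show ?thesis unfolding sum_J by blast
qed

section \<open>The action on the polynomial ring\<close>

lemma scale_single: "scale c (Poly_Mapping.single k t) = Poly_Mapping.single k (c * t)"
  by (rule poly_mapping_eqI) (simp add: lookup_scale lookup_single when_def)

lemma scale_mult_single:
  "scale a (Poly_Mapping.single m 1) * scale b (Poly_Mapping.single n 1) =
    scale (a * b) (Poly_Mapping.single (m + n) 1)"
  by (simp add: scale_single mult_single)

lemma mult_eq_sum_singles:
  "f * g = (\<Sum>m\<in>Poly_Mapping.keys f. \<Sum>n\<in>Poly_Mapping.keys g.
      scale (Poly_Mapping.lookup f m * Poly_Mapping.lookup g n) (Poly_Mapping.single (m + n) 1))"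
  by (subst (1) poly_mapping_eq_sum_singles[of f], subst (1) poly_mapping_eq_sum_singles[of g])
    (simp add: sum_product scale_mult_single)

text \<open>Scalars become constant polynomials, so that the ring laws apply to
  \<open>scale\<close>.\<close>

lemma scale_eq_mult: "scale c f = Poly_Mapping.single 0 c * f"
proof -
  have "Poly_Mapping.single 0 c * f =
      Poly_Mapping.single 0 c * (\<Sum>k\<in>Poly_Mapping.keys f. scale (Poly_Mapping.lookup f k)
          (Poly_Mapping.single k 1))"
    by (simp flip: poly_mapping_eq_sum_singles)
  also have "\<dots> = scale c (\<Sum>k\<in>Poly_Mapping.keys f. scale (Poly_Mapping.lookup f k)
      (Poly_Mapping.single k 1))"
    by (simp add: sum_distrib_left fsupp.scale_sum_right scale_single mult_single)
  finally show ?thesis by (simp flip: poly_mapping_eq_sum_singles)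
qed

lemma scale_mult_left: "scale c f * g = scale c (f * g)"
  and scale_mult_right: "f * scale c g = scale c (f * g)"
  for f g :: "'b::comm_monoid_add \<Rightarrow>\<^sub>0 'a::field"
  by (simp_all add: scale_eq_mult ac_simps)

text \<open>A map that is multiplicative on monomials extends linearly to a multiplicative map.
  Since \<open>sigma\<close> is defined by linear extension, this is where it becomes an algebra
  map.\<close>

lemma linear_ext_mult:
  fixes e :: "'b::monoid_add \<Rightarrow> ('c::comm_monoid_add \<Rightarrow>\<^sub>0 'a::field)"
  assumes "\<And>m n. e (m + n) = e m * e n"
  shows "linear_ext e (f * g) = linear_ext e f * linear_ext e g"
proof -
  interpret L: Vector_Spaces.linear scale scale "linear_ext e" by (rule linear_linear_ext)
  have "linear_ext e (f * g) = (\<Sum>m\<in>Poly_Mapping.keys f. \<Sum>n\<in>Poly_Mapping.keys g.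
      scale (Poly_Mapping.lookup f m * Poly_Mapping.lookup g n) (e m * e n))"
    by (subst mult_eq_sum_singles) (simp add: L.sum L.scale assms)
  also have "\<dots> = linear_ext e f * linear_ext e g"
    by (simp add: linear_ext_def sum_product scale_mult_left scale_mult_right mult.commute)
  finally show ?thesis .
qed

definition sigma_monomial :: "monomial \<Rightarrow> 'a::field mpoly"
  where "sigma_monomial m = (\<Prod>v\<in>Poly_Mapping.keys m. sigma_var v ^ Poly_Mapping.lookup m v)"

lemma sigma_monomial_superset:
  assumes "finite K" "Poly_Mapping.keys m \<subseteq> K"
  shows "sigma_monomial m = (\<Prod>v\<in>K. sigma_var v ^ Poly_Mapping.lookup m v)"
  unfolding sigma_monomial_def using assms
  by (intro prod.mono_neutral_left) (auto simp: in_keys_iff)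

lemma sigma_monomial_add: "sigma_monomial (m + n) = sigma_monomial m * sigma_monomial n"
proof -
  define K where "K = Poly_Mapping.keys m \<union> Poly_Mapping.keys n"
  have K: "finite K" "Poly_Mapping.keys m \<subseteq> K" "Poly_Mapping.keys n \<subseteq> K"
    "Poly_Mapping.keys (m + n) \<subseteq> K"
    using keys_add[of m n] by (auto simp: K_def)
  show ?thesis
    by (simp add: sigma_monomial_superset[OF K(1,2)] sigma_monomial_superset[OF K(1,3)]
        sigma_monomial_superset[OF K(1,4)] lookup_add power_add prod.distrib)
qed

lemma sigma_eq_linear_ext: "sigma = linear_ext sigma_monomial"
  by (simp add: sigma_def sigma_monomial_def[abs_def])

global_interpretation sigma: linear_operator sigma
  by (rule linear_operator.intro) (simp only: sigma_eq_linear_ext linear_linear_ext)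

lemma sigma_mult: "sigma (f * g) = sigma f * sigma g"
  unfolding sigma_eq_linear_ext by (rule linear_ext_mult) (rule sigma_monomial_add)

lemma sigma_add: "sigma (f + g) = sigma f + sigma g"
  and sigma_scale: "sigma (scale c f) = scale c (sigma f)"
  by (simp_all add: sigma_eq_linear_ext linear_ext_add linear_ext_scale)

lemma sigma_diff: "sigma (f - g) = sigma f - sigma g"
  using sigma_add[of "f - g" g] by (simp add: algebra_simps)

lemma sigma_zero [simp]: "sigma 0 = 0"
  using sigma_diff[of 0 0] by simp

lemma sigma_one [simp]: "sigma 1 = 1"
  using linear_ext_single[of sigma_monomial 0 1]
  by (simp add: sigma_eq_linear_ext sigma_monomial_def)

lemma sigma_xvar [simp]: "sigma (xvar i) = xvar i"
  and sigma_yvar [simp]: "sigma (yvar i) = yvar i + xvar i"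
  by (simp_all add: sigma_eq_linear_ext sigma_monomial_def Var_def[of "X i"] Var_def[of "Y i"])

lemma sigma_prod: "sigma (\<Prod>i\<in>A. f i) = (\<Prod>i\<in>A. sigma (f i))"
  by (induction A rule: infinite_finite_induct) (auto simp: sigma_mult)

lemma sigma_udet [simp]: "sigma (udet i j) = udet i j"
  by (simp add: udet_def sigma_diff sigma_mult algebra_simps)

lemma D_mult: "sigma.D (f * g) = sigma.D f * g + sigma f * sigma.D g"
  by (simp add: sigma.D_def sigma_mult algebra_simps)

lemma sigma_D_pow: "sigma ((sigma.D ^^ n) f) = (sigma.D ^^ n) (sigma f)"
  by (induction n) (simp_all add: sigma.D_def sigma_diff)

lemma D_pow_invariant_mult:
  assumes "sigma c = c"
  shows "(sigma.D ^^ n) (c * f) = c * (sigma.D ^^ n) f"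
  by (induction n) (simp_all add: sigma.D_def sigma_mult assms algebra_simps)

text \<open>The iterated twisted Leibniz rule: \<open>D\<close> sends y_i to x_i and x_i to 0, so at
  most one of the \<open>Suc n\<close> copies of \<open>D\<close> falls on the last factor, and
  there are \<open>Suc n\<close> choices for it.\<close>

lemma D_pow_mult_yvar:
  fixes f :: "'a::field mpoly"
  shows "(sigma.D ^^ Suc n) (f * yvar i) =
    (sigma.D ^^ Suc n) f * yvar i + scale (of_nat (Suc n)) (sigma ((sigma.D ^^ n) f) * xvar i)"
proof (induction n)
  case 0
  show ?case by (simp add: D_mult) (simp add: sigma.D_def)
next
  case (Suc n)
  have "sigma.D (yvar i :: 'a mpoly) = xvar i" "sigma.D (xvar i :: 'a mpoly) = 0"
    by (simp_all add: sigma.D_def)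
  moreover have "sigma.D (sigma g) = sigma (sigma.D g)" for g :: "'a mpoly"
    using sigma_D_pow[of 1 g] by simp
  moreover have "scale 2 g = g + g" for g :: "'a mpoly"
    using fsupp.scale_left_distrib[of 1 1 g] by simp
  ultimately show ?case
    by (subst funpow.simps, unfold comp_apply, subst Suc)
      (simp add: sigma.D_add sigma.D_scale D_mult fsupp.scale_left_distrib add.assoc add.commute)
qed

text \<open>By \<open>D_pow_mult_yvar\<close>, one more factor y_i raises the power of
  \<open>D\<close> needed to annihilate the product by at most one.\<close>

lemma D_pow_prod_yvar_eq_0:
  "finite A \<Longrightarrow> card A < n \<Longrightarrow> (sigma.D ^^ n) (\<Prod>i\<in>A. yvar i :: 'a::field mpoly) = 0"
proof (induction A arbitrary: n rule: finite_induct)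
  case empty
  then obtain m where "n = Suc m" by (cases n) auto
  then show ?case by (simp add: funpow_Suc_right sigma.D_def[of 1] del: funpow.simps)
next
  case (insert a A)
  then obtain m where m: "n = Suc m" by (cases n) auto
  with insert have "(sigma.D ^^ Suc m) (\<Prod>i\<in>A. yvar i :: 'a mpoly) = 0"
    "(sigma.D ^^ m) (\<Prod>i\<in>A. yvar i :: 'a mpoly) = 0"
    by simp_all
  then show ?case
    using insert D_pow_mult_yvar[of m "\<Prod>i\<in>A. yvar i :: 'a mpoly" a]
    by (simp add: m mult.commute[of "yvar a"] del: funpow.simps)
qed

text \<open>In \<open>D_pow_mult_yvar\<close> the first summand vanishes for lack of factors. The
  second contributes \<open>Suc (card A)\<close>, which accumulates to the factorial, and its
  \<open>sigma\<close> disappears because a product of x_i is invariant.\<close>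

lemma D_pow_prod_yvar_card:
  "finite A \<Longrightarrow> (sigma.D ^^ card A) (\<Prod>i\<in>A. yvar i :: 'a::field mpoly) =
      scale (of_nat (fact (card A))) (\<Prod>i\<in>A. xvar i)"
proof (induction A rule: finite_induct)
  case (insert a A)
  then have "(sigma.D ^^ Suc (card A)) (\<Prod>i\<in>insert a A. yvar i :: 'a mpoly) =
      scale (of_nat (Suc (card A))) (sigma ((sigma.D ^^ card A) (\<Prod>i\<in>A. yvar i)) * xvar a)"
    using D_pow_mult_yvar[of "card A" "\<Prod>i\<in>A. yvar i :: 'a mpoly" a]
    by (simp add: D_pow_prod_yvar_eq_0 mult.commute[of "yvar a"] del: funpow.simps)
  also have "\<dots> = scale (of_nat (fact (Suc (card A)))) (\<Prod>i\<in>insert a A. xvar i)"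
    using insert
    by (simp add: sigma_scale sigma_prod scale_mult_left mult.commute[of "xvar a"] distrib_right)
  finally show ?case using insert by simp
qed simp

section \<open>Powers of \<open>sigma\<close> and the trace as polynomials in
  \<open>D\<close>\<close>

lemma sigma_pow_eq:
  "(sigma ^^ n) f = (\<Sum>j\<le>n. scale (of_nat (n choose j)) ((sigma.D ^^ j) f))"
proof (induction n)
  case (Suc n)
  let ?a = "\<lambda>c j. scale (of_nat c) ((sigma.D ^^ j) f)"
  have "(sigma ^^ Suc n) f = (\<Sum>j\<le>n. ?a (n choose j) j) + (\<Sum>j\<le>n. ?a (n choose j) (Suc j))"
    by (simp add: Suc sigma.s_eq[of "sum _ _"] sigma.D_sum sigma.D_scale)
  also have "(\<Sum>j\<le>n. ?a (n choose j) j) = ?a 1 0 + (\<Sum>j\<le>n. ?a (n choose Suc j) (Suc j))"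
    using sum.atMost_Suc_shift[of "\<lambda>j. ?a (n choose j) j" n] by (simp add: binomial_eq_0)
  also have "\<dots> + (\<Sum>j\<le>n. ?a (n choose j) (Suc j)) = ?a 1 0 + (\<Sum>j\<le>n. ?a (Suc n choose Suc j) (Suc j))"
    by (simp add: sum.distrib[symmetric] fsupp.scale_left_distrib[symmetric] add.assoc add.commute)
  also have "\<dots> = (\<Sum>j\<le>Suc n. ?a (Suc n choose j) j)"
    by (subst sum.atMost_Suc_shift) simp
  finally show ?case .
qed simp

text \<open>Summing \<open>k choose j\<close> over \<open>k < n\<close> gives
  \<open>n choose Suc j\<close>. Formally this is the geometric sum ((1 + D)^n - 1) / D.\<close>

lemma sum_sigma_pow_eq:
  "(\<Sum>k<n. (sigma ^^ k) f) = (\<Sum>j<n. scale (of_nat (n choose Suc j)) ((sigma.D ^^ j) f))"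
proof (induction n)
  case (Suc n)
  have "(\<Sum>k<Suc n. (sigma ^^ k) f) = (\<Sum>j<n. scale (of_nat (n choose Suc j)) ((sigma.D ^^ j) f)) +
      (\<Sum>j<Suc n. scale (of_nat (n choose j)) ((sigma.D ^^ j) f))"
    by (subst sum.lessThan_Suc) (simp only: Suc sigma_pow_eq[of n] lessThan_Suc_atMost)
  also have "(\<Sum>j<n. scale (of_nat (n choose Suc j)) ((sigma.D ^^ j) f)) =
      (\<Sum>j<Suc n. scale (of_nat (n choose Suc j)) ((sigma.D ^^ j) f))"
    by (simp add: binomial_eq_0)
  finally show ?case
    by (simp only: sum.distrib[symmetric] fsupp.scale_left_distrib[symmetric] of_nat_add[symmetric]
        binomial_Suc_Suc add.commute)
qed simp

lemma Tr_eq_D_pow: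
  assumes "prime p" "CHAR('a::field) = p"
  shows "Tr p (f :: 'a mpoly) = (sigma.D ^^ (p - 1)) f"
proof -
  have "Tr p f = (\<Sum>j<p. scale (of_nat (p choose Suc j)) ((sigma.D ^^ j) f))"
    by (simp add: Tr_def sum_sigma_pow_eq)
  also have "\<dots> = (\<Sum>j\<in>{p - 1}. scale (of_nat (p choose Suc j)) ((sigma.D ^^ j) f))"
  proof (rule sum.mono_neutral_right)
    show "\<forall>j\<in>{..<p} - {p - 1}. scale (of_nat (p choose Suc j)) ((sigma.D ^^ j) f) = 0"
    proof
      fix j assume "j \<in> {..<p} - {p - 1}"
      then have "p dvd (p choose Suc j)"
        using assms(1) by (intro dvd_choose_prime) auto
      then have "(of_nat (p choose Suc j) :: 'a) = 0"
        using assms(2) by (simp add: of_nat_eq_0_iff_char_dvd)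
      then show "scale (of_nat (p choose Suc j)) ((sigma.D ^^ j) f) = 0" by simp
    qed
  qed (use assms(1) prime_gt_0_nat in auto)
  also have "\<dots> = (sigma.D ^^ (p - 1)) f"
    using assms(1) prime_gt_0_nat[of p] by simp
  finally show ?thesis .
qed

lemma fact_nonzero_char:
  assumes "prime p" "CHAR('a::field) = p" "n < p"
  shows "(of_nat (fact n) :: 'a) \<noteq> 0"
proof -
  have "\<not> p dvd fact n" using assms by (simp add: prime_dvd_fact_iff)
  then show ?thesis using assms by (simp add: of_nat_eq_0_iff_char_dvd)
qed

section \<open>Multi-degrees\<close>

text \<open>Multi-degrees are functions on all indices: they add under multiplication, and degree 0
  outside \<open>{1..d}\<close> also expresses that no variable beyond those of
  \<open>poly_ring d\<close> occurs.\<close>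

definition multihomogeneous :: "(nat \<Rightarrow> nat) \<Rightarrow> 'a::field mpoly set"
  where "multihomogeneous e = {f. \<forall>m\<in>Poly_Mapping.keys f. multideg m = e}"

lemma multideg_add: "multideg (m + n) = (\<lambda>i. multideg m i + multideg n i)"
  by (simp add: multideg_def lookup_add fun_eq_iff)

lemma multihomogeneous_add:
  "f \<in> multihomogeneous e \<Longrightarrow> g \<in> multihomogeneous e \<Longrightarrow> f + g \<in> multihomogeneous e"
  using keys_add[of f g] by (auto simp: multihomogeneous_def)

lemma multihomogeneous_scale: "f \<in> multihomogeneous e \<Longrightarrow> scale c f \<in> multihomogeneous e"
  by (auto simp: multihomogeneous_def in_keys_iff lookup_scale)

lemma subspace_multihomogeneous: "fsupp.subspace (multihomogeneous e)"
  unfolding fsupp.subspace_def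
  by (intro conjI ballI allI multihomogeneous_add multihomogeneous_scale)
      (simp add: multihomogeneous_def)

lemma multihomogeneous_mult:
  assumes "f \<in> multihomogeneous e" "g \<in> multihomogeneous e'"
  shows "f * g \<in> multihomogeneous (\<lambda>i. e i + e' i)"
  using assms by (auto simp: multihomogeneous_def multideg_add dest!: subsetD[OF keys_mult])

lemma multihomogeneous_one: "1 \<in> multihomogeneous (\<lambda>_. 0)"
  by (auto simp: multihomogeneous_def multideg_def fun_eq_iff)

lemma multihomogeneous_prod:
  "finite A \<Longrightarrow> (\<And>a. a \<in> A \<Longrightarrow> f a \<in> multihomogeneous (e a)) \<Longrightarrow>
    (\<Prod>a\<in>A. f a) \<in> multihomogeneous (\<lambda>i. \<Sum>a\<in>A. e a i)"
  by (induction A rule: finite_induct) (auto simp: multihomogeneous_one multihomogeneous_mult)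

lemma multihomogeneous_power:
  "f \<in> multihomogeneous e \<Longrightarrow> f ^ n \<in> multihomogeneous (\<lambda>i. n * e i)"
  by (induction n) (auto simp: multihomogeneous_one dest: multihomogeneous_mult)

lemma multihomogeneous_xvar: "xvar j \<in> multihomogeneous (\<lambda>i. of_bool (i = j))"
  and multihomogeneous_yvar: "yvar j \<in> multihomogeneous (\<lambda>i. of_bool (i = j))"
  by (auto simp: multihomogeneous_def multideg_def fun_eq_iff Var_def lookup_single when_def)

lemma multihomogeneous_udet:
  "udet j k \<in> multihomogeneous (\<lambda>i. of_bool (i = j) + of_bool (i = k))"
  unfolding udet_def
  by (intro fsupp.subspace_diff[OF subspace_multihomogeneous])
    (use multihomogeneous_mult[OF multihomogeneous_xvar multihomogeneous_yvar, of j k]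
      multihomogeneous_mult[OF multihomogeneous_xvar multihomogeneous_yvar, of k j]
     in \<open>simp_all add: add.commute\<close>)

lemma multihomogeneous_sigma:
  fixes f :: "'a::field mpoly"
  assumes "f \<in> multihomogeneous e"
  shows "sigma f \<in> multihomogeneous e"
proof -
  have "sigma_monomial m \<in> (multihomogeneous (multideg m) :: 'a mpoly set)" for m
  proof -
    have "sigma_var v \<in> (multihomogeneous (\<lambda>i. of_bool (i = var_index v)) :: 'a mpoly set)" for v
      by (cases v) (auto intro: multihomogeneous_xvar multihomogeneous_yvar multihomogeneous_add)
    then have "(sigma_monomial m :: 'a mpoly) \<in> multihomogeneous (\<lambda>i. \<Sum>v\<in>Poly_Mapping.keys m.
        Poly_Mapping.lookup m v * of_bool (i = var_index v))"
      unfolding sigma_monomial_def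
      by (intro multihomogeneous_prod multihomogeneous_power) auto
    also have "(\<lambda>i. \<Sum>v\<in>Poly_Mapping.keys m. Poly_Mapping.lookup m v * of_bool (i = var_index v)) =
        multideg m"
    proof
      fix i
      have "(\<Sum>v\<in>Poly_Mapping.keys m. Poly_Mapping.lookup m v * of_bool (i = var_index v)) =
          (\<Sum>v\<in>Poly_Mapping.keys m. Poly_Mapping.lookup m v * of_bool (v = X i) +
            Poly_Mapping.lookup m v * of_bool (v = Y i))"
        by (intro sum.cong refl) (rename_tac v, case_tac v, auto)
      also have "\<dots> = multideg m i"
      proof -
        have "(\<Sum>v\<in>Poly_Mapping.keys m. Poly_Mapping.lookup m v * of_bool (v = w)) =
            Poly_Mapping.lookup m w" for w
          by (simp add: of_bool_def if_distrib[of "\<lambda>t. _ * t"] in_keys_iff cong: if_cong)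
        then show ?thesis by (simp add: sum.distrib multideg_def)
      qed
      finally show "(\<Sum>v\<in>Poly_Mapping.keys m. Poly_Mapping.lookup m v * of_bool (i = var_index v)) =
          multideg m i" .
    qed
    finally show ?thesis .
  qed
  moreover have "multideg m = e" if "m \<in> Poly_Mapping.keys f" for m
    using assms that by (simp add: multihomogeneous_def)
  ultimately have "(sigma_monomial m :: 'a mpoly) \<in> multihomogeneous e" if "m \<in>
      Poly_Mapping.keys f" for m
    using that by metis
  then show ?thesis
    unfolding sigma_eq_linear_ext linear_ext_def
    by (intro fsupp.subspace_sum[OF subspace_multihomogeneous] multihomogeneous_scale)
qed

lemma submodule_multihomogeneous: "submodule sigma (multihomogeneous e)"
  using subspace_multihomogeneous multihomogeneous_sigma by (auto simp: submodule_def)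

lemma multilinear_eq: "multilinear d = multihomogeneous (\<lambda>i. of_bool (i \<in> {1..d}))"
proof -
  have "(\<forall>v\<in>Poly_Mapping.keys m. var_index v \<in> {1..d}) \<and> (\<forall>i\<in>{1..d}. multideg m i = 1) \<longleftrightarrow>
      multideg m = (\<lambda>i. of_bool (i \<in> {1..d}))" (is "?L \<and> ?M \<longleftrightarrow> ?R") for m
  proof
    assume ?R
    have "var_index v \<in> {1..d}" if "v \<in> Poly_Mapping.keys m" for v
    proof -
      have "multideg m (var_index v) > 0"
        using that by (cases v) (auto simp: multideg_def in_keys_iff)
      then show ?thesis using \<open>?R\<close> by (simp split: if_splits)
    qed
    then show "?L \<and> ?M" using \<open>?R\<close> by simp
  next
    assume LM: "?L \<and> ?M"
    show ?R
    proof
      fix i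
      show "multideg m i = of_bool (i \<in> {1..d})"
      proof (cases "i \<in> {1..d}")
        case False
        then have "X i \<notin> Poly_Mapping.keys m" "Y i \<notin> Poly_Mapping.keys m" using LM by force+
        then show ?thesis using False by (simp add: multideg_def in_keys_iff)
      qed (use LM in simp)
    qed
  qed
  then show ?thesis
    unfolding multilinear_def poly_ring_def multihomogeneous_def
    by (simp only: mem_Collect_eq flip: ball_conj_distrib)
qed

text \<open>Within one multi-degree the graded comparison is always a tie, so
  \<open>grevlex_less\<close> is decided at the differing variable of highest rank.\<close>

lemma multideg_eq_imp_total_deg_eq:
  assumes "multideg m = multideg n"
  shows "total_deg m = total_deg n"
proof -
  define I where "I = var_index ` (Poly_Mapping.keys m \<union> Poly_Mapping.keys n)"
  have "total_deg q = (\<Sum>i\<in>I. multideg q i)" if "Poly_Mapping.keys q \<subseteq>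
      Poly_Mapping.keys m \<union> Poly_Mapping.keys n" for q
  proof -
    have "v \<in> X ` I \<union> Y ` I" if "v \<in> Poly_Mapping.keys q" for v
      using that \<open>Poly_Mapping.keys q \<subseteq> _\<close> by (cases v) (force simp: I_def image_iff)+
    then have "total_deg q = (\<Sum>v\<in>X ` I \<union> Y ` I. Poly_Mapping.lookup q v)"
      by (intro total_deg_superset) (auto simp: I_def)
    also have "\<dots> = (\<Sum>v\<in>X ` I. Poly_Mapping.lookup q v) + (\<Sum>v\<in>Y ` I. Poly_Mapping.lookup q v)"
      by (intro sum.union_disjoint) (auto simp: I_def)
    also have "\<dots> = (\<Sum>i\<in>I. multideg q i)"
      by (simp add: sum.reindex inj_on_def multideg_def sum.distrib)
    finally show ?thesis .
  qed
  from this[of m] this[of n] assms show ?thesis by simp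
qed

section \<open>Lead monomials of the invariants\<close>

lemma has_lead_Var: "has_lead (Var v :: 'a::field mpoly) (Poly_Mapping.single v 1)"
  by (simp add: Var_def)

lemma has_lead_udet:
  assumes "i < j"
  shows "has_lead (udet i j :: 'a::field mpoly) (Poly_Mapping.single (X i) 1 +
      Poly_Mapping.single (Y j) 1)"
proof -
  let ?m = "Poly_Mapping.single (X i) (1::nat) + Poly_Mapping.single (Y j) 1"
  let ?n = "Poly_Mapping.single (X j) (1::nat) + Poly_Mapping.single (Y i) 1"
  have "multideg ?n = multideg ?m"
    by (auto simp: multideg_def fun_eq_iff lookup_add lookup_single when_def)
  then have "total_deg ?n = total_deg ?m" by (rule multideg_eq_imp_total_deg_eq)
  moreover have "\<exists>v. Poly_Mapping.lookup ?n v > Poly_Mapping.lookup ?m v \<and>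
      (\<forall>w. var_rank w > var_rank v \<longrightarrow> Poly_Mapping.lookup ?n w = Poly_Mapping.lookup ?m w)"
  \<comment> \<open>\<open>X j\<close> has the highest rank among the variables involved and occurs
    only in \<open>?n\<close>; in the reverse lexicographic order this makes \<open>?n\<close> the
    smaller monomial.\<close>
  proof (intro exI[of _ "X j"] conjI allI impI)
    fix w assume "var_rank w > var_rank (X j)"
    then show "Poly_Mapping.lookup ?n w = Poly_Mapping.lookup ?m w"
      using assms by (cases w) (auto simp: lookup_add lookup_single when_def)
  qed (use assms in \<open>auto simp: lookup_add lookup_single when_def\<close>)
  ultimately have less: "grevlex_less ?n ?m" by (simp add: grevlex_less_def)
  have "udet i j = Poly_Mapping.single ?m (1::'a) + Poly_Mapping.single ?n (- 1)"
    by (simp add: udet_def Var_def mult_single single_uminus)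
  also have "has_lead \<dots> ?m"
    by (rule has_lead_add) (use less in \<open>auto\<close>)
  finally show ?thesis .
qed

lemma multihomogeneous_prod_yvar:
  "finite A \<Longrightarrow> (\<Prod>i\<in>A. yvar i) \<in> multihomogeneous (\<lambda>i. of_bool (i \<in> A))"
proof -
  assume "finite A"
  then have "(\<lambda>i. \<Sum>a\<in>A. of_bool (i = a)) = (\<lambda>i. of_bool (i \<in> A) :: nat)"
    by (auto simp: of_bool_def)
  then show ?thesis
    using multihomogeneous_prod[of A yvar "\<lambda>a i. of_bool (i = a)"] \<open>finite A\<close> multihomogeneous_yvar
    by auto
qed

text \<open>Induction adding the largest index \<open>b\<close>: in \<open>D_pow_mult_yvar\<close>
  the second summand carries x_b, which ranks after all other variables present, so it is smaller
  than the first. The copies of \<open>D\<close> thus act on \<open>A\<close> in the lead monomial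
  and the y_i with index in \<open>B\<close> are left alone. The base case is the factorial formula,
  whence the assumption on \<open>fact (card A)\<close>.\<close>

lemma has_lead_D_pow_prod_yvar:
  assumes "finite A" "(of_nat (fact (card A)) :: 'a::field) \<noteq> 0"
    and "finite B" "\<And>a b. a \<in> A \<Longrightarrow> b \<in> B \<Longrightarrow> a < b"
  shows "has_lead ((sigma.D ^^ card A) (\<Prod>i\<in>A \<union> B. yvar i) :: 'a mpoly)
    ((\<Sum>i\<in>A. Poly_Mapping.single (X i) 1) + (\<Sum>i\<in>B. Poly_Mapping.single (Y i) 1))"
  using assms(3,4)
proof (induction B rule: finite_linorder_max_induct)
  case empty
  have "has_lead (\<Prod>i\<in>A. xvar i :: 'a mpoly) (\<Sum>i\<in>A. Poly_Mapping.single (X i) 1)"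
    using assms(1) by (intro has_lead_prod has_lead_Var)
  then show ?case
    using assms(1,2) by (simp add: D_pow_prod_yvar_card has_lead_scale)
next
  case (insert b B)
  let ?S = "A \<union> B" and ?k = "card A"
  define F where "F = (\<Prod>i\<in>?S. yvar i :: 'a mpoly)"
  define m where "m = (\<Sum>i\<in>A. Poly_Mapping.single (X i) (1::nat)) +
      (\<Sum>i\<in>B. Poly_Mapping.single (Y i) 1)"
  have S: "finite ?S" "b \<notin> ?S" "\<And>i. i \<in> ?S \<Longrightarrow> i < b"
    using insert.hyps insert.prems assms(1) by auto
  have F: "(\<Prod>i\<in>A \<union> insert b B. yvar i :: 'a mpoly) = F * yvar b"
    using S by (simp add: F_def mult.commute)
  have IH: "has_lead ((sigma.D ^^ ?k) F) m"
    using insert by (simp add: F_def m_def)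
  have m': "(\<Sum>i\<in>A. Poly_Mapping.single (X i) 1) + (\<Sum>i\<in>insert b B. Poly_Mapping.single (Y i) 1) =
      m + Poly_Mapping.single (Y b) 1"
    using S insert.hyps by (simp add: m_def ac_simps)
  have lead: "has_lead ((sigma.D ^^ ?k) F * yvar b) (m + Poly_Mapping.single (Y b) 1)"
    by (intro has_lead_mult IH has_lead_Var)
  have homF: "(sigma.D ^^ n) F \<in> multihomogeneous (\<lambda>i. of_bool (i \<in> ?S))" for n
    unfolding F_def using S(1)
    by (intro sigma.submodule_D_pow submodule_multihomogeneous multihomogeneous_prod_yvar)
  then have deg_m: "multideg m = (\<lambda>i. of_bool (i \<in> ?S))"
    using IH by (auto simp: multihomogeneous_def has_lead_def)
  \<comment> \<open>All of \<open>?S\<close> lies below \<open>b\<close>, so the comparison with a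
    monomial containing x_b is decided at x_b itself.\<close>
  have vanish: "Poly_Mapping.lookup q w = 0" if "multideg q = (\<lambda>i. of_bool (i \<in> ?S))"
      "var_index w \<ge> b" for q w
  proof -
    have "var_index w \<notin> ?S" using S(3)[of "var_index w"] that(2) by linarith
    then have "multideg q (var_index w) = 0" using that(1) by simp
    then show ?thesis by (cases w) (auto simp: multideg_def)
  qed
  show ?case
  proof (cases ?k)
    case 0
    then show ?thesis unfolding F m' using lead by simp
  next
    case (Suc k)
    let ?R = "scale (of_nat (Suc k)) (sigma ((sigma.D ^^ k) F) * xvar b)"
    have "has_lead ((sigma.D ^^ ?k) F * yvar b + ?R) (m + Poly_Mapping.single (Y b) 1)"
      using lead
    proof (rule has_lead_add)
      fix n assume "n \<in> Poly_Mapping.keys ?R"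
      then have "n \<in> Poly_Mapping.keys (sigma ((sigma.D ^^ k) F) * xvar b)"
        by (auto simp: in_keys_iff lookup_scale)
      then obtain q where q: "q \<in> Poly_Mapping.keys (sigma ((sigma.D ^^ k) F))" "n = q +
          Poly_Mapping.single (X b) 1"
        using keys_mult[of "sigma ((sigma.D ^^ k) F)" "xvar b"] by (auto simp: Var_def)
      have deg_q: "multideg q = (\<lambda>i. of_bool (i \<in> ?S))"
        using q(1) multihomogeneous_sigma[OF homF] by (auto simp: multihomogeneous_def)
      have "multideg n = multideg (m + Poly_Mapping.single (Y b) 1)"
        unfolding q(2) multideg_add deg_q deg_m by (auto simp: multideg_def lookup_single when_def)
      then have "total_deg n = total_deg (m + Poly_Mapping.single (Y b) 1)"
        by (rule multideg_eq_imp_total_deg_eq)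
      moreover have "\<exists>v. Poly_Mapping.lookup n v > Poly_Mapping.lookup (m +
          Poly_Mapping.single (Y b) 1) v \<and>
          (\<forall>w. var_rank w > var_rank v \<longrightarrow>
            Poly_Mapping.lookup n w = Poly_Mapping.lookup (m + Poly_Mapping.single (Y b) 1) w)"
      proof (intro exI[of _ "X b"] conjI allI impI)
        fix w assume "var_rank w > var_rank (X b)"
        then have "var_index w > b" by (cases w) auto
        then show "Poly_Mapping.lookup n w = Poly_Mapping.lookup (m +
            Poly_Mapping.single (Y b) 1) w"
          using vanish[OF deg_q, of w] vanish[OF deg_m, of w]
          by (cases w) (auto simp: q(2) lookup_add lookup_single when_def)
      qed (use vanish[OF deg_q, of "X b"] vanish[OF deg_m, of "X b"]
           in \<open>auto simp: q(2) lookup_add lookup_single when_def\<close>)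
      ultimately show "grevlex_less n (m + Poly_Mapping.single (Y b) 1)"
        by (simp add: grevlex_less_def)
    qed
    then show ?thesis unfolding F m' Suc D_pow_mult_yvar .
  qed
qed

section \<open>Lattice paths\<close>

lemma finishing_height_Nil [simp]: "finishing_height [] = 0"
  by (simp add: finishing_height_def)

lemma finishing_height_snoc:
  "finishing_height (\<gamma> @ [s]) = finishing_height \<gamma> + (if s = xstep then 1 else - 1)"
  by (cases s) (simp_all add: finishing_height_def)

text \<open>Membership in the families of paths is a condition on all prefixes, so appending a step
  adds a single condition. For initial Dyck paths, where some prefix is asked for, it is applied to
  the negated predicate.\<close>

lemma all_prefixes_snoc:
  "(\<forall>k\<le>length (\<gamma> @ [s]). P (take k (\<gamma> @ [s]))) \<longleftrightarrow> (\<forall>k\<le>length \<gamma>. P (take k \<gamma>)) \<and> P (\<gamma> @ [s])"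
  by (auto simp: le_Suc_eq)

lemma PDP_iff:
  "\<gamma> \<in> PDP d q \<longleftrightarrow> length \<gamma> = d \<and>
    (\<forall>k\<le>length \<gamma>. 0 \<le> finishing_height (take k \<gamma>) \<and> finishing_height (take k \<gamma>) \<le> int q)"
proof -
  have "height \<gamma> \<le> int q \<longleftrightarrow> (\<forall>k\<le>length \<gamma>. finishing_height (take k \<gamma>) \<le> int q)"
    unfolding height_def by (subst Max_le_iff) auto
  then show ?thesis by (auto simp: PDP_def partial_dyck_def)
qed

lemma partial_dyck_snoc:
  "partial_dyck (\<gamma> @ [s]) \<longleftrightarrow> partial_dyck \<gamma> \<and> 0 \<le> finishing_height (\<gamma> @ [s])"
  unfolding partial_dyck_def by (rule all_prefixes_snoc)

lemma PDP_snoc: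
  "\<gamma> @ [s] \<in> PDP (length (\<gamma> @ [s])) q \<longleftrightarrow> \<gamma> \<in> PDP (length \<gamma>) q \<and>
    0 \<le> finishing_height (\<gamma> @ [s]) \<and> finishing_height (\<gamma> @ [s]) \<le> int q"
  using all_prefixes_snoc[of \<gamma> s "\<lambda>\<delta>. 0 \<le> finishing_height \<delta> \<and> finishing_height \<delta> \<le> int q"]
  by (simp add: PDP_iff)

lemma PDP_finishing_height:
  "\<gamma> \<in> PDP d q \<Longrightarrow> 0 \<le> finishing_height \<gamma> \<and> finishing_height \<gamma> \<le> int q"
  by (auto simp: PDP_iff dest: spec[of _ "length \<gamma>"])

lemma IDP_iff:
  "\<gamma> \<in> IDP d q \<longleftrightarrow> length \<gamma> = d \<and>
    (\<exists>k\<le>length \<gamma>. partial_dyck (take k \<gamma>) \<and> finishing_height (take k \<gamma>) = int q)"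
proof
  assume "\<gamma> \<in> IDP d q"
  then obtain \<alpha> \<beta> where "length \<gamma> = d" "\<gamma> = \<alpha> @ \<beta>" "partial_dyck \<alpha>" "finishing_height \<alpha> = int q"
    by (auto simp: IDP_def)
  then show "length \<gamma> = d \<and> (\<exists>k\<le>length \<gamma>. partial_dyck (take k \<gamma>) \<and> finishing_height (take k \<gamma>) =
      int q)"
    by (auto intro!: exI[of _ "length \<alpha>"])
next
  assume "length \<gamma> = d \<and> (\<exists>k\<le>length \<gamma>. partial_dyck (take k \<gamma>) \<and> finishing_height (take k \<gamma>) =
      int q)"
  then show "\<gamma> \<in> IDP d q"
    unfolding IDP_def using append_take_drop_id by (metis (mono_tags, lifting) mem_Collect_eq)
qed

lemma IDP_snoc:
  "\<gamma> @ [s] \<in> IDP (length (\<gamma> @ [s])) q \<longleftrightarrow> \<gamma> \<in> IDP (length \<gamma>) q \<or>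
    partial_dyck (\<gamma> @ [s]) \<and> finishing_height (\<gamma> @ [s]) = int q"
  using all_prefixes_snoc[of \<gamma> s "\<lambda>\<delta>. \<not> (partial_dyck \<delta> \<and> finishing_height \<delta> = int q)"]
  unfolding IDP_iff by blast

lemma PDP_imp_partial_dyck: "\<gamma> \<in> PDP d q \<Longrightarrow> partial_dyck \<gamma>"
  by (simp add: PDP_def)

lemma PDP_IDP_disjoint: "\<gamma> \<in> PDP d q \<Longrightarrow> q < r \<Longrightarrow> \<gamma> \<notin> IDP d r"
  by (force simp: PDP_iff IDP_iff)

text \<open>The height changes by one at each step, so a partial Dyck path that exceeds
  \<open>q\<close> must first hit \<open>q + 1\<close> exactly.\<close>

lemma partial_dyck_cases:
  "partial_dyck \<gamma> \<Longrightarrow> \<gamma> \<in> PDP (length \<gamma>) q \<or> \<gamma> \<in> IDP (length \<gamma>) (Suc q)"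
proof (induction \<gamma> rule: rev_induct)
  case Nil
  then show ?case by (simp add: PDP_iff)
next
  case (snoc s \<gamma>)
  then have "\<gamma> \<in> PDP (length \<gamma>) q \<or> \<gamma> \<in> IDP (length \<gamma>) (Suc q)"
    by (simp add: partial_dyck_snoc)
  then show ?case
  proof
    assume \<gamma>: "\<gamma> \<in> PDP (length \<gamma>) q"
    then have "finishing_height (\<gamma> @ [s]) \<le> int q + 1"
      using PDP_finishing_height[OF \<gamma>] by (simp add: finishing_height_snoc)
    then show ?thesis
      using \<gamma> snoc.prems unfolding PDP_snoc IDP_snoc by (auto simp: partial_dyck_snoc)
  qed (unfold IDP_snoc, simp)
qed

text \<open>
  For \<open>q = p - 2\<close> this is the dimension of the summand attached to \<open>\<gamma>\<close>, with value \<open>0\<close> on the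
      paths that
  have none.  The lemma \<open>weight_snoc\<close> mirrors \<open>V\<^sub>n \<otimes> V\<^sub>2 \<cong> V\<^sub>n\<^sub>+\<^sub>1 \<oplus> V\<^sub>n\<^sub>-\<^sub>1\<close> for \<open>n < p\<close> and
  \<open>V\<^sub>p \<otimes> V\<^sub>2 \<cong> V\<^sub>p \<oplus> V\<^sub>p\<close>.
\<close>

definition weight :: "nat \<Rightarrow> step list \<Rightarrow> nat"
  where "weight q \<gamma> = (if \<gamma> \<in> PDP (length \<gamma>) q then nat (finishing_height \<gamma>) + 1
    else if \<gamma> \<in> IDP (length \<gamma>) (Suc q) then q + 2 else 0)"

lemma weight_snoc: "weight q (\<gamma> @ [xstep]) + weight q (\<gamma> @ [ystep]) = 2 * weight q \<gamma>"
proof -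
  consider "\<gamma> \<in> PDP (length \<gamma>) q" | "\<gamma> \<notin> PDP (length \<gamma>) q" "\<gamma> \<in> IDP (length \<gamma>) (Suc q)"
    | "\<gamma> \<notin> PDP (length \<gamma>) q" "\<gamma> \<notin> IDP (length \<gamma>) (Suc q)" by blast
  then show ?thesis
  proof cases
    case 1
    \<comment> \<open>From height \<open>h\<close> the steps contribute \<open>h + 2\<close> and
      \<open>h\<close>, twice \<open>h + 1\<close> in total. The two boundary cases fit: at
      \<open>h = 0\<close> the y-step leaves the region and contributes 0, and at
      \<open>h = q\<close> the x-step escapes with weight \<open>q + 2\<close>.\<close>
    have h: "0 \<le> finishing_height \<gamma>" "finishing_height \<gamma> \<le> int q"
      using PDP_finishing_height[OF 1] by auto
    have "\<gamma> \<notin> IDP (length \<gamma>) (Suc q)"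
      using PDP_IDP_disjoint[OF 1] by simp
    then show ?thesis
      unfolding weight_def PDP_snoc IDP_snoc partial_dyck_snoc
      using 1 h PDP_imp_partial_dyck[OF 1] by (auto simp: finishing_height_snoc)
  next
    case 2
    then show ?thesis unfolding weight_def PDP_snoc IDP_snoc by simp
  next
    case 3
    then have "\<not> partial_dyck \<gamma>" using partial_dyck_cases by blast
    with 3 show ?thesis unfolding weight_def PDP_snoc IDP_snoc partial_dyck_snoc by simp
  qed
qed

section \<open>Counting lattice paths of given length\<close>

lemma finite_paths: "finite {\<gamma> :: step list. length \<gamma> = d}"
proof -
  have "(UNIV :: step set) = {xstep, ystep}" using step.exhaust by auto
  then have "finite (UNIV :: step set)" by (metis finite.emptyI finite.insertI)
  then show ?thesis using finite_lists_length_eq[of UNIV d] by simp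
qed

lemma sum_paths_Suc:
  "(\<Sum>\<gamma> | length \<gamma> = Suc d. f \<gamma>) = (\<Sum>\<gamma> | length \<gamma> = d. f (\<gamma> @ [xstep]) + f (\<gamma> @ [ystep]))"
proof -
  have eq: "{\<gamma>. length \<gamma> = Suc d} = (\<lambda>\<gamma>. \<gamma> @ [xstep]) ` {\<gamma>. length \<gamma> =
      d} \<union> (\<lambda>\<gamma>. \<gamma> @ [ystep]) ` {\<gamma>. length \<gamma> = d}"
  proof (intro equalityI subsetI)
    fix \<gamma> :: "step list" assume "\<gamma> \<in> {\<gamma>. length \<gamma> = Suc d}"
    then have "\<gamma> = butlast \<gamma> @ [last \<gamma>]" "length (butlast \<gamma>) =
        d" by (cases \<gamma> rule: rev_cases; simp)+
    then show "\<gamma> \<in> (\<lambda>\<gamma>. \<gamma> @ [xstep]) ` {\<gamma>. length \<gamma> = d} \<union> (\<lambda>\<gamma>. \<gamma> @ [ystep]) ` {\<gamma>. length \<gamma> = d}"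
      by (cases "last \<gamma>") (auto intro: image_eqI[of _ _ "butlast \<gamma>"])
  qed auto
  show ?thesis
    unfolding eq using finite_paths
    by (subst sum.union_disjoint) (auto simp: sum.reindex inj_on_def sum.distrib)
qed

lemma sum_weight: "(\<Sum>\<gamma> | length \<gamma> = d. weight q \<gamma>) = 2 ^ d"
proof (induction d)
  case 0
  have "{\<gamma> :: step list. length \<gamma> = 0} = {[]}" by auto
  then show ?case by (simp add: weight_def PDP_iff)
next
  case (Suc d)
  then show ?case by (simp add: sum_paths_Suc weight_snoc sum_distrib_left[symmetric])
qed

lemma card_paths: "card {\<gamma> :: step list. length \<gamma> = d} = 2 ^ d"
proof (induction d)
  case (Suc d)
  then show ?case using sum_paths_Suc[of "\<lambda>_. 1 :: nat" d] by simp
next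
  case 0
  have "{\<gamma> :: step list. length \<gamma> = 0} = {[]}" by auto
  then show ?case by simp
qed

lemma card_letters:
  "k \<le> length \<gamma> \<Longrightarrow> card {i \<in> {1..k}. letter \<gamma> i = a} = count_list (take k \<gamma>) a"
proof (induction k)
  case (Suc k)
  have "{i \<in> {1..Suc k}. letter \<gamma> i = a} =
      (if \<gamma> ! k = a then insert (Suc k) {i \<in> {1..k}. letter \<gamma> i = a} else {i \<in>
          {1..k}. letter \<gamma> i = a})"
    by (auto simp: letter_def le_Suc_eq)
  then show ?case using Suc by (simp add: take_Suc_conv_app_nth)
qed simp

section \<open>The matching\<close>

text \<open>The point is that the set under \<open>Max\<close> is not empty. The path is still at
  height at least 0 after its y-step at \<open>j\<close>, so before \<open>j\<close> there are more
  x-steps than y-steps, and earlier y-steps cannot have used up all x-steps.\<close>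

lemma rho_candidate:
  assumes "partial_dyck \<gamma>" "j \<in> I1 \<gamma>"
  shows "rho \<gamma> j \<in> {i \<in> {1..<j}. letter \<gamma> i = xstep} - rho \<gamma> ` {s \<in> {1..<j}. letter \<gamma> s = ystep}"
proof -
  let ?A = "{i \<in> {1..<j}. letter \<gamma> i = xstep}" and ?B = "{s \<in> {1..<j}. letter \<gamma> s = ystep}"
  obtain k where k: "j = Suc k" "Suc k \<le> length \<gamma>" "\<gamma> ! k = ystep"
    using assms(2) by (cases j) (auto simp: I1_def letter_def)
  have "finishing_height (take (Suc k) \<gamma>) \<ge> 0"
    using assms(1) k unfolding partial_dyck_def by blast
  then have "finishing_height (take k \<gamma>) \<ge> 1"
    using k by (simp add: take_Suc_conv_app_nth finishing_height_snoc)
  moreover have "{1..<j} = {1..k}" using k by auto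
  then have "card ?A = count_list (take k \<gamma>) xstep" "card ?B = count_list (take k \<gamma>) ystep"
    using card_letters[of k \<gamma>] k by simp_all
  ultimately have "card ?B < card ?A" by (simp add: finishing_height_def)
  moreover have "card (rho \<gamma> ` ?B) \<le> card ?B" by (intro card_image_le) simp
  ultimately have "card (rho \<gamma> ` ?B) < card ?A" by linarith
  have "\<not> ?A \<subseteq> rho \<gamma> ` ?B"
  proof
    assume "?A \<subseteq> rho \<gamma> ` ?B"
    then have "card ?A \<le> card (rho \<gamma> ` ?B)" by (rule card_mono[rotated]) simp
    with \<open>card (rho \<gamma> ` ?B) < card ?A\<close> show False by linarith
  qed
  then have "Max (?A - rho \<gamma> ` ?B) \<in> ?A - rho \<gamma> ` ?B" by (intro Max_in) auto
  then show ?thesis by (simp only: rho.simps[of \<gamma> j])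
qed

lemma rho_less: "partial_dyck \<gamma> \<Longrightarrow> j \<in> I1 \<gamma> \<Longrightarrow> rho \<gamma> j < j"
  using rho_candidate[of \<gamma> j] by simp

text \<open>The recursion removes every value taken earlier from the candidates of a later
  index.\<close>

lemma inj_on_rho:
  assumes "partial_dyck \<gamma>"
  shows "inj_on (rho \<gamma>) (I1 \<gamma>)"
proof -
  have "rho \<gamma> i \<noteq> rho \<gamma> j" if "i \<in> I1 \<gamma>" "j \<in> I1 \<gamma>" "i < j" for i j
  proof -
    have "i \<in> {s \<in> {1..<j}. letter \<gamma> s = ystep}" using that by (auto simp: I1_def)
    then have i: "rho \<gamma> i \<in> rho \<gamma> ` {s \<in> {1..<j}. letter \<gamma> s = ystep}" by (rule imageI)
    have j: "rho \<gamma> j \<notin> rho \<gamma> ` {s \<in> {1..<j}. letter \<gamma> s = ystep}"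
      using rho_candidate[OF assms that(2)] unfolding Diff_iff by (rule conjunct2)
    show ?thesis
    proof
      assume "rho \<gamma> i = rho \<gamma> j"
      from this i have "rho \<gamma> j \<in> rho \<gamma> ` {s \<in> {1..<j}. letter \<gamma> s = ystep}" by (rule subst)
      with j show False by contradiction
    qed
  qed
  then show ?thesis by (rule linorder_inj_onI')
qed

lemma finite_I1 [simp]: "finite (I1 \<gamma>)" and finite_I2 [simp]: "finite (I2 \<gamma>)"
  and finite_I3 [simp]: "finite (I3 \<gamma>)"
  by (simp_all add: I1_def I2_def I3_def)

lemma I2_subset:
  assumes "partial_dyck \<gamma>"
  shows "I2 \<gamma> \<subseteq> {i \<in> {1..length \<gamma>}. letter \<gamma> i = xstep}"
proof
  fix i assume "i \<in> I2 \<gamma>"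
  then obtain j where j: "j \<in> I1 \<gamma>" "i = rho \<gamma> j" by (auto simp: I2_def)
  then have "j \<le> length \<gamma>" by (simp add: I1_def)
  then show "i \<in> {i \<in> {1..length \<gamma>}. letter \<gamma> i = xstep}"
    using rho_candidate[OF assms j(1)] j(2) by simp
qed

lemma not_ystep_iff: "a \<noteq> ystep \<longleftrightarrow> a = xstep"
  by (cases a) auto

lemma I_partition:
  assumes "partial_dyck \<gamma>"
  shows "I1 \<gamma> \<inter> I2 \<gamma> = {}" "(I1 \<gamma> \<union> I2 \<gamma>) \<inter> I3 \<gamma> = {}" "I1 \<gamma> \<union> I2 \<gamma> \<union> I3 \<gamma> = {1..length \<gamma>}"
    "i \<in> I1 \<gamma> \<Longrightarrow> letter \<gamma> i = ystep" "i \<in> I2 \<gamma> \<union> I3 \<gamma> \<Longrightarrow> letter \<gamma> i = xstep"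
  using I2_subset[OF assms] by (auto simp: I1_def I3_def not_ystep_iff)

text \<open>\<open>rho\<close> is injective with values in the x-steps, so each y-step uses up
  exactly one x-step and the excess stays unmatched.\<close>

lemma card_I3:
  assumes "partial_dyck \<gamma>"
  shows "int (card (I3 \<gamma>)) = finishing_height \<gamma>"
proof -
  let ?X = "{i \<in> {1..length \<gamma>}. letter \<gamma> i = xstep}"
  have "I3 \<gamma> = ?X - I2 \<gamma>" by (auto simp: I3_def I1_def simp flip: not_ystep_iff)
  then have "card (I3 \<gamma>) = card ?X - card (I2 \<gamma>)" "card (I2 \<gamma>) \<le> card ?X"
    using I2_subset[OF assms] by (simp_all add: card_Diff_subset card_mono)
  moreover have "card (I2 \<gamma>) = card (I1 \<gamma>)"
    unfolding I2_def using inj_on_rho[OF assms] by (rule card_image)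
  moreover have "card ?X = count_list \<gamma> xstep" "card (I1 \<gamma>) = count_list \<gamma> ystep"
    using card_letters[of "length \<gamma>" \<gamma>] by (simp_all add: I1_def)
  ultimately show ?thesis by (simp add: finishing_height_def)
qed

section \<open>The polynomials attached to a path\<close>

definition path_monomial :: "step list \<Rightarrow> monomial"
  where "path_monomial \<gamma> = (\<Sum>i\<in>{1..length \<gamma>}. Poly_Mapping.single (step_var (letter \<gamma> i) i) 1)"

lemma prod_Var: "finite A \<Longrightarrow> (\<Prod>i\<in>A. Var (v i) :: 'a::field mpoly) =
    Poly_Mapping.single (\<Sum>i\<in>A. Poly_Mapping.single (v i) 1) 1"
  by (induction A rule: finite_induct) (simp_all add: Var_def mult_single)

lemma Lambda_eq: "Lambda \<gamma> = Poly_Mapping.single (path_monomial \<gamma>) 1"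
  by (simp add: Lambda_def path_monomial_def prod_Var)

lemma lookup_path_monomial:
  "Poly_Mapping.lookup (path_monomial \<gamma>) (X i) = of_bool (i \<in> {1..length \<gamma>} \<and> letter \<gamma> i = xstep)"
  "Poly_Mapping.lookup (path_monomial \<gamma>) (Y i) = of_bool (i \<in> {1..length \<gamma>} \<and> letter \<gamma> i = ystep)"
proof -
  have X: "step_var a j = X i \<longleftrightarrow> j = i \<and> a = xstep" for a j by (cases a) auto
  have Y: "step_var a j = Y i \<longleftrightarrow> j = i \<and> a = ystep" for a j by (cases a) auto
  have eq: "(\<Sum>j\<in>A. of_bool (j = i \<and> P j)) = (of_bool (i \<in> A \<and> P i) :: nat)" if "finite A" for A P
  proof -
    have "(\<Sum>j\<in>A. of_bool (j = i \<and> P j)) = (\<Sum>j\<in>A. if j = i then of_bool (P i) else (0 :: nat))"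
      by (intro sum.cong) auto
    then show ?thesis using that by simp
  qed
  show "Poly_Mapping.lookup (path_monomial \<gamma>) (X i) = of_bool (i \<in> {1..length \<gamma>} \<and> letter \<gamma> i =
      xstep)"
    using eq[of "{1..length \<gamma>}" "\<lambda>j. letter \<gamma> j = xstep"]
    by (simp add: path_monomial_def lookup_sum lookup_single when_def X of_bool_def del:
        One_nat_def)
  show "Poly_Mapping.lookup (path_monomial \<gamma>) (Y i) = of_bool (i \<in> {1..length \<gamma>} \<and> letter \<gamma> i =
      ystep)"
    using eq[of "{1..length \<gamma>}" "\<lambda>j. letter \<gamma> j = ystep"]
    by (simp add: path_monomial_def lookup_sum lookup_single when_def Y of_bool_def del:
        One_nat_def)
qed

lemma multideg_path_monomial: "multideg (path_monomial \<gamma>) = (\<lambda>i. of_bool (i \<in> {1..length \<gamma>}))"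
proof
  fix i
  show "multideg (path_monomial \<gamma>) i = of_bool (i \<in> {1..length \<gamma>})"
    by (cases "letter \<gamma> i") (simp_all add: multideg_def lookup_path_monomial)
qed

lemma inj_on_path_monomial: "inj_on path_monomial {\<gamma>. length \<gamma> = d}"
proof (rule inj_onI)
  fix \<gamma> \<delta> assume "\<gamma> \<in> {\<gamma>. length \<gamma> = d}" "\<delta> \<in> {\<gamma>. length \<gamma> = d}"
    and eq: "path_monomial \<gamma> = path_monomial \<delta>"
  then have len: "length \<gamma> = d" "length \<delta> = d" by auto
  show "\<gamma> = \<delta>"
  proof (rule nth_equalityI)
    fix i assume "i < length \<gamma>"
    then have "(of_bool (letter \<gamma> (Suc i) = xstep) :: nat) = of_bool (letter \<delta> (Suc i) = xstep)"
      using lookup_path_monomial(1)[of \<gamma> "Suc i"] lookup_path_monomial(1)[of \<delta> "Suc i"] len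
      by (simp add: eq)
    then have "letter \<gamma> (Suc i) = xstep \<longleftrightarrow> letter \<delta> (Suc i) = xstep"
      by (simp only: of_bool_eq_iff)
    then show "\<gamma> ! i = \<delta> ! i"
      by (cases "\<gamma> ! i"; cases "\<delta> ! i") (auto simp: letter_def)
  qed (use len in simp)
qed

text \<open>A monomial of this multi-degree chooses exactly one of x_i and y_i for each
  \<open>i\<close>, which is a path. Together with injectivity, this gives dimension
  \<open>2 ^ d\<close> for the multi-linear component.\<close>

lemma image_path_monomial:
  "path_monomial ` {\<gamma>. length \<gamma> = d} = {m. multideg m = (\<lambda>i. of_bool (i \<in> {1..d}))}"
proof (intro equalityI subsetI)
  fix m assume "m \<in> {m. multideg m = (\<lambda>i. of_bool (i \<in> {1..d}))}"
  then have deg: "Poly_Mapping.lookup m (X i) + Poly_Mapping.lookup m (Y i) = of_bool (i \<in>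
      {1..d})" for i
    by (simp add: multideg_def fun_eq_iff)
  define \<gamma> where "\<gamma> = map (\<lambda>i. if Poly_Mapping.lookup m (X (Suc i)) =
      1 then xstep else ystep) [0..<d]"
  have len: "length \<gamma> = d" by (simp add: \<gamma>_def)
  have letter: "letter \<gamma> i = (if Poly_Mapping.lookup m (X i) = 1 then xstep else ystep)" if "i \<in>
      {1..d}" for i
    using that by (cases i) (auto simp: letter_def \<gamma>_def)
  have "path_monomial \<gamma> = m"
  proof (rule poly_mapping_eqI)
    fix v
    show "Poly_Mapping.lookup (path_monomial \<gamma>) v = Poly_Mapping.lookup m v"
    proof (cases v)
      case (X i)
      then show ?thesis using deg[of i] letter[of i]
        by (cases "i \<in> {1..d}") (auto simp: lookup_path_monomial len split: if_splits)
    next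
      case (Y i)
      then show ?thesis using deg[of i] letter[of i]
        by (cases "i \<in> {1..d}") (auto simp: lookup_path_monomial len split: if_splits)
    qed
  qed
  then show "m \<in> path_monomial ` {\<gamma>. length \<gamma> = d}" using len by blast
qed (auto simp: multideg_path_monomial)

lemma multilinear_eq_keys:
  "multilinear d = {f. Poly_Mapping.keys f \<subseteq> path_monomial ` {\<gamma>. length \<gamma> = d}}"
  unfolding multilinear_eq image_path_monomial multihomogeneous_def by auto

lemma multilinear_eq_span:
  "(multilinear d :: 'a::field mpoly set) =
    fsupp.span ((\<lambda>m. Poly_Mapping.single m 1) ` path_monomial ` {\<gamma>. length \<gamma> = d})"
  unfolding multilinear_eq_keys by (rule keys_subset_eq_span)

lemma card_multilinear_basis:
  "card ((\<lambda>m. Poly_Mapping.single m (1::'a::field)) ` path_monomial ` {\<gamma>. length \<gamma> = d}) = 2 ^ d"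
proof -
  have "inj (\<lambda>m. Poly_Mapping.single m (1::'a))"
    by (rule injI) (metis keys_single singleton_inject zero_neq_one)
  then have inj: "inj_on (\<lambda>m. Poly_Mapping.single m (1::'a)) A" for A by (rule inj_on_subset) simp
  show ?thesis
    by (subst card_image[OF inj], subst card_image[OF inj_on_path_monomial], rule card_paths)
qed

definition matching_product :: "step list \<Rightarrow> 'a::field mpoly"
  where "matching_product \<gamma> = (\<Prod>j\<in>I1 \<gamma>. udet (rho \<gamma> j) j)"

lemma sigma_matching_product [simp]: "sigma (matching_product \<gamma>) = matching_product \<gamma>"
  by (simp add: matching_product_def sigma_prod)

text \<open>Injectivity of \<open>rho\<close> makes every matched index occur in one determinant
  only.\<close>

lemma multihomogeneous_matching_product:
  assumes "partial_dyck \<gamma>"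
  shows "matching_product \<gamma> \<in> multihomogeneous (\<lambda>i. of_bool (i \<in> I1 \<gamma>) + of_bool (i \<in> I2 \<gamma>))"
proof -
  have "(\<Sum>j\<in>I1 \<gamma>. of_bool (i = rho \<gamma> j) + of_bool (i = j)) =
      (of_bool (i \<in> I1 \<gamma>) + of_bool (i \<in> I2 \<gamma>) :: nat)" for i
  proof -
    have "(\<Sum>j\<in>I1 \<gamma>. of_bool (i = rho \<gamma> j)) = (\<Sum>j\<in>I2 \<gamma>. of_bool (i = j) :: nat)"
      unfolding I2_def by (simp add: sum.reindex[OF inj_on_rho[OF assms]])
    then show ?thesis by (simp add: sum.distrib)
  qed
  then show ?thesis
    unfolding matching_product_def
    using multihomogeneous_prod[of "I1 \<gamma>" "\<lambda>j. udet (rho \<gamma> j) j", OF _ multihomogeneous_udet]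
        by simp
qed

text \<open>As \<open>rho \<gamma> j < j\<close>, the determinant of the pair leads with x at the
  earlier and y at the later index, which are the letters of the path there.\<close>

lemma has_lead_matching_product:
  assumes "partial_dyck \<gamma>"
  shows "has_lead (matching_product \<gamma>)
    ((\<Sum>i\<in>I2 \<gamma>. Poly_Mapping.single (X i) 1) + (\<Sum>i\<in>I1 \<gamma>. Poly_Mapping.single (Y i) 1))"
proof -
  have "(\<Sum>i\<in>I2 \<gamma>. Poly_Mapping.single (X i) (1::nat)) =
      (\<Sum>j\<in>I1 \<gamma>. Poly_Mapping.single (X (rho \<gamma> j)) 1)"
    unfolding I2_def by (simp add: sum.reindex[OF inj_on_rho[OF assms]])
  then have "(\<Sum>i\<in>I2 \<gamma>. Poly_Mapping.single (X i) (1::nat)) +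
      (\<Sum>i\<in>I1 \<gamma>. Poly_Mapping.single (Y i) 1) =
      (\<Sum>j\<in>I1 \<gamma>. Poly_Mapping.single (X (rho \<gamma> j)) 1 + Poly_Mapping.single (Y j) 1)"
    by (simp add: sum.distrib)
  then show ?thesis
    unfolding matching_product_def
    by (simp only:) (intro has_lead_prod has_lead_udet rho_less[OF assms] finite_I1)
qed

lemma path_monomial_partial_dyck:
  assumes "partial_dyck \<gamma>"
  shows "path_monomial \<gamma> = (\<Sum>i\<in>I2 \<gamma>. Poly_Mapping.single (X i) 1) +
      (\<Sum>i\<in>I1 \<gamma>. Poly_Mapping.single (Y i) 1) +
    (\<Sum>i\<in>I3 \<gamma>. Poly_Mapping.single (X i) 1)"
proof -
  let ?f = "\<lambda>i. Poly_Mapping.single (step_var (letter \<gamma> i) i) (1::nat)"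
  note I = I_partition[OF assms]
  have "path_monomial \<gamma> = sum ?f (I1 \<gamma> \<union> I2 \<gamma> \<union> I3 \<gamma>)"
    by (simp only: path_monomial_def I(3))
  also have "\<dots> = sum ?f (I1 \<gamma>) + sum ?f (I2 \<gamma>) + sum ?f (I3 \<gamma>)"
    using I(1,2) by (simp add: sum.union_disjoint)
  also have "sum ?f (I1 \<gamma>) = (\<Sum>i\<in>I1 \<gamma>. Poly_Mapping.single (Y i) 1)"
    using I(4) by (intro sum.cong) simp_all
  also have "sum ?f (I2 \<gamma>) = (\<Sum>i\<in>I2 \<gamma>. Poly_Mapping.single (X i) 1)"
    using I(5) by (intro sum.cong) simp_all
  also have "sum ?f (I3 \<gamma>) = (\<Sum>i\<in>I3 \<gamma>. Poly_Mapping.single (X i) 1)"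
    using I(5) by (intro sum.cong) simp_all
  finally show ?thesis by (simp add: ac_simps)
qed

lemma multihomogeneous_prod_xvar:
  assumes "finite A"
  shows "(\<Prod>i\<in>A. xvar i) \<in> multihomogeneous (\<lambda>i. of_bool (i \<in> A))"
proof -
  have "(\<lambda>i. \<Sum>a\<in>A. of_bool (i = a)) = (\<lambda>i. of_bool (i \<in> A) :: nat)"
    using assms by (auto simp: of_bool_def)
  then show ?thesis
    using multihomogeneous_prod[of A xvar, OF assms multihomogeneous_xvar] by simp
qed

lemma sigma_prod_xvar [simp]: "sigma (\<Prod>i\<in>A. xvar i) = (\<Prod>i\<in>A. xvar i)"
  by (simp add: sigma_prod)

text \<open>The power of \<open>D\<close> that carries \<open>theta'\<close> to a nonzero multiple
  of \<open>theta\<close>.\<close>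

definition string_height :: "nat \<Rightarrow> step list \<Rightarrow> nat"
  where "string_height p \<gamma> = (if \<gamma> \<in> PDP (length \<gamma>) (p - 2) then nat (finishing_height \<gamma>) else p -
      1)"

lemma PDP_theta:
  fixes p d
  assumes "prime p" "CHAR('a::field) = p" "\<gamma> \<in> PDP d (p - 2)"
  shows "\<exists>c. c \<noteq> 0 \<and> (sigma.D ^^ string_height p \<gamma>) (theta' p \<gamma> :: 'a mpoly) = scale c (theta p \<gamma>)"
    and "sigma (theta p \<gamma> :: 'a mpoly) = theta p \<gamma>"
    and "has_lead (theta p \<gamma> :: 'a mpoly) (path_monomial \<gamma>)"
    and "(theta' p \<gamma> :: 'a mpoly) \<in> multilinear d"
proof -
  have len: "length \<gamma> = d" and pd: "partial_dyck \<gamma>" using assms(3) by (auto simp: PDP_def)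
  have in_PDP: "\<gamma> \<in> PDP (length \<gamma>) (p - 2)" using assms(3) len by simp
  have th: "(theta p \<gamma> :: 'a mpoly) = matching_product \<gamma> * (\<Prod>i\<in>I3 \<gamma>. xvar i)"
    and th': "(theta' p \<gamma> :: 'a mpoly) = matching_product \<gamma> * (\<Prod>i\<in>I3 \<gamma>. yvar i)"
    using in_PDP by (simp_all add: theta_def theta'_def theta0_def theta0'_def matching_product_def)
  have card: "string_height p \<gamma> = card (I3 \<gamma>)"
    using in_PDP card_I3[OF pd] by (simp add: string_height_def)
  have "card (I3 \<gamma>) \<le> p - 2"
    using PDP_finishing_height[OF in_PDP] card_I3[OF pd] by linarith
  then have "(of_nat (fact (card (I3 \<gamma>))) :: 'a) \<noteq> 0"
    using prime_ge_2_nat[OF assms(1)] by (intro fact_nonzero_char[OF assms(1,2)]) linarith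
  \<comment> \<open>\<open>D\<close> passes through the invariant matching product and acts on the
    \<open>card (I3 \<gamma>)\<close> free factors y_i; the scalar is the factorial of their
    number.\<close>
  then show "\<exists>c. c \<noteq> 0 \<and> (sigma.D ^^ string_height p \<gamma>) (theta' p \<gamma> :: 'a mpoly) =
      scale c (theta p \<gamma>)"
    by (intro exI[of _ "of_nat (fact (card (I3 \<gamma>)))"])
      (simp add: card th th' D_pow_invariant_mult D_pow_prod_yvar_card scale_mult_right)
  show "sigma (theta p \<gamma> :: 'a mpoly) = theta p \<gamma>"
    by (simp add: th sigma_mult)
  show "has_lead (theta p \<gamma> :: 'a mpoly) (path_monomial \<gamma>)"
    unfolding th path_monomial_partial_dyck[OF pd]
    by (intro has_lead_mult has_lead_matching_product[OF pd] has_lead_prod has_lead_Var finite_I3)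
  have "(\<lambda>i. of_bool (i \<in> I1 \<gamma>) + of_bool (i \<in> I2 \<gamma>) + of_bool (i \<in> I3 \<gamma>)) =
      (\<lambda>i. of_bool (i \<in> {1..d}) :: nat)"
    unfolding len[symmetric] I_partition(3)[OF pd, symmetric] using I_partition(1,2)[OF pd]
    by (auto simp: fun_eq_iff)
  then show "(theta' p \<gamma> :: 'a mpoly) \<in> multilinear d"
    using multihomogeneous_mult[OF multihomogeneous_matching_product[OF pd]
        multihomogeneous_prod_yvar[OF finite_I3[of \<gamma>]]]
    by (simp add: th' multilinear_eq)
qed

lemma sigma_pow_one: "(sigma ^^ n) 1 = 1"
  by (induction n) auto

lemma sigma_pow_mult: "(sigma ^^ n) (f * g) = (sigma ^^ n) f * (sigma ^^ n) g"
  by (induction n) (simp_all add: sigma_mult)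

lemma sigma_pow_prod: "(sigma ^^ n) (\<Prod>i\<in>A. f i) = (\<Prod>i\<in>A. (sigma ^^ n) (f i))"
  by (induction A rule: infinite_finite_induct) (auto simp: sigma_pow_mult sigma_pow_one)

lemma sigma_pow_yvar: "(sigma ^^ n) (yvar i) = yvar i + scale (of_nat n) (xvar i)"
  by (induction n) (simp_all add: sigma_add sigma_scale fsupp.scale_left_distrib add.assoc
      add.commute)

text \<open>The p-th power of \<open>sigma\<close> sends y_i to y_i + p x_i = y_i, so it fixes the
  product, and \<open>sigma\<close> permutes the summands of the trace cyclically. On general
  polynomials \<open>Tr\<close> is just a sum over exponents, so this periodicity has to be
  supplied.\<close>

lemma sigma_Tr_prod_yvar:
  assumes "CHAR('a::field) = p"
  shows "sigma (Tr p (\<Prod>i\<in>A. yvar i) :: 'a mpoly) = Tr p (\<Prod>i\<in>A. yvar i)"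
proof -
  let ?f = "\<Prod>i\<in>A. yvar i :: 'a mpoly"
  have "(of_nat p :: 'a) = 0" using assms by (simp add: of_nat_eq_0_iff_char_dvd)
  then have fix_f: "(sigma ^^ p) ?f = ?f" by (simp add: sigma_pow_prod sigma_pow_yvar)
  have "sigma (\<Sum>k<n. (sigma ^^ k) g) = (\<Sum>k<n. (sigma ^^ Suc k) g)" for n and g :: "'a mpoly"
    by (induction n) (simp_all add: sigma_add)
  then have "?f + sigma (Tr p ?f) = (\<Sum>k<Suc p. (sigma ^^ k) ?f)"
    unfolding Tr_def by (subst sum.lessThan_Suc_shift) simp
  also have "\<dots> = Tr p ?f + ?f" by (simp add: Tr_def fix_f)
  finally show ?thesis by (simp add: add.commute)
qed

lemma letter_take: "i \<le> k \<Longrightarrow> 1 \<le> i \<Longrightarrow> letter (take k \<gamma>) i = letter \<gamma> i"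
  by (simp add: letter_def)

lemma finite_I4 [simp]: "finite (I4 p \<gamma>)" and finite_I5 [simp]: "finite (I5 p \<gamma>)"
  by (simp_all add: I4_def I5_def)

lemma initial_part:
  assumes "\<gamma> \<in> IDP d (p - 1)"
  shows "escape p \<gamma> \<le> length \<gamma>" "partial_dyck (initial_part p \<gamma>)"
    "finishing_height (initial_part p \<gamma>) = int (p - 1)"
proof -
  have "\<exists>s. s \<le> length \<gamma> \<and> partial_dyck (take s \<gamma>) \<and> finishing_height (take s \<gamma>) = int (p - 1)"
    using assms by (auto simp: IDP_iff)
  from LeastI_ex[OF this]
  show "escape p \<gamma> \<le> length \<gamma>" "partial_dyck (initial_part p \<gamma>)"
    "finishing_height (initial_part p \<gamma>) = int (p - 1)"
    by (simp_all add: escape_def)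
qed

lemma IDP_not_PDP:
  assumes "prime p" "\<gamma> \<in> IDP d (p - 1)"
  shows "\<gamma> \<notin> PDP d' (p - 2)"
proof
  assume PDP: "\<gamma> \<in> PDP d' (p - 2)"
  moreover have "p - 2 < p - 1" using prime_ge_2_nat[OF assms(1)] by linarith
  ultimately have "\<gamma> \<notin> IDP d' (p - 1)" by (rule PDP_IDP_disjoint)
  moreover have "d' = d" using assms(2) PDP by (simp add: IDP_def PDP_def)
  ultimately show False using assms(2) by simp
qed

lemma IDP_theta:
  assumes "prime p" "CHAR('a::field) = p" "\<gamma> \<in> IDP d (p - 1)"
  shows "(sigma.D ^^ string_height p \<gamma>) (theta' p \<gamma> :: 'a mpoly) = theta p \<gamma>"
    and "sigma (theta p \<gamma> :: 'a mpoly) = theta p \<gamma>"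
    and "has_lead (theta p \<gamma> :: 'a mpoly) (path_monomial \<gamma>)"
    and "(theta' p \<gamma> :: 'a mpoly) \<in> multilinear d"
proof -
  have p: "p \<ge> 2" using assms(1) by (rule prime_ge_2_nat)
  have len: "length \<gamma> = d" using assms(3) by (simp add: IDP_iff)
  have not_PDP: "\<gamma> \<notin> PDP (length \<gamma>) (p - 2)"
    by (rule IDP_not_PDP[OF assms(1,3)])
  define s where "s = escape p \<gamma>"
  have s: "s \<le> length \<gamma>" and pd: "partial_dyck (take s \<gamma>)" and fh: "finishing_height (take s \<gamma>) =
      int (p - 1)"
    unfolding s_def by (rule initial_part[OF assms(3)])+
  let ?\<gamma>' = "take s \<gamma>"
  have len': "length ?\<gamma>' = s" using s by simp
  let ?U = "matching_product ?\<gamma>' :: 'a mpoly" and ?A = "I3 ?\<gamma>'" and ?B = "I5 p \<gamma>"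
  let ?y = "\<Prod>i\<in>?A \<union> ?B. yvar i :: 'a mpoly" and ?x = "\<Prod>i\<in>I4 p \<gamma>. xvar i :: 'a mpoly"
  have th: "theta p \<gamma> = Tr p ?y * ?U * ?x" and th': "theta' p \<gamma> = ?U * ?y * ?x"
    using not_PDP by (simp_all add: theta_def theta'_def Let_def matching_product_def s_def)
  have height: "string_height p \<gamma> = p - 1" using not_PDP by (simp add: string_height_def)
  have Tr: "Tr p ?y = (sigma.D ^^ (p - 1)) ?y" by (rule Tr_eq_D_pow[OF assms(1,2)])
  \<comment> \<open>The matching product and the x_i are invariant, so all of
    \<open>D ^^ (p - 1)\<close> acts on the y_i, where it is the trace; no scalar appears.\<close>
  have "theta' p \<gamma> = (?U * ?x) * ?y" by (simp add: th' mult.assoc mult.commute mult.left_commute)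
  then have "(sigma.D ^^ (p - 1)) (theta' p \<gamma>) = (?U * ?x) * (sigma.D ^^ (p - 1)) ?y"
    using D_pow_invariant_mult[of "?U * ?x" "p - 1" ?y] by (simp add: sigma_mult)
  then show "(sigma.D ^^ string_height p \<gamma>) (theta' p \<gamma> :: 'a mpoly) = theta p \<gamma>"
    by (simp add: height th Tr mult.assoc mult.commute mult.left_commute)
  show "sigma (theta p \<gamma> :: 'a mpoly) = theta p \<gamma>"
    by (simp add: th sigma_mult sigma_Tr_prod_yvar[OF assms(2)])
  have card: "card ?A = p - 1" using card_I3[OF pd] fh by simp
  \<comment> \<open>\<open>?A\<close> lies in the initial part and \<open>?B\<close> after the
    escape, which is the order required by the lemma on lead monomials.\<close>
  have AB: "a < b" if "a \<in> ?A" "b \<in> ?B" for a b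
    using that len' by (auto simp: I3_def I5_def s_def)
  have "(of_nat (fact (card ?A)) :: 'a) \<noteq> 0"
    using p card by (intro fact_nonzero_char[OF assms(1,2)]) simp
  from has_lead_D_pow_prod_yvar[OF finite_I3 this finite_I5 AB]
  have lead_Tr: "has_lead (Tr p ?y) ((\<Sum>i\<in>?A. Poly_Mapping.single (X i) 1) +
      (\<Sum>i\<in>?B. Poly_Mapping.single (Y i) 1))"
    by (simp add: Tr card)
  have parts: "{1..length \<gamma>} = {1..s} \<union> (I4 p \<gamma> \<union> ?B)"
    using s by (auto simp: I4_def I5_def s_def not_ystep_iff)
  have "{1..s} \<inter> (I4 p \<gamma> \<union> ?B) = {}" "I4 p \<gamma> \<inter> ?B = {}"
    by (auto simp: I4_def I5_def s_def)
  note disj = this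
  let ?f = "\<lambda>i. Poly_Mapping.single (step_var (letter \<gamma> i) i) (1::nat)"
  have "path_monomial \<gamma> = sum ?f {1..s} + (sum ?f (I4 p \<gamma>) + sum ?f ?B)"
    unfolding path_monomial_def parts using disj by (simp add: sum.union_disjoint)
  also have "sum ?f {1..s} = path_monomial ?\<gamma>'"
    unfolding path_monomial_def len' by (intro sum.cong) (simp_all add: letter_take)
  also have "sum ?f (I4 p \<gamma>) = (\<Sum>i\<in>I4 p \<gamma>. Poly_Mapping.single (X i) 1)"
    by (intro sum.cong) (simp_all add: I4_def)
  also have "sum ?f ?B = (\<Sum>i\<in>?B. Poly_Mapping.single (Y i) 1)"
    by (intro sum.cong) (simp_all add: I5_def)
  finally have mono: "path_monomial \<gamma> =
      ((\<Sum>i\<in>?A. Poly_Mapping.single (X i) 1) + (\<Sum>i\<in>?B. Poly_Mapping.single (Y i) 1)) +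
      ((\<Sum>i\<in>I2 ?\<gamma>'. Poly_Mapping.single (X i) 1) + (\<Sum>i\<in>I1 ?\<gamma>'. Poly_Mapping.single (Y i) 1)) +
      (\<Sum>i\<in>I4 p \<gamma>. Poly_Mapping.single (X i) 1)"
    by (simp add: path_monomial_partial_dyck[OF pd] ac_simps)
  show "has_lead (theta p \<gamma> :: 'a mpoly) (path_monomial \<gamma>)"
    unfolding th mono
    by (intro has_lead_mult lead_Tr has_lead_matching_product[OF pd] has_lead_prod has_lead_Var
        finite_I4)
  have "(\<lambda>i. of_bool (i \<in> I1 ?\<gamma>') + of_bool (i \<in> I2 ?\<gamma>') + of_bool (i \<in> ?A \<union> ?B) + of_bool (i \<in>
      I4 p \<gamma>)) =
      (\<lambda>i. of_bool (i \<in> {1..d}) :: nat)"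
  proof
    fix i
    have "{1..s} = I1 ?\<gamma>' \<union> I2 ?\<gamma>' \<union> ?A"
      using I_partition(3)[OF pd] len' by simp
    then have "i \<in> {1..s} \<longleftrightarrow> i \<in> I1 ?\<gamma>' \<or> i \<in> I2 ?\<gamma>' \<or> i \<in> ?A"
      by blast
    moreover have "i \<in> {1..d} \<longleftrightarrow> i \<in> {1..s} \<or> i \<in> I4 p \<gamma> \<or> i \<in> ?B"
      unfolding len[symmetric] parts by blast
    moreover have "\<not> (i \<in> I1 ?\<gamma>' \<and> i \<in> I2 ?\<gamma>')" "\<not> ((i \<in> I1 ?\<gamma>' \<or> i \<in> I2 ?\<gamma>') \<and> i \<in> ?A)"
      "\<not> (i \<in> I4 p \<gamma> \<and> i \<in> ?B)" "\<not> (i \<in> {1..s} \<and> (i \<in> I4 p \<gamma> \<or> i \<in> ?B))"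
      using I_partition(1,2)[OF pd] disj by blast+
    ultimately show "of_bool (i \<in> I1 ?\<gamma>') + of_bool (i \<in> I2 ?\<gamma>') + of_bool (i \<in> ?A \<union> ?B) +
        of_bool (i \<in> I4 p \<gamma>) =
      (of_bool (i \<in> {1..d}) :: nat)"
      by (cases "i \<in> I1 ?\<gamma>'"; cases "i \<in> I2 ?\<gamma>'"; cases "i \<in> ?A"; cases "i \<in> ?B"; cases "i \<in>
          I4 p \<gamma>")
        simp_all
  qed
  then show "(theta' p \<gamma> :: 'a mpoly) \<in> multilinear d"
    using multihomogeneous_mult[OF multihomogeneous_mult[OF multihomogeneous_matching_product[OF pd]
        multihomogeneous_prod_yvar[of "?A \<union> ?B"]] multihomogeneous_prod_xvar[of "I4 p \<gamma>"]]
    by (simp add: th' multilinear_eq del: Un_iff)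
qed

section \<open>The tensor power\<close>

lemma linear_ext_cong:
  "(\<And>k. k \<in> Poly_Mapping.keys v \<Longrightarrow> b k = b' k) \<Longrightarrow> linear_ext b v = linear_ext b' v"
  by (simp add: linear_ext_def)

lemma linear_ext_linear_ext:
  "linear_ext b (linear_ext b' v) = linear_ext (\<lambda>k. linear_ext b (b' k)) v"
proof -
  interpret L: Vector_Spaces.linear scale scale "linear_ext b" by (rule linear_linear_ext)
  show ?thesis by (simp add: linear_ext_def[of b'] linear_ext_def[of
      "\<lambda>k. linear_ext b (b' k)"] L.sum L.scale)
qed

lemma linear_ext_mult_left:
  "linear_ext (\<lambda>k. c * b k) v = c * linear_ext b v" and
  linear_ext_mult_right: "linear_ext (\<lambda>k. b k * c) v = linear_ext b v * c"
  for c :: "'c::comm_monoid_add \<Rightarrow>\<^sub>0 'a::field"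
  by (simp_all add: linear_ext_def sum_distrib_left sum_distrib_right scale_mult_left
      scale_mult_right)

lemma linear_ext_singles: "linear_ext (\<lambda>k. Poly_Mapping.single k 1) v = v"
  unfolding linear_ext_def by (rule poly_mapping_eq_sum_singles[symmetric])

lemma keys_linear_ext_subset:
  assumes "\<And>k. k \<in> Poly_Mapping.keys v \<Longrightarrow> Poly_Mapping.keys (b k) \<subseteq> K"
  shows "Poly_Mapping.keys (linear_ext b v :: 'c \<Rightarrow>\<^sub>0 'a::field) \<subseteq> K"
proof -
  have "linear_ext b v \<in> {f :: 'c \<Rightarrow>\<^sub>0 'a. Poly_Mapping.keys f \<subseteq> K}"
    unfolding linear_ext_def keys_subset_eq_span
    by (intro fsupp.span_sum fsupp.span_scale, fold keys_subset_eq_span) (use assms in simp)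
  then show ?thesis by simp
qed

lemma bij_betw_linear_ext_single:
  assumes "inj_on e W"
  shows "bij_betw (linear_ext (\<lambda>w. Poly_Mapping.single (e w) (1::'a::field)))
    {v. Poly_Mapping.keys v \<subseteq> W} {f. Poly_Mapping.keys f \<subseteq> e ` W}"
proof (rule bij_betw_byWitness[where f' = "linear_ext (\<lambda>m. Poly_Mapping.single (inv_into W e m)
    1)"])
  show "\<forall>v\<in>{v. Poly_Mapping.keys v \<subseteq> W}. linear_ext (\<lambda>m. Poly_Mapping.single (inv_into W e m) 1)
      (linear_ext (\<lambda>w. Poly_Mapping.single (e w) (1::'a)) v) = v"
  proof
    fix v :: "'b \<Rightarrow>\<^sub>0 'a" assume "v \<in> {v. Poly_Mapping.keys v \<subseteq> W}"
    then have "linear_ext (\<lambda>w. Poly_Mapping.single (inv_into W e (e w)) (1::'a)) v =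
        linear_ext (\<lambda>w. Poly_Mapping.single w 1) v"
      using assms by (intro linear_ext_cong) (auto simp: inv_into_f_f)
    then show "linear_ext (\<lambda>m. Poly_Mapping.single (inv_into W e m) 1)
      (linear_ext (\<lambda>w. Poly_Mapping.single (e w) (1::'a)) v) = v"
      by (simp add: linear_ext_linear_ext linear_ext_singles)
  qed
  show "\<forall>f\<in>{f. Poly_Mapping.keys f \<subseteq> e ` W}. linear_ext (\<lambda>w. Poly_Mapping.single (e w) 1)
      (linear_ext (\<lambda>m. Poly_Mapping.single (inv_into W e m) (1::'a)) f) = f"
  proof
    fix f :: "'c \<Rightarrow>\<^sub>0 'a" assume "f \<in> {f. Poly_Mapping.keys f \<subseteq> e ` W}"
    then have "linear_ext (\<lambda>m. Poly_Mapping.single (e (inv_into W e m)) (1::'a)) f =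
        linear_ext (\<lambda>m. Poly_Mapping.single m 1) f"
      by (intro linear_ext_cong) (auto simp: f_inv_into_f)
    then show "linear_ext (\<lambda>w. Poly_Mapping.single (e w) 1)
      (linear_ext (\<lambda>m. Poly_Mapping.single (inv_into W e m) (1::'a)) f) = f"
      by (simp add: linear_ext_linear_ext linear_ext_singles)
  qed
  show "linear_ext (\<lambda>w. Poly_Mapping.single (e w) (1::'a)) ` {v. Poly_Mapping.keys v \<subseteq> W} \<subseteq>
      {f. Poly_Mapping.keys f \<subseteq> e ` W}"
  proof (intro image_subsetI CollectI keys_linear_ext_subset)
    fix v :: "'b \<Rightarrow>\<^sub>0 'a" and k assume "v \<in> {v. Poly_Mapping.keys v \<subseteq> W}" "k \<in> Poly_Mapping.keys v"
    then show "Poly_Mapping.keys (Poly_Mapping.single (e k) (1::'a)) \<subseteq> e ` W" by auto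
  qed
  show "linear_ext (\<lambda>m. Poly_Mapping.single (inv_into W e m) (1::'a)) ` {f. Poly_Mapping.keys f \<subseteq>
      e ` W} \<subseteq> {v. Poly_Mapping.keys v \<subseteq> W}"
  proof (intro image_subsetI CollectI keys_linear_ext_subset)
    fix f :: "'c \<Rightarrow>\<^sub>0 'a" and k assume "f \<in> {f. Poly_Mapping.keys f \<subseteq> e ` W}" "k \<in>
        Poly_Mapping.keys f"
    then have "inv_into W e k \<in> W" by (intro inv_into_into) auto
    then show "Poly_Mapping.keys (Poly_Mapping.single (inv_into W e k) (1::'a)) \<subseteq> W" by simp
  qed
qed

text \<open>The letter 0 stands for x because the Jordan block fixes its basis vector 0 and adds
  that vector to basis vector 1, just as \<open>sigma\<close> fixes x_i and adds it to y_i.\<close>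

definition to_step :: "nat \<Rightarrow> step"
  where "to_step a = (if a = 0 then xstep else ystep)"

text \<open>The polynomial of a word whose first letter sits at position \<open>n\<close>.\<close>

fun word_poly :: "nat \<Rightarrow> nat list \<Rightarrow> 'a::field mpoly"
  where
    "word_poly n [] = 1"
  | "word_poly n (a # w) = Var (step_var (to_step a) n) * word_poly (Suc n) w"

lemma word_poly_eq:
  "word_poly (Suc n) w = (\<Prod>i\<in>{1..length w}. Var (step_var (letter (map to_step w) i) (n + i)))"
proof (induction w arbitrary: n)
  case (Cons a w)
  let ?g = "\<lambda>i. Var (step_var (letter (map to_step (a # w)) i) (n + i)) :: 'a mpoly"
  have "(\<Prod>i\<in>{1..Suc (length w)}. ?g i) = ?g 1 * (\<Prod>i\<in>{Suc 1..Suc (length w)}. ?g i)"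
    by (rule prod.atLeast_Suc_atMost) simp
  also have "(\<Prod>i\<in>{Suc 1..Suc (length w)}. ?g i) = (\<Prod>i\<in>{1..length w}. ?g (Suc i))"
    by (rule prod.shift_bounds_cl_Suc_ivl)
  also have "\<dots> = word_poly (Suc (Suc n)) w"
    unfolding Cons.IH by (intro prod.cong refl) (auto simp: letter_def nth_Cons')
  finally show ?case by (simp add: letter_def)
qed simp

lemma word_poly_eq_Lambda: "word_poly 1 w = Lambda (map to_step w)"
  using word_poly_eq[of 0 w] by (simp add: Lambda_def)

text \<open>Both actions are diagonal: \<open>word_poly\<close> turns tensor factors into factors of
  a product and \<open>sigma\<close> is multiplicative, so the claim reduces to one letter, where
  the Jordan block is compared with \<open>sigma\<close> on x and y.\<close>

lemma linear_ext_word_poly_pure_tensor: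
  assumes "set w \<subseteq> {0, 1}"
  shows "linear_ext (word_poly n) (pure_tensor (map jordan_basis w)) =
      sigma (word_poly n w :: 'a::field mpoly)"
  using assms
proof (induction w arbitrary: n)
  case (Cons a w)
  let ?T = "pure_tensor (map jordan_basis w) :: nat list \<Rightarrow>\<^sub>0 'a"
  have "linear_ext (word_poly n) (pure_tensor (map jordan_basis (a # w))) =
      linear_ext (\<lambda>i. Var (step_var (to_step i) n) * linear_ext (word_poly (Suc n)) ?T)
          (jordan_basis a)"
    by (simp add: linear_ext_linear_ext linear_ext_mult_left)
  also have "\<dots> = linear_ext (\<lambda>i. Var (step_var (to_step i) n)) (jordan_basis a) * sigma (word_poly
      (Suc n) w)"
    using Cons by (simp add: linear_ext_mult_right)
  also have "linear_ext (\<lambda>i. Var (step_var (to_step i) n)) (jordan_basis a) =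
      sigma (Var (step_var (to_step a) n) :: 'a mpoly)"
    using Cons.prems linear_ext_single[of "\<lambda>i. Var (step_var (to_step i) n) :: 'a mpoly" 0 1]
    by (auto simp: jordan_basis_def to_step_def linear_ext_add)
  finally show ?case by (simp add: sigma_mult)
qed simp

lemma isomorphic_tensor_power_multilinear:
  "isomorphic tensor_action (tensor_power d :: (nat list \<Rightarrow>\<^sub>0 'a::field) set) sigma (multilinear d)"
proof -
  define W :: "nat list set" where "W = {w. length w = d \<and> set w \<subseteq> {0, 1}}"
  define \<phi> where "\<phi> = (linear_ext (word_poly 1) :: (nat list \<Rightarrow>\<^sub>0 'a) \<Rightarrow> 'a mpoly)"
  have W: "tensor_power d = {v :: nat list \<Rightarrow>\<^sub>0 'a. Poly_Mapping.keys v \<subseteq> W}"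
    by (auto simp: tensor_power_def W_def)
  have "inj_on to_step {0, 1}" by (simp add: to_step_def)
  then have "inj_on (map to_step) W"
    unfolding W_def by (intro inj_on_mapI, elim inj_on_subset) auto
  moreover have im: "map to_step ` W = {\<gamma>. length \<gamma> = d}"
  proof (intro equalityI subsetI)
    fix \<gamma> assume "\<gamma> \<in> {\<gamma> :: step list. length \<gamma> = d}"
    moreover have "to_step (if a = xstep then 0 else 1) = a" for a
      by (cases a) (simp_all add: to_step_def)
    ultimately show "\<gamma> \<in> map to_step ` W"
      by (intro image_eqI[of _ _ "map (\<lambda>a. if a = xstep then 0 else 1) \<gamma>"])
        (auto simp: W_def o_def)
  qed (auto simp: W_def)
  ultimately have "inj_on (path_monomial \<circ> map to_step) W"
    using inj_on_path_monomial[of d] by (intro comp_inj_on) simp_all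
  from bij_betw_linear_ext_single[OF this]
  have "bij_betw (linear_ext (\<lambda>w. Poly_Mapping.single (path_monomial (map to_step w)) (1::'a)))
      {v. Poly_Mapping.keys v \<subseteq> W} {f. Poly_Mapping.keys f \<subseteq> path_monomial ` {\<gamma>. length \<gamma> = d}}"
    by (simp only: comp_apply image_comp[symmetric] im)
  moreover have "\<phi> = linear_ext (\<lambda>w. Poly_Mapping.single (path_monomial (map to_step w)) (1::'a))"
    unfolding \<phi>_def by (rule arg_cong[of _ _ linear_ext])
        (simp only: fun_eq_iff word_poly_eq_Lambda Lambda_eq simp_thms)
  ultimately have bij: "bij_betw \<phi> (tensor_power d) (multilinear d)"
    by (simp add: W multilinear_eq_keys)
  interpret S: Vector_Spaces.linear scale scale sigma by (rule sigma.linear_s)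
  have equiv: "\<phi> (tensor_action v) = sigma (\<phi> v)" if "v \<in> tensor_power d" for v
  proof -
    have "\<phi> (tensor_action v) = linear_ext (\<lambda>w. sigma (word_poly 1 w)) v"
      unfolding \<phi>_def tensor_action_def linear_ext_linear_ext
      using that by (intro linear_ext_cong linear_ext_word_poly_pure_tensor) (auto simp: W W_def)
    also have "\<dots> = sigma (\<phi> v)"
      by (simp add: \<phi>_def linear_ext_def S.sum S.scale)
    finally show ?thesis .
  qed
  show ?thesis
    unfolding isomorphic_def
    by (intro exI[of _ \<phi>] conjI ballI allI bij equiv)
        (simp_all add: \<phi>_def linear_ext_add linear_ext_scale)
qed

section \<open>Products of lead monomials\<close>

definition LM_products :: "'a::field mpoly set \<Rightarrow> 'a mpoly set"
  where "LM_products B = {q. \<exists>G e. finite G \<and> G \<subseteq> B - {0} \<and> q = (\<Prod>g\<in>G. LM g ^ e g)}"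

lemma LM_products_one: "1 \<in> LM_products B"
  unfolding LM_products_def by (auto intro!: exI[of _ "{}"])

lemma LM_products_base: "g \<in> B \<Longrightarrow> g \<noteq> 0 \<Longrightarrow> LM g \<in> LM_products B"
  unfolding LM_products_def by (auto intro!: exI[of _ "{g}"] exI[of _ "\<lambda>_. 1 :: nat"])

lemma LM_products_mult:
  assumes "q \<in> LM_products B" "r \<in> LM_products B"
  shows "q * r \<in> LM_products B"
proof -
  obtain G e where G: "finite G" "G \<subseteq> B - {0}" "q = (\<Prod>g\<in>G. LM g ^ e g)"
    using assms(1) unfolding LM_products_def by blast
  obtain H f where H: "finite H" "H \<subseteq> B - {0}" "r = (\<Prod>g\<in>H. LM g ^ f g)"
    using assms(2) unfolding LM_products_def by blast
  \<comment> \<open>The two index sets may overlap, so both products are extended by exponent 0 to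
    the union before exponents are added.\<close>
  have "q = (\<Prod>g\<in>G \<union> H. LM g ^ (if g \<in> G then e g else 0))"
    unfolding G(3) using G(1) H(1) by (intro prod.mono_neutral_cong_left) auto
  moreover have "r = (\<Prod>g\<in>G \<union> H. LM g ^ (if g \<in> H then f g else 0))"
    unfolding H(3) using G(1) H(1) by (intro prod.mono_neutral_cong_left) auto
  ultimately have "q * r = (\<Prod>g\<in>G \<union> H. LM g ^ ((if g \<in> G then e g else 0) + (if g \<in>
      H then f g else 0)))"
    by (simp only: prod.distrib power_add)
  moreover have "finite (G \<union> H)" "G \<union> H \<subseteq> B - {0}" using G H by auto
  ultimately show ?thesis
    unfolding LM_products_def by (intro CollectI exI[of _ "G \<union> H"] exI conjI)
qed

lemma ex_has_lead:
  assumes "f \<noteq> 0"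
  shows "\<exists>m. has_lead (f :: 'a::field mpoly) m"
proof -
  have "\<exists>m\<in>Poly_Mapping.keys f. has_lead (\<Sum>m\<in>Poly_Mapping.keys f.
      scale (Poly_Mapping.lookup f m) (Poly_Mapping.single m 1)) m"
    by (rule has_lead_sum) (use assms in \<open>auto simp flip: poly_mapping_eq_sum_singles\<close>)
  then show ?thesis by (auto simp flip: poly_mapping_eq_sum_singles)
qed

text \<open>Nonzeroness is part of the notion: it guarantees lead monomials, hence multiplicativity
  of \<open>LM\<close>, and only nonzero elements of \<open>B\<close> may be used.\<close>

definition lead_generated :: "'a::field mpoly set \<Rightarrow> 'a mpoly \<Rightarrow> bool"
  where "lead_generated B f \<longleftrightarrow> f \<noteq> 0 \<and> LM f \<in> LM_products B"

lemma lead_generated_base: "f \<in> B \<Longrightarrow> f \<noteq> 0 \<Longrightarrow> lead_generated B f"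
  by (simp add: lead_generated_def LM_products_base)

lemma lead_generated_mult:
  assumes "lead_generated B f" "lead_generated B g"
  shows "lead_generated B (f * g)"
proof -
  obtain m n where mn: "has_lead f m" "has_lead g n"
    using assms ex_has_lead unfolding lead_generated_def by blast
  note fg = has_lead_mult[OF this]
  have "LM (f * g) = LM f * LM g"
    by (simp add: LM_eq[OF fg] LM_eq[OF mn(1)] LM_eq[OF mn(2)] mult_single)
  then show ?thesis
    using assms LM_products_mult has_lead_nonzero[OF fg] by (auto simp: lead_generated_def)
qed

lemma lead_generated_one: "lead_generated B 1"
  using LM_products_one[of B] by (simp add: lead_generated_def LM_eq[OF has_lead_one])

lemma lead_generated_prod:
  "(\<And>i. i \<in> A \<Longrightarrow> lead_generated B (f i)) \<Longrightarrow> lead_generated B (\<Prod>i\<in>A. f i)"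
  by (induction A rule: infinite_finite_induct) (auto simp: lead_generated_one lead_generated_mult)

lemma lead_generated_xvar:
  assumes "i \<in> {1..d}"
  shows "lead_generated (basis_B p d) (xvar i)"
proof (rule lead_generated_base)
  show "xvar i \<in> basis_B p d" using assms by (auto simp: basis_B_def)
  show "xvar i \<noteq> 0" by (rule has_lead_nonzero[OF has_lead_Var])
qed

lemma lead_generated_matching_product:
  assumes "partial_dyck \<gamma>" "length \<gamma> \<le> d"
  shows "lead_generated (basis_B p d) (matching_product \<gamma>)"
  unfolding matching_product_def
proof (intro lead_generated_prod lead_generated_base)
  fix j assume j: "j \<in> I1 \<gamma>"
  have "rho \<gamma> j \<in> I2 \<gamma>" using j by (simp add: I2_def)
  then have "1 \<le> rho \<gamma> j" using I2_subset[OF assms(1)] by auto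
  moreover have "j \<le> d" using j assms(2) by (simp add: I1_def)
  moreover note rho_less[OF assms(1) j]
  ultimately show "udet (rho \<gamma> j) j \<in> basis_B p d" unfolding basis_B_def by blast
  show "udet (rho \<gamma> j) j \<noteq> 0"
    by (rule has_lead_nonzero[OF has_lead_udet]) (rule rho_less[OF assms(1) j])
qed

lemma Tr_in_basis_B:
  assumes "A \<subseteq> {1..d}"
  shows "Tr p (\<Prod>i\<in>A. yvar i :: 'a::field mpoly) \<in> basis_B p d"
proof -
  have "(\<Prod>i\<in>A. yvar i :: 'a mpoly) = (\<Prod>i\<in>{1..d}. yvar i ^ of_bool (i \<in> A))"
    using assms by (intro prod.mono_neutral_cong_left) auto
  then have "Tr p (\<Prod>i\<in>A. yvar i :: 'a mpoly) = Tr p (\<Prod>i\<in>{1..d}. yvar i ^ of_bool (i \<in> A))"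
    by (rule arg_cong)
  moreover have "\<forall>i\<in>{1..d}. of_bool (i \<in> A) \<le> (1 :: nat)" by simp
  ultimately show ?thesis
    unfolding basis_B_def by (intro UnI2 CollectI exI[of _ "\<lambda>i. of_bool (i \<in> A)"] conjI)
qed

lemma lead_generated_theta:
  assumes "prime p" "CHAR('a::field) = p" "\<gamma> \<in> PDP d (p - 2) \<union> IDP d (p - 1)"
  shows "lead_generated (basis_B p d) (theta p \<gamma> :: 'a mpoly)"
proof (cases "\<gamma> \<in> PDP d (p - 2)")
  case True
  then have len: "length \<gamma> = d" and pd: "partial_dyck \<gamma>" by (auto simp: PDP_def)
  have "(theta p \<gamma> :: 'a mpoly) = matching_product \<gamma> * (\<Prod>i\<in>I3 \<gamma>. xvar i)"
    using True len by (simp add: theta_def theta0_def matching_product_def)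
  moreover have "lead_generated (basis_B p d) (\<Prod>i\<in>I3 \<gamma>. xvar i :: 'a mpoly)"
    using len by (intro lead_generated_prod lead_generated_xvar) (auto simp: I3_def)
  moreover have "lead_generated (basis_B p d) (matching_product \<gamma> :: 'a mpoly)"
    using len by (intro lead_generated_matching_product[OF pd]) simp
  ultimately show ?thesis by (simp only: lead_generated_mult)
next
  case False
  then have IDP: "\<gamma> \<in> IDP d (p - 1)" using assms(3) by simp
  have len: "length \<gamma> = d" using IDP by (simp add: IDP_def)
  note s = initial_part[OF IDP]
  let ?\<gamma>' = "initial_part p \<gamma>"
  have len': "length ?\<gamma>' \<le> d" using s(1) len by simp
  let ?y = "\<Prod>i\<in>I3 ?\<gamma>' \<union> I5 p \<gamma>. yvar i :: 'a mpoly"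
  have th: "(theta p \<gamma> :: 'a mpoly) = Tr p ?y * matching_product ?\<gamma>' * (\<Prod>i\<in>I4 p \<gamma>. xvar i)"
    using False len by (simp add: theta_def Let_def matching_product_def)
  \<comment> \<open>A trace of a product of y_i can be zero and is then not admissible in
    \<open>B\<close>; here it is a factor of the nonzero \<open>theta\<close>.\<close>
  have "(theta p \<gamma> :: 'a mpoly) \<noteq> 0"
    by (rule has_lead_nonzero[OF IDP_theta(3)[OF assms(1,2) IDP]])
  then have "Tr p ?y \<noteq> 0" by (auto simp: th)
  moreover have "I3 ?\<gamma>' \<union> I5 p \<gamma> \<subseteq> {1..d}"
    using len' len by (auto simp: I3_def I5_def)
  ultimately have "lead_generated (basis_B p d) (Tr p ?y)"
    by (intro lead_generated_base Tr_in_basis_B)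
  moreover have "lead_generated (basis_B p d) (\<Prod>i\<in>I4 p \<gamma>. xvar i :: 'a mpoly)"
    using len by (intro lead_generated_prod lead_generated_xvar) (auto simp: I4_def)
  ultimately show ?thesis
    unfolding th by (intro lead_generated_mult lead_generated_matching_product[OF s(2) len'])
qed

section \<open>The strings of all paths together\<close>

lemma sum_string_height:
  assumes "prime p"
  shows "(\<Sum>\<gamma>\<in>PDP d (p - 2) \<union> IDP d (p - 1). string_height p \<gamma> + 1) = 2 ^ d"
proof -
  have p: "Suc (p - 2) = p - 1" "p - 2 + 2 = p" "p - 1 + 1 = p"
    using prime_ge_2_nat[OF assms] by linarith+
  have "(\<Sum>\<gamma>\<in>PDP d (p - 2) \<union> IDP d (p - 1). string_height p \<gamma> + 1) = (\<Sum>\<gamma> | length \<gamma> =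
      d. weight (p - 2) \<gamma>)"
  proof (rule sum.mono_neutral_cong_left)
    show "finite {\<gamma> :: step list. length \<gamma> = d}" by (rule finite_paths)
    show "PDP d (p - 2) \<union> IDP d (p - 1) \<subseteq> {\<gamma>. length \<gamma> = d}"
      by (auto simp: PDP_def IDP_def)
    show "\<forall>\<gamma>\<in>{\<gamma>. length \<gamma> = d} - (PDP d (p - 2) \<union> IDP d (p - 1)). weight (p - 2) \<gamma> = 0"
      by (auto simp: weight_def p)
    fix \<gamma> assume \<gamma>: "\<gamma> \<in> PDP d (p - 2) \<union> IDP d (p - 1)"
    then have "length \<gamma> = d" by (auto simp: PDP_def IDP_def)
    with \<gamma> show "string_height p \<gamma> + 1 = weight (p - 2) \<gamma>"
      unfolding weight_def string_height_def p by (auto simp: p(3)[simplified])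
  qed
  then show ?thesis by (simp add: sum_weight)
qed

lemma theta_string:
  assumes "prime p" "CHAR('a::field) = p" "\<gamma> \<in> PDP d (p - 2) \<union> IDP d (p - 1)"
  shows "\<exists>c. c \<noteq> 0 \<and> (sigma.D ^^ string_height p \<gamma>) (theta' p \<gamma> :: 'a mpoly) = scale c (theta p \<gamma>)"
    and "sigma (theta p \<gamma> :: 'a mpoly) = theta p \<gamma>"
    and "has_lead (theta p \<gamma> :: 'a mpoly) (path_monomial \<gamma>)"
    and "(theta' p \<gamma> :: 'a mpoly) \<in> multilinear d"
proof -
  consider "\<gamma> \<in> PDP d (p - 2)" | "\<gamma> \<in> IDP d (p - 1)" using assms(3) by blast
  note cases = this
  from cases show "\<exists>c. c \<noteq> 0 \<and> (sigma.D ^^ string_height p \<gamma>) (theta' p \<gamma> :: 'a mpoly) =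
      scale c (theta p \<gamma>)"
    by cases (rule PDP_theta(1)[OF assms(1,2)], assumption,
      rule exI[of _ 1], simp add: IDP_theta(1)[OF assms(1,2)])
  from cases show "sigma (theta p \<gamma> :: 'a mpoly) = theta p \<gamma>"
    by cases (rule PDP_theta(2)[OF assms(1,2)] IDP_theta(2)[OF assms(1,2)]; assumption)+
  from cases show "has_lead (theta p \<gamma> :: 'a mpoly) (path_monomial \<gamma>)"
    by cases (rule PDP_theta(3)[OF assms(1,2)] IDP_theta(3)[OF assms(1,2)]; assumption)+
  from cases show "(theta' p \<gamma> :: 'a mpoly) \<in> multilinear d"
    by cases (rule PDP_theta(4)[OF assms(1,2)] IDP_theta(4)[OF assms(1,2)]; assumption)+
qed

theorem theorem5p5:
  fixes p d :: nat
  assumes "prime p" and "CHAR('a::field) = p"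
  shows
    "(\<forall>\<gamma> \<in> PDP d (p - 2) \<union> IDP d (p - 1).
        (theta p \<gamma> :: 'a mpoly) \<noteq> 0 \<and> LM (theta p \<gamma> :: 'a mpoly) = Lambda \<gamma>) \<and>
     (\<forall>h \<le> p - 2. \<forall>\<gamma> \<in> PDP_at d (p - 2) h.
        (theta p \<gamma> :: 'a mpoly) \<in> invariants p d \<inter> multilinear d \<and>
        inv_length d (theta p \<gamma> :: 'a mpoly) = h + 1) \<and>
     (\<forall>\<gamma> \<in> IDP d (p - 1).
        (theta p \<gamma> :: 'a mpoly) \<in> invariants p d \<inter> multilinear d \<and>
        inv_length d (theta p \<gamma> :: 'a mpoly) = p) \<and>
     multilinear_sagbi_basis d (basis_B p d :: 'a mpoly set) (invariants p d) \<and>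
     isomorphic tensor_action (tensor_power d :: (nat list \<Rightarrow>\<^sub>0 'a) set) sigma (multilinear d) \<and>
     internal_direct_sum sigma (multilinear d :: 'a mpoly set)
       (PDP d (p - 2) \<union> IDP d (p - 1)) (V_path p) \<and>
     (\<forall>\<gamma> \<in> PDP d (p - 2) \<union> IDP d (p - 1).
        let k = inv_length d (theta p \<gamma> :: 'a mpoly) - 1 in
          indecomposable sigma (V_path p \<gamma> :: 'a mpoly set) \<and>
          isomorphic sigma (V_path p \<gamma> :: 'a mpoly set) jordan (Vn (k + 1)) \<and>
          socle sigma (V_path p \<gamma> :: 'a mpoly set) = fsupp.span {theta p \<gamma>} \<and>
          (\<gamma> \<in> PDP d (p - 2) \<longrightarrow> int k = finishing_height \<gamma>) \<and>
          (\<gamma> \<in> IDP d (p - 1) \<longrightarrow> k = p - 1))"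
proof -
  let ?\<Gamma> = "PDP d (p - 2) \<union> IDP d (p - 1)"
  let ?\<theta> = "theta p :: step list \<Rightarrow> 'a mpoly"
  let ?k = "string_height p"
  let ?T = "(\<lambda>m. Poly_Mapping.single m (1::'a)) ` path_monomial ` {\<gamma>. length \<gamma> = d}"
  note string = theta_string[OF assms]
  have fin: "finite ?\<Gamma>" and inj: "inj_on path_monomial ?\<Gamma>"
    using finite_paths[of d] inj_on_path_monomial[of d]
    by (auto simp: PDP_def IDP_def elim!: rev_finite_subset inj_on_subset)
  have "\<forall>\<gamma>\<in>?\<Gamma>. \<exists>c. c \<noteq> 0 \<and> (sigma.D ^^ ?k \<gamma>) (theta' p \<gamma> :: 'a mpoly) = scale c (?\<theta> \<gamma>)"
    using string(1) by blast
  from bchoice[OF this] obtain c where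
    c: "\<And>\<gamma>. \<gamma> \<in> ?\<Gamma> \<Longrightarrow> c \<gamma> \<noteq> 0 \<and> (sigma.D ^^ ?k \<gamma>) (theta' p \<gamma>) = scale (c \<gamma>) (?\<theta> \<gamma>)"
    by blast
  have comb: "(\<Sum>\<gamma>\<in>?\<Gamma>. scale (a \<gamma>) ((sigma.D ^^ ?k \<gamma>) (theta' p \<gamma>))) =
      (\<Sum>\<gamma>\<in>?\<Gamma>. scale (a \<gamma> * c \<gamma>) (?\<theta> \<gamma>))" for a
    by (intro sum.cong) (simp_all add: c)
  have D_theta: "sigma.D (?\<theta> \<gamma>) = 0" if "\<gamma> \<in> ?\<Gamma>" for \<gamma>
    using string(2)[OF that] by (simp add: sigma.D_def)
  have sub: "submodule sigma (multilinear d :: 'a mpoly set)"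
    unfolding multilinear_eq by (rule submodule_multihomogeneous)
  interpret full_jordan_strings sigma ?\<Gamma> "theta' p :: step list \<Rightarrow> 'a mpoly" ?k "multilinear d" ?T
  proof unfold_locales
    show "finite ?\<Gamma>" by (rule fin)
    show "(sigma.D ^^ Suc (?k \<gamma>)) (theta' p \<gamma> :: 'a mpoly) = 0" if "\<gamma> \<in> ?\<Gamma>" for \<gamma>
      using c[OF that] D_theta[OF that] by (simp add: sigma.D_scale)
    show "a \<gamma> = 0" if eq: "(\<Sum>\<gamma>\<in>?\<Gamma>. scale (a \<gamma>) ((sigma.D ^^ ?k \<gamma>) (theta' p \<gamma> :: 'a mpoly))) = 0"
      and \<gamma>: "\<gamma> \<in> ?\<Gamma>" for a \<gamma>
    proof (rule ccontr)
      assume "a \<gamma> \<noteq> 0"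
      then have "\<exists>\<gamma>\<in>?\<Gamma>. a \<gamma> * c \<gamma> \<noteq> 0" using c \<gamma> by (intro bexI[of _ \<gamma>]) auto
      \<comment> \<open>The polynomials \<open>theta\<close> have pairwise distinct lead monomials,
        so a combination with a nonzero coefficient has a lead monomial and cannot be zero.\<close>
      then have "\<exists>\<delta>\<in>?\<Gamma>. has_lead (\<Sum>\<gamma>\<in>?\<Gamma>. scale (a \<gamma> * c \<gamma>) (?\<theta> \<gamma>)) (path_monomial \<delta>)"
        by (intro has_lead_sum fin string(3) inj disjI2)
      then show False using eq unfolding comb by (auto dest: has_lead_nonzero)
    qed
    show "multilinear d = fsupp.span ?T" by (rule multilinear_eq_span)
    show "finite ?T" using finite_paths by simp
    show "submodule sigma (multilinear d :: 'a mpoly set)" by (rule sub)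
    show "(theta' p \<gamma> :: 'a mpoly) \<in> multilinear d" if "\<gamma> \<in> ?\<Gamma>" for \<gamma>
      by (rule string(4)[OF that])
    show "(\<Sum>\<gamma>\<in>?\<Gamma>. ?k \<gamma> + 1) = card ?T"
      unfolding card_multilinear_basis by (rule sum_string_height[OF assms(1)])
  qed
  have theta_eq: "?\<theta> \<gamma> = scale (inverse (c \<gamma>)) ((sigma.D ^^ ?k \<gamma>) (theta' p \<gamma>))" if "\<gamma> \<in> ?\<Gamma>" for \<gamma>
    using c[OF that] by simp
  have LM: "?\<theta> \<gamma> \<noteq> 0 \<and> LM (?\<theta> \<gamma>) = Lambda \<gamma>" if "\<gamma> \<in> ?\<Gamma>" for \<gamma>
    using has_lead_nonzero[OF string(3)[OF that]] LM_eq[OF string(3)[OF that]] by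
        (simp add: Lambda_eq)
  have inv: "?\<theta> \<gamma> \<in> invariants p d \<inter> multilinear d" if "\<gamma> \<in> ?\<Gamma>" for \<gamma>
  proof -
    have "?\<theta> \<gamma> \<in> multilinear d"
      unfolding theta_eq[OF that] using sub D_pow_v_in_W[OF that]
      by (intro fsupp.subspace_scale) (simp_all add: submodule_def)
    moreover have "(sigma ^^ n) (?\<theta> \<gamma>) = ?\<theta> \<gamma>" for n
      by (induction n) (simp_all add: string(2)[OF that])
    ultimately show ?thesis by (simp add: invariants_def multilinear_def)
  qed
  have len: "inv_length d (?\<theta> \<gamma>) = ?k \<gamma> + 1" if "\<gamma> \<in> ?\<Gamma>" for \<gamma>
  proof -
    \<comment> \<open>The exponents that occur form an initial segment ending at
      \<open>?k \<gamma>\<close>, so the maximum named by \<open>GREATEST\<close> exists.\<close>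
    have "?\<theta> \<gamma> \<in> (sigma.D ^^ r) ` multilinear d \<longleftrightarrow> r \<le> ?k \<gamma>" for r
      unfolding theta_eq[OF that] using c[OF that] by (intro end_in_image_iff that) simp
    then show ?thesis
      unfolding inv_length_def sigma.D_fun_eq by (simp add: Greatest_equality)
  qed
  have PDP_len: "int (?k \<gamma>) = finishing_height \<gamma>" if "\<gamma> \<in> PDP d (p - 2)" for \<gamma>
  proof -
    have "length \<gamma> = d" using that by (simp add: PDP_def)
    then show ?thesis using that PDP_finishing_height[OF that] by (simp add: string_height_def)
  qed
  have IDP_len: "?k \<gamma> = p - 1" if "\<gamma> \<in> IDP d (p - 1)" for \<gamma>
    using IDP_not_PDP[OF assms(1) that] by (simp add: string_height_def)
  have sagbi: "multilinear_sagbi_basis d (basis_B p d :: 'a mpoly set) (invariants p d)"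
    unfolding multilinear_sagbi_basis_def
  proof (intro ballI impI)
    fix f :: "'a mpoly" assume f: "f \<in> invariants p d \<inter> multilinear d" "f \<noteq> 0"
    \<comment> \<open>Puts the exponent 1 within the range \<open>k < p\<close> of
      \<open>invariants\<close>, so that invariance yields \<open>sigma f = f\<close>.\<close>
    have "1 < p" using assms(1) by (rule prime_gt_1_nat)
    then have "(sigma ^^ 1) f = f" using f(1) unfolding invariants_def by blast
    then have "sigma.D f = 0" by (simp add: sigma.D_def)
    then obtain a where a: "f = (\<Sum>\<gamma>\<in>?\<Gamma>. scale (a \<gamma>) ((sigma.D ^^ ?k \<gamma>) (theta' p \<gamma>)))"
      using kernel_D[of f] f(1) by blast
    \<comment> \<open>As a combination of the \<open>theta\<close>, which have distinct lead
      monomials, \<open>f\<close> has the lead monomial of one of them.\<close>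
    have "\<exists>\<gamma>\<in>?\<Gamma>. has_lead f (path_monomial \<gamma>)"
      unfolding a comb using f(2) unfolding a comb
      by (intro has_lead_sum fin string(3) inj disjI1)
    then obtain \<gamma> where \<gamma>: "\<gamma> \<in> ?\<Gamma>" "has_lead f (path_monomial \<gamma>)" by blast
    then have "LM f = LM (?\<theta> \<gamma>)"
      using LM_eq[OF string(3)] LM_eq by simp
    moreover have "LM (?\<theta> \<gamma>) \<in> LM_products (basis_B p d)"
      using lead_generated_theta[OF assms \<gamma>(1)] by (simp add: lead_generated_def)
    ultimately show "\<exists>G e. finite G \<and> G \<subseteq> basis_B p d - {0} \<and> LM f = (\<Prod>g\<in>G. LM g ^ e g)"
      by (simp add: LM_products_def)
  qed
  have module: "indecomposable sigma (V_path p \<gamma> :: 'a mpoly set) \<and>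
      isomorphic sigma (V_path p \<gamma> :: 'a mpoly set) jordan (Vn (?k \<gamma> + 1)) \<and>
      socle sigma (V_path p \<gamma> :: 'a mpoly set) = fsupp.span {?\<theta> \<gamma>}" if "\<gamma> \<in> ?\<Gamma>" for \<gamma>
  proof -
    \<comment> \<open>The socle is obtained as the span of the end of the string, which is
      \<open>theta\<close> only up to the nonzero scalar \<open>c \<gamma>\<close>.\<close>
    have "fsupp.span {scale (c \<gamma>) (?\<theta> \<gamma>)} = fsupp.span {?\<theta> \<gamma>}"
      using fsupp.span_image_scale[of "{?\<theta> \<gamma>}" "\<lambda>_. c \<gamma>"] c[OF that] by simp
    then show ?thesis
      unfolding V_path_def using indecomposable_generated[OF that] isomorphic_generated[OF that]
        socle_generated[OF that] c[OF that] by simp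
  qed
  have direct: "internal_direct_sum sigma (multilinear d :: 'a mpoly set) ?\<Gamma> (V_path p)"
    using internal_direct_sum_generated unfolding V_path_def[abs_def] .
  show ?thesis
  proof (intro conjI)
    show "\<forall>\<gamma>\<in>?\<Gamma>. ?\<theta> \<gamma> \<noteq> 0 \<and> LM (?\<theta> \<gamma>) = Lambda \<gamma>"
      using LM by (rule ballI)
    show "\<forall>h\<le>p - 2. \<forall>\<gamma>\<in>PDP_at d (p - 2) h.
        ?\<theta> \<gamma> \<in> invariants p d \<inter> multilinear d \<and> inv_length d (?\<theta> \<gamma>) = h + 1"
    proof (intro allI impI ballI)
      fix h \<gamma> assume "\<gamma> \<in> PDP_at d (p - 2) h"
      then have \<gamma>: "\<gamma> \<in> PDP d (p - 2)" and h: "finishing_height \<gamma> = int h"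
        by (auto simp: PDP_at_def)
      then have "\<gamma> \<in> ?\<Gamma>" by simp
      from inv[OF this] len[OF this] PDP_len[OF \<gamma>] h
      show "?\<theta> \<gamma> \<in> invariants p d \<inter> multilinear d \<and> inv_length d (?\<theta> \<gamma>) = h + 1"
        by simp
    qed
    show "\<forall>\<gamma>\<in>IDP d (p - 1). ?\<theta> \<gamma> \<in> invariants p d \<inter> multilinear d \<and> inv_length d (?\<theta> \<gamma>) = p"
    proof
      fix \<gamma> assume \<gamma>: "\<gamma> \<in> IDP d (p - 1)"
      then have "\<gamma> \<in> ?\<Gamma>" by simp
      from inv[OF this] len[OF this] IDP_len[OF \<gamma>] prime_gt_0_nat[OF assms(1)]
      show "?\<theta> \<gamma> \<in> invariants p d \<inter> multilinear d \<and> inv_length d (?\<theta> \<gamma>) = p" by simp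
    qed
    show "\<forall>\<gamma>\<in>?\<Gamma>. let k = inv_length d (?\<theta> \<gamma>) - 1 in
          indecomposable sigma (V_path p \<gamma> :: 'a mpoly set) \<and>
          isomorphic sigma (V_path p \<gamma> :: 'a mpoly set) jordan (Vn (k + 1)) \<and>
          socle sigma (V_path p \<gamma> :: 'a mpoly set) = fsupp.span {?\<theta> \<gamma>} \<and>
          (\<gamma> \<in> PDP d (p - 2) \<longrightarrow> int k = finishing_height \<gamma>) \<and>
          (\<gamma> \<in> IDP d (p - 1) \<longrightarrow> k = p - 1)"
    proof
      fix \<gamma> assume \<gamma>: "\<gamma> \<in> ?\<Gamma>"
      have "inv_length d (?\<theta> \<gamma>) - 1 = ?k \<gamma>" using len[OF \<gamma>] by simp
      then show "let k = inv_length d (?\<theta> \<gamma>) - 1 in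
          indecomposable sigma (V_path p \<gamma> :: 'a mpoly set) \<and>
          isomorphic sigma (V_path p \<gamma> :: 'a mpoly set) jordan (Vn (k + 1)) \<and>
          socle sigma (V_path p \<gamma> :: 'a mpoly set) = fsupp.span {?\<theta> \<gamma>} \<and>
          (\<gamma> \<in> PDP d (p - 2) \<longrightarrow> int k = finishing_height \<gamma>) \<and>
          (\<gamma> \<in> IDP d (p - 1) \<longrightarrow> k = p - 1)"
        using module[OF \<gamma>] PDP_len[of \<gamma>] IDP_len[of \<gamma>] by (simp only: Let_def) blast
    qed
  qed (fact sagbi isomorphic_tensor_power_multilinear direct)+
qed

end
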